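(* Fix $T>0$ and let $\mathcal{D}=\{x^{(1)},\dots,x^{(M)}\}$, $\mu^N_t$, $h^N_t$, $\mu_0$, $\pi$, $\alpha$, $\mathcal{G}$ and $E$ be as in the context. As $N\to\infty$, the process $(\mu^N_t,h^N_t)_{t\in[0,T]}$ converges in distribution in the Skorokhod space $D_E([0,T])$ to a process $(\mu_t,h_t)_{t\in[0,T]}$ which satisfies, for every $f\in C^2_b(\mathbb{R}^{1+d})$, every $t\in[0,T]$ and every $x\in\mathcal{D}$, the random ODE $$h_t(x)=h_0(x)+\alpha\int_0^t\int (y-h_s(x'))\,\langle \sigma(w\cdot x)\sigma(w\cdot x'),\mu_s\rangle\,\pi(dx',dy)\,ds+\alpha\int_0^t\int (y-h_s(x'))\,\langle c^2\sigma'(w\cdot x')\sigma'(w\cdot x)\,x\cdot x',\mu_s\rangle\,\pi(dx',dy)\,ds,$$ $$h_0(x)=\mathcal{G}(x),\qquad \langle f,\mu_t\rangle=\langle f,\mu_0\rangle .$$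
   Context: Setting. Let $d,M\ge 1$ and let $(x^{(i)},y^{(i)})_{i=1}^M\subset\mathbb{R}^d\times\mathbb{R}$ be a fixed dataset, $\pi(dx,dy)=\frac1M\sum_{i=1}^M\delta_{(x^{(i)},y^{(i)})}(dx,dy)$, $\mathcal{D}=\{x^{(1)},\dots,x^{(M)}\}$. Let $\sigma\in C^2_b(\mathbb{R})$, i.e. $\sigma$ is twice continuously differentiable, and $\sigma,\sigma',\sigma''$ are bounded. Let $\alpha>0$ be a constant and, for each $N$, let the learning rate be $\alpha^N=\alpha/N$. The initial parameters $(C^i_0,W^i_0)\in\mathbb{R}\times\mathbb{R}^d$, $i=1,\dots,N$, are i.i.d. mean-zero with law $\mu_0(dc,dw)$, $C^i_0$ is independent of $W^i_0$, $C_0^i$ has compact support, and $\int\|w\|\,\mu_0(dc,dw)<\infty$. The samples $(x_k,y_k)_{k\ge 0}$ are i.i.d. from $\pi$ and independent of the initial parameters. For $k\ge0$ and $i=1,\dots,N$, stochastic gradient descent is $$C^i_{k+1}=C^i_k+\tfrac{\alpha^N}{\sqrt N}(y_k-g^N_k(x_k))\sigma(W^i_k\cdot x_k),\qquad W^i_{k+1}=W^i_k+\tfrac{\alpha^N}{\sqrt N}(y_k-g^N_k(x_k))C^i_k\sigma'(W^i_k\cdot x_k)x_k,$$ with network output $g^N_k(x)=\frac{1}{\sqrt N}\sum_{i=1}^N C^i_k\sigma(W^i_k\cdot x)$. Notation. $\langle f,\nu\rangle=\int f\,d\nu$, where the variable of integration in $\mathbb{R}^{1+d}$ is $(c,w)$.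 $\nu^N_k=\frac1N\sum_{i=1}^N\delta_{(C^i_k,W^i_k)}$, $\mu^N_t=\nu^N_{\lfloor Nt\rfloor}$, $h^N_t(x)=g^N_{\lfloor Nt\rfloor}(x)$, $h^N_t=(h^N_t(x^{(1)}),\dots,h^N_t(x^{(M)}))\in\mathbb{R}^M$. $\mathcal{M}(S)$ is the space of probability measures on $S$ with the topology of weak convergence, $E=\mathcal{M}(\mathbb{R}^{1+d})\times\mathbb{R}^M$, and $D_E([0,T])$ is the Skorokhod space of càdlàg $E$-valued paths. $C^2_b(\mathbb{R}^{1+d})$ is the set of twice continuously differentiable functions that are bounded together with their first and second derivatives. $\mathcal{G}=(\mathcal{G}(x))_{x\in\mathcal{D}}\in\mathbb{R}^M$ is the Gaussian limit in distribution of $(g^N_0(x^{(1)}),\dots,g^N_0(x^{(M)}))$ as $N\to\infty$, i.e. the mean-zero Gaussian vector with covariance $\langle c^2\sigma(w\cdot x)\sigma(w\cdot x'),\mu_0\rangle$. The initial condition $h_0=\mathcal{G}$ is understood as $h_0$ being distributed as $\mathcal{G}$. *)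

theory Defs
  imports "HOL-Probability.Probability"
begin

section \<open>Weak convergence and the Skorokhod space\<close>

text \<open>The topology of weak convergence on the Borel probability measures: the coarsest topology
  making \<open>\<nu> \<mapsto> \<integral> f d\<nu>\<close> continuous for every bounded continuous \<open>f\<close>.\<close>

definition weak_topology :: "'a::topological_space measure topology" where
  "weak_topology = topology_generated_by
     {{\<nu> \<in> space (prob_algebra borel). (\<integral>x. f x \<partial>\<nu>) \<in> U} | (f :: 'a \<Rightarrow> real) U.
        continuous_on UNIV f \<and> bounded (range f) \<and> open U}"

lemma topspace_weak_topology:
  "topspace weak_topology = space (prob_algebra (borel :: 'a::topological_space measure))"
proof -
  let ?S = "{{\<nu> \<in> space (prob_algebra borel). (\<integral>x. f x \<partial>\<nu>) \<in> U} | (f :: 'a \<Rightarrow> real) U.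
        continuous_on UNIV f \<and> bounded (range f) \<and> open U}"
  have "space (prob_algebra borel) \<in> ?S"
    by (intro CollectI exI[of _ "\<lambda>_. 0"] exI[of _ UNIV]) auto
  then have "\<Union>?S = space (prob_algebra borel)" by blast
  then show ?thesis by (simp add: weak_topology_def)
qed

lemma continuous_map_weak_topology:
  fixes f :: "'a::topological_space \<Rightarrow> real"
  assumes "continuous_on UNIV f" "bounded (range f)"
  shows "continuous_map weak_topology euclideanreal (\<lambda>\<nu>. \<integral>x. f x \<partial>\<nu>)"
  unfolding continuous_map_alt
proof (intro conjI allI impI)
  fix U :: "real set" assume "openin euclideanreal U"
  then have "(\<lambda>\<nu>. \<integral>x. f x \<partial>\<nu>) -` U \<inter> topspace weak_topology
      \<in> {{\<nu> \<in> space (prob_algebra borel). (\<integral>x. f x \<partial>\<nu>) \<in> U} | (f :: 'a \<Rightarrow> real) U.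
        continuous_on UNIV f \<and> bounded (range f) \<and> open U}"
    using assms by (intro CollectI exI[of _ f] exI[of _ U]) (auto simp: topspace_weak_topology)
  then show "openin weak_topology ((\<lambda>\<nu>. \<integral>x. f x \<partial>\<nu>) -` U \<inter> topspace weak_topology)"
    unfolding weak_topology_def by (rule topology_generated_by_Basis)
qed simp

text \<open>The integrals of a countable family of functions determine weak convergence, and hence embed
  the space of probability measures into \<open>\<real>\<^sup>\<nat>\<close>: every nonnegative bounded lower semicontinuous
  function is an increasing limit of finite maxima of countably many tent functions.\<close>

definition lsc_below :: "real \<Rightarrow> ('a::metric_space \<Rightarrow> real) \<Rightarrow> bool" where
  "lsc_below B g \<longleftrightarrow> (\<forall>x. 0 \<le> g x \<and> g x \<le> B) \<and>
     (\<forall>x a. a < g x \<longrightarrow> (\<exists>e>0. \<forall>y. dist y x < e \<longrightarrow> a < g y))"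

lemma countable_lower_approximation:
  obtains F :: "nat \<Rightarrow> 'a::{metric_space,second_countable_topology} \<Rightarrow> real"
  where "\<And>n. continuous_on UNIV (F n)" "\<And>n. bounded (range (F n))" "\<And>n x. 0 \<le> F n x"
    "\<And>B g x a. lsc_below B g \<Longrightarrow> 0 \<le> a \<Longrightarrow> a < g x \<Longrightarrow> \<exists>n. (\<forall>y. F n y \<le> g y) \<and> a < F n x"
proof -
  obtain D :: "'a set" where D: "countable D" "\<And>U. open U \<Longrightarrow> U \<noteq> {} \<Longrightarrow> \<exists>d\<in>D. d \<in> U"
    using countable_dense_exists by blast
  then have "D \<noteq> {}" by blast
  define tent :: "nat \<times> rat \<times> rat \<times> nat \<Rightarrow> 'a \<Rightarrow> real" where
    "tent = (\<lambda>(i, d, a, k) y. max 0 (min (of_rat a) (real k * (of_rat d - dist y (from_nat_into D i)))))"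
  define F where "F n = tent (from_nat n)" for n
  show ?thesis
  proof (rule that[of F])
    fix n x
    obtain i d a k where n: "(from_nat n :: nat \<times> rat \<times> rat \<times> nat) = (i, d, a, k)"
      by (metis surj_pair)
    show "continuous_on UNIV (F n)"
      unfolding F_def n tent_def by (auto intro!: continuous_intros)
    have "norm (F n y) \<le> max 0 (of_rat a)" for y unfolding F_def n tent_def by auto
    then show "bounded (range (F n))" by (intro boundedI[of _ "max 0 (of_rat a)"]) auto
    show "0 \<le> F n x" unfolding F_def n tent_def by auto
  next
    fix B and g :: "'a \<Rightarrow> real" and x and a :: real assume g: "lsc_below B g" and a: "0 \<le> a" "a < g x"
    obtain b where b: "a < of_rat b" "of_rat b < g x" using of_rat_dense[OF a(2)] by blast
    obtain e where e: "e > 0" "\<And>y. dist y x < e \<Longrightarrow> of_rat b < g y"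
      using g b unfolding lsc_below_def by blast
    obtain d where d: "0 < real_of_rat d" "of_rat d < e / 2" using of_rat_dense[of 0 "e/2"] e by auto
    obtain c where c: "c \<in> D" "dist x c < of_rat d"
      using D(2)[of "ball x (of_rat d)"] d by auto
    obtain i where i: "from_nat_into D i = c" using c D(1) by (metis from_nat_into_to_nat_on)
    obtain k where k: "of_rat b < real k * (of_rat d - dist x c)"
      using c reals_Archimedean3[of "of_rat d - dist x c"] by auto
    let ?n = "to_nat (i, d, b, k)"
    have F: "F ?n = tent (i, d, b, k)" by (simp add: F_def)
    have "F ?n y \<le> g y" for y
    proof (cases "dist y c < of_rat d")
      case True
      have "dist y x \<le> dist y c + dist x c" by (rule dist_triangle2)
      with True c d have "dist y x < e" by simp
      with e have "of_rat b < g y" by blast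
      moreover have "0 \<le> real_of_rat b" using a b by linarith
      then have "F ?n y \<le> of_rat b" unfolding F tent_def by auto
      ultimately show ?thesis by linarith
    next
      case False
      then have "real k * (of_rat d - dist y c) \<le> 0" by (simp add: mult_nonneg_nonpos)
      then have "F ?n y = 0" unfolding F tent_def i[symmetric] by (auto simp: i)
      then show ?thesis using g by (simp add: lsc_below_def)
    qed
    moreover have "a < F ?n x" using a b k unfolding F tent_def by (auto simp: i)
    ultimately show "\<exists>n. (\<forall>y. F n y \<le> g y) \<and> a < F n x" by blast
  qed
qed

lemma prob_lsc_below:
  obtains G :: "nat \<Rightarrow> 'a::{metric_space,second_countable_topology} \<Rightarrow> real"
  where "\<And>n. continuous_on UNIV (G n)" "\<And>n. bounded (range (G n))"
    "\<And>B g \<mu> a. lsc_below B g \<Longrightarrow> g \<in> borel_measurable borel \<Longrightarrow> \<mu> \<in> space (prob_algebra borel) \<Longrightarrow>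
       a < (\<integral>x. g x \<partial>\<mu>) \<Longrightarrow> \<exists>n. (\<forall>y. G n y \<le> g y) \<and> a < (\<integral>x. G n x \<partial>\<mu>)"
proof -
  obtain F :: "nat \<Rightarrow> 'a \<Rightarrow> real"
    where F: "\<And>n. continuous_on UNIV (F n)" "\<And>n. bounded (range (F n))" "\<And>n x. 0 \<le> F n x"
    "\<And>B g x a. lsc_below B g \<Longrightarrow> 0 \<le> a \<Longrightarrow> a < g x \<Longrightarrow> \<exists>n. (\<forall>y. F n y \<le> g y) \<and> a < F n x"
    by (rule countable_lower_approximation) blast
  define H where "H l x = foldr (\<lambda>i r. max (F i x) r) l 0" for l x
  have H_Cons: "H (i # l) = (\<lambda>x. max (F i x) (H l x))" and H_Nil: "H [] = (\<lambda>_. 0)" for i l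
    by (auto simp: H_def)
  have H_cont: "continuous_on UNIV (H l)" for l
    by (induction l) (auto simp: H_Nil H_Cons intro!: continuous_intros F)
  have H_bdd: "bounded (range (H l))" for l
  proof (induction l)
    case (Cons i l)
    obtain a b where "\<And>x. norm (F i x) \<le> a" "\<And>x. norm (H l x) \<le> b"
      using F(2)[of i] Cons unfolding bounded_iff by (meson rangeI)
    then have "norm (H (i # l) x) \<le> max a b" for x
      unfolding H_Cons by (smt (verit) real_norm_def)
    then show ?case by (intro boundedI[of _ "max a b"]) auto
  qed (simp add: H_Nil)
  have H_ge: "F i x \<le> H l x" if "i \<in> set l" for i l x
    using that by (induction l) (auto simp: H_Cons)
  have H_nonneg: "0 \<le> H l x" for l x
    by (induction l) (auto simp: H_Nil H_Cons)
  have H_le: "H l x \<le> b" if "\<And>i. i \<in> set l \<Longrightarrow> F i x \<le> b" "0 \<le> b" for l x b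
    using that by (induction l) (auto simp: H_Nil H_Cons)
  show ?thesis
  proof (rule that[of "\<lambda>n. H (from_nat n)"])
    fix B and g :: "'a \<Rightarrow> real" and \<mu> :: "'a measure" and a :: real
    assume g: "lsc_below B g" "g \<in> borel_measurable borel"
      and \<mu>: "\<mu> \<in> space (prob_algebra borel)" and a: "a < (\<integral>x. g x \<partial>\<mu>)"
    interpret prob_space \<mu> using \<mu> by (simp add: space_prob_algebra)
    have sets[measurable_cong]: "sets \<mu> = sets borel" using \<mu> by (simp add: space_prob_algebra)
    have g0: "0 \<le> g x" "g x \<le> B" for x using g by (auto simp: lsc_below_def)
    define l where "l k = filter (\<lambda>i. \<forall>y. F i y \<le> g y) [0..<k]" for k
    have l_le: "H (l k) x \<le> g x" for k x by (rule H_le) (auto simp: l_def g0)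
    have lim: "(\<lambda>k. H (l k) x) \<longlonglongrightarrow> g x" for x
    proof (rule order_tendstoI)
      fix b assume b: "b < g x"
      show "\<forall>\<^sub>F k in sequentially. b < H (l k) x"
      proof (cases "b < 0")
        case True
        then have "b < H (l k) x" for k using H_nonneg[of "l k" x] by linarith
        then show ?thesis by simp
      next
        case False
        with F(4)[OF g(1) _ b] obtain i where i: "\<forall>y. F i y \<le> g y" "b < F i x" by auto
        have "b < H (l k) x" if "k \<ge> Suc i" for k
          using i that H_ge[of i "l k" x] by (auto simp: l_def)
        then show ?thesis by (auto simp: eventually_sequentially)
      qed
    next
      fix b assume "g x < b"
      then have "H (l k) x < b" for k using l_le[of k x] by linarith
      then show "\<forall>\<^sub>F k in sequentially. H (l k) x < b" by simp
    qed
    have "(\<lambda>k. \<integral>x. H (l k) x \<partial>\<mu>) \<longlonglongrightarrow> (\<integral>x. g x \<partial>\<mu>)"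
    proof (rule integral_dominated_convergence[where w = "\<lambda>_. B"])
      show "H (l k) \<in> borel_measurable \<mu>" for k
        using borel_measurable_continuous_onI[OF H_cont] by measurable
      show "AE x in \<mu>. norm (H (l k) x) \<le> B" for k
        using l_le g0 H_nonneg by (intro AE_I2) (smt (verit) real_norm_def)
    qed (use g lim in auto)
    then have "\<forall>\<^sub>F k in sequentially. a < (\<integral>x. H (l k) x \<partial>\<mu>)" using a by (rule order_tendstoD)
    then obtain k where "a < (\<integral>x. H (l k) x \<partial>\<mu>)" by (auto simp: eventually_sequentially)
    then show "\<exists>n. (\<forall>y. H (from_nat n) y \<le> g y) \<and> a < (\<integral>x. H (from_nat n) x \<partial>\<mu>)"
      using l_le by (intro exI[of _ "to_nat (l k)"]) auto
  qed (use H_cont H_bdd in auto)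
qed

lemma integrable_prob_bounded:
  fixes f :: "'a::topological_space \<Rightarrow> real"
  assumes "\<mu> \<in> space (prob_algebra borel)" "f \<in> borel_measurable borel" "bounded (range f)"
  shows "integrable \<mu> f"
proof -
  interpret prob_space \<mu> using assms by (simp add: space_prob_algebra)
  have [measurable_cong]: "sets \<mu> = sets borel" using assms by (simp add: space_prob_algebra)
  obtain b where "\<And>x. norm (f x) \<le> b" using assms(3) unfolding bounded_iff by blast
  then show ?thesis using assms(2) by (intro integrable_const_bound[of _ b]) auto
qed

lemma metrizable_weak_topology:
  "metrizable_space (weak_topology :: 'a::{metric_space,second_countable_topology} measure topology)"
proof -
  let ?W = "weak_topology :: 'a measure topology" and ?M = "space (prob_algebra (borel :: 'a measure))"
  obtain G :: "nat \<Rightarrow> 'a \<Rightarrow> real"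
    where G: "\<And>n. continuous_on UNIV (G n)" "\<And>n. bounded (range (G n))"
    "\<And>B g \<mu> a. lsc_below B g \<Longrightarrow> g \<in> borel_measurable borel \<Longrightarrow> \<mu> \<in> ?M \<Longrightarrow>
       a < (\<integral>x. g x \<partial>\<mu>) \<Longrightarrow> \<exists>n. (\<forall>y. G n y \<le> g y) \<and> a < (\<integral>x. G n x \<partial>\<mu>)"
    by (rule prob_lsc_below) blast
  define J where "J \<mu> n = (\<integral>x. G n x \<partial>\<mu>)" for \<mu> n
  let ?P = "product_topology (\<lambda>_::nat. euclideanreal) UNIV"
  let ?T = "pullback_topology ?M J ?P"
  have topT: "topspace ?T = ?M" by (auto simp: topspace_pullback_topology)
  have G_int: "integrable \<mu> (G n)" if "\<mu> \<in> ?M" for \<mu> n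
    using that G by (intro integrable_prob_bounded borel_measurable_continuous_onI)
  have J_cont: "continuous_map ?T euclideanreal (\<lambda>\<mu>. J \<mu> n)" for n
  proof -
    have "continuous_map ?T euclideanreal ((\<lambda>v. v n) \<circ> J)"
      by (intro continuous_map_pullback continuous_map_product_projection) simp
    then show ?thesis by (simp add: comp_def)
  qed
  have lsc: "openin ?T {\<mu> \<in> ?M. a < (\<integral>x. g x \<partial>\<mu>)}"
    if g: "lsc_below B g" "g \<in> borel_measurable borel" for B g a
  proof -
    have gi: "integrable \<mu> g" if "\<mu> \<in> ?M" for \<mu>
    proof (rule integrable_prob_bounded[OF that g(2)])
      show "bounded (range g)" using g(1) unfolding lsc_below_def by (auto intro!: boundedI[of _ B])
    qed
    have "{\<mu> \<in> ?M. a < (\<integral>x. g x \<partial>\<mu>)} = (\<Union>n\<in>{n. \<forall>y. G n y \<le> g y}. {\<mu> \<in> ?M. J \<mu> n \<in> {a<..}})"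
    proof (intro equalityI subsetI)
      fix \<mu> assume "\<mu> \<in> {\<mu> \<in> ?M. a < (\<integral>x. g x \<partial>\<mu>)}"
      then show "\<mu> \<in> (\<Union>n\<in>{n. \<forall>y. G n y \<le> g y}. {\<mu> \<in> ?M. J \<mu> n \<in> {a<..}})"
        using G(3)[OF g, of \<mu> a] by (auto simp: J_def)
    next
      fix \<mu> assume "\<mu> \<in> (\<Union>n\<in>{n. \<forall>y. G n y \<le> g y}. {\<mu> \<in> ?M. J \<mu> n \<in> {a<..}})"
      then obtain n where n: "\<forall>y. G n y \<le> g y" "\<mu> \<in> ?M" "a < J \<mu> n" by auto
      have "J \<mu> n \<le> (\<integral>x. g x \<partial>\<mu>)" unfolding J_def
        using n by (intro integral_mono G_int gi) auto
      with n show "\<mu> \<in> {\<mu> \<in> ?M. a < (\<integral>x. g x \<partial>\<mu>)}" by auto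
    qed
    moreover have "openin ?T {\<mu> \<in> ?M. J \<mu> n \<in> {a<..}}" for n
      using openin_continuous_map_preimage[OF J_cont[of n], of "{a<..}"] by (simp add: topT)
    ultimately show ?thesis by auto
  qed
  have inj: "inj_on J ?M"
  proof (rule inj_onI)
    fix \<mu> \<nu> assume \<mu>: "\<mu> \<in> ?M" and \<nu>: "\<nu> \<in> ?M" and eq: "J \<mu> = J \<nu>"
    have le: "measure \<mu> U \<le> measure \<nu> U" if U: "open U" and \<mu>: "\<mu> \<in> ?M" and \<nu>: "\<nu> \<in> ?M"
      and eq: "J \<mu> = J \<nu>" for U \<mu> \<nu>
    proof (rule ccontr)
      have ind: "lsc_below 1 (indicator U :: 'a \<Rightarrow> real)"
        unfolding lsc_below_def
      proof (intro conjI allI impI)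
        fix x a assume a: "a < (indicator U x :: real)"
        show "\<exists>e>0. \<forall>y. dist y x < e \<longrightarrow> a < indicator U y"
        proof (cases "x \<in> U")
          case True
          then obtain e where "e > 0" "\<And>y. dist y x < e \<Longrightarrow> y \<in> U" using U by (metis open_dist)
          then show ?thesis using a True by (intro exI[of _ e]) auto
        next
          case False
          then have "a < indicator U y" for y using a by (auto simp: indicator_def)
          then show ?thesis by (intro exI[of _ 1]) auto
        qed
      qed (auto simp: indicator_def)
      have Um: "U \<in> sets borel" using U by simp
      have s: "sets \<mu> = sets borel" "sets \<nu> = sets borel" using \<mu> \<nu> by (auto simp: space_prob_algebra)
      have int: "(\<integral>x. indicator U x \<partial>\<mu>) = measure \<mu> U" "(\<integral>x. indicator U x \<partial>\<nu>) = measure \<nu> U"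
        using sets_eq_imp_space_eq[OF s(1)] sets_eq_imp_space_eq[OF s(2)] by simp_all
      assume "\<not> ?thesis"
      then have "measure \<nu> U < (\<integral>x. indicator U x \<partial>\<mu>)" using int by simp
      from G(3)[OF ind _ \<mu> this] Um obtain n
        where n: "\<And>y. G n y \<le> indicator U y" "measure \<nu> U < J \<mu> n" by (auto simp: J_def)
      have "J \<nu> n \<le> (\<integral>x. indicator U x \<partial>\<nu>)" unfolding J_def
        using n Um \<nu> by (intro integral_mono G_int integrable_prob_bounded)
          (auto intro!: boundedI[of _ 1] simp: indicator_def)
      then show False using n eq int by simp
    qed
    interpret m: prob_space \<mu> using \<mu> by (simp add: space_prob_algebra)
    interpret n: prob_space \<nu> using \<nu> by (simp add: space_prob_algebra)
    show "\<mu> = \<nu>"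
    proof (rule measure_eqI_generator_eq[where E = "{U. open U}" and \<Omega> = UNIV and A = "\<lambda>_. UNIV"])
      show "Int_stable {U :: 'a set. open U}" by (auto simp: Int_stable_def)
      fix U :: "'a set" assume "U \<in> {U. open U}"
      then have "measure \<mu> U = measure \<nu> U" using le \<mu> \<nu> eq by (auto intro!: antisym)
      then show "emeasure \<mu> U = emeasure \<nu> U"
        by (simp add: m.emeasure_eq_measure n.emeasure_eq_measure)
    qed (use \<mu> \<nu> in \<open>auto simp: space_prob_algebra borel_def\<close>)
  qed
  have f_cont: "continuous_map ?T euclideanreal (\<lambda>\<mu>. \<integral>x. f x \<partial>\<mu>)"
    if f: "continuous_on UNIV f" "bounded (range f)" for f
  proof -
    obtain b where b: "\<And>x. \<bar>f x\<bar> \<le> b" using f(2) unfolding bounded_iff real_norm_def by blast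
    have shift: "(\<integral>x. b + f x \<partial>\<mu>) = b + (\<integral>x. f x \<partial>\<mu>)" if "\<mu> \<in> ?M" "continuous_on UNIV f" "bounded (range f)" for \<mu> f
    proof -
      interpret prob_space \<mu> using that by (simp add: space_prob_algebra)
      have "integrable \<mu> f" using that by (intro integrable_prob_bounded borel_measurable_continuous_onI)
      then show ?thesis by (simp add: prob_space)
    qed
    have up: "openin ?T {\<mu> \<in> ?M. a < (\<integral>x. f x \<partial>\<mu>)}"
      if f: "continuous_on UNIV f" "bounded (range f)" "\<And>x. \<bar>f x\<bar> \<le> b" for f a
    proof -
      have "lsc_below (2 * b) (\<lambda>x. b + f x)"
        unfolding lsc_below_def
      proof (intro conjI allI impI)
        fix x show "0 \<le> b + f x" "b + f x \<le> 2 * b" using f(3)[of x] by auto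
      next
        fix x a assume a: "a < b + f x"
        have "open {y. a < b + f y}" by (intro open_Collect_less continuous_intros f(1))
        with a show "\<exists>e>0. \<forall>y. dist y x < e \<longrightarrow> a < b + f y" by (auto simp: open_dist)
      qed
      moreover have "(\<lambda>x. b + f x) \<in> borel_measurable borel"
        by (intro borel_measurable_continuous_onI continuous_intros f(1))
      ultimately have "openin ?T {\<mu> \<in> ?M. b + a < (\<integral>x. b + f x \<partial>\<mu>)}" by (rule lsc)
      moreover have "{\<mu> \<in> ?M. b + a < (\<integral>x. b + f x \<partial>\<mu>)} = {\<mu> \<in> ?M. a < (\<integral>x. f x \<partial>\<mu>)}"
        using shift f by auto
      ultimately show ?thesis by simp
    qed
    have "openin ?T {\<mu> \<in> ?M. (\<integral>x. f x \<partial>\<mu>) < a}" for a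
    proof -
      have "bounded (range (\<lambda>x. - f x))" using b by (auto intro!: boundedI[of _ b])
      then have "openin ?T {\<mu> \<in> ?M. - a < (\<integral>x. - f x \<partial>\<mu>)}"
        using f b by (intro up continuous_intros) auto
      then show ?thesis by simp
    qed
    then show ?thesis
      using up[OF f b] by (simp add: continuous_map_upper_lower_semicontinuous_lt topT)
  qed
  have openT: "openin ?T U" if "openin ?W U" for U
  proof -
    have "generate_topology_on {{\<nu> \<in> ?M. (\<integral>x. f x \<partial>\<nu>) \<in> U} | (f :: 'a \<Rightarrow> real) U.
        continuous_on UNIV f \<and> bounded (range f) \<and> open U} U"
      using that unfolding weak_topology_def by (rule openin_topology_generated_by)
    moreover have "openin ?T V" if "V \<in> {{\<nu> \<in> ?M. (\<integral>x. f x \<partial>\<nu>) \<in> U} | (f :: 'a \<Rightarrow> real) U.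
        continuous_on UNIV f \<and> bounded (range f) \<and> open U}" for V
      using that openin_continuous_map_preimage[OF f_cont] by (auto simp: topT)
    ultimately show ?thesis
      using generate_topology_on_coarsest[OF istopology_openin] by blast
  qed
  have "continuous_map ?W ?P J"
    unfolding continuous_map_componentwise_UNIV J_def
    using continuous_map_weak_topology G by blast
  moreover have "\<exists>V. openin ?P V \<and> J ` U = V \<inter> J ` ?M" if U: "openin ?W U" for U
  proof -
    obtain V where V: "openin ?P V" "U = J -` V \<inter> ?M"
      using openT[OF U] by (auto simp: openin_pullback_topology)
    then show ?thesis by (intro exI[of _ V]) auto
  qed
  then have "open_map ?W (subtopology ?P (J ` ?M)) J"
    by (auto simp: open_map_def openin_subtopology)
  ultimately have "homeomorphic_map ?W (subtopology ?P (J ` ?M)) J"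
    using inj by (intro bijective_open_imp_homeomorphic_map)
      (auto simp: continuous_map_in_subtopology topspace_weak_topology)
  then have "?W homeomorphic_space subtopology ?P (J ` ?M)" by (rule homeomorphic_map_imp_homeomorphic_space)
  moreover have "metrizable_space ?P"
    by (auto simp: metrizable_space_product_topology metrizable_space_euclidean)
  ultimately show ?thesis
    by (simp add: homeomorphic_metrizable_space metrizable_space_subtopology)
qed

lemma metrizable_state_topology:
  "\<exists>m. mtopology_of m = prod_topology
     (weak_topology :: 'a::{metric_space,second_countable_topology} measure topology)
     (euclidean :: 'b::metric_space topology)"
proof -
  have "metrizable_space (prod_topology (weak_topology :: 'a measure topology) (euclidean :: 'b topology))"
    by (simp add: metrizable_space_prod_topology metrizable_weak_topology metrizable_space_euclidean)
  then show ?thesis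
    by (metis metrizable_space_def Metric_space.mtopology_of)
qed

definition cadlag_paths :: "real \<Rightarrow> 'e topology \<Rightarrow> (real \<Rightarrow> 'e) set" where
  "cadlag_paths T E = {\<omega> \<in> {0..T} \<rightarrow>\<^sub>E topspace E.
     (\<forall>t\<in>{0..<T}. limitin E \<omega> (\<omega> t) (at_right t)) \<and>
     (\<forall>t\<in>{0<..T}. \<exists>l. limitin E \<omega> l (at_left t))}"

text \<open>An increasing surjection of \<open>[0,T]\<close> onto itself is automatically continuous.\<close>

definition time_changes :: "real \<Rightarrow> (real \<Rightarrow> real) set" where
  "time_changes T = {\<theta>. strict_mono_on {0..T} \<theta> \<and> \<theta> ` {0..T} = {0..T}}"

definition skorokhod_dist ::
    "real \<Rightarrow> 'e metric \<Rightarrow> (real \<Rightarrow> 'e) \<Rightarrow> (real \<Rightarrow> 'e) \<Rightarrow> real" where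
  "skorokhod_dist T m \<omega> \<omega>' = Inf {e. e > 0 \<and> (\<exists>\<theta>\<in>time_changes T. \<forall>t\<in>{0..T}.
     \<bar>\<theta> t - t\<bar> \<le> e \<and> mdist m (\<omega> t) (\<omega>' (\<theta> t)) \<le> e)}"

text \<open>The Skorokhod (J1) topology on the paths in a metrizable space \<open>E\<close>. All metrics
  that induce the topology of \<open>E\<close> give the same Skorokhod topology, so openness is
  asked for each of them and no particular metric has to be singled out. Such a metric
  exists for the state space used below, by \<open>metrizable_state_topology\<close>.\<close>

definition skorokhod_open :: "real \<Rightarrow> 'e topology \<Rightarrow> (real \<Rightarrow> 'e) set \<Rightarrow> bool" where
  "skorokhod_open T E U \<longleftrightarrow> U \<subseteq> cadlag_paths T E \<and>
     (\<forall>m. mtopology_of m = E \<longrightarrow>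
        (\<forall>\<omega>\<in>U. \<exists>r>0. \<forall>\<omega>'\<in>cadlag_paths T E. skorokhod_dist T m \<omega> \<omega>' < r \<longrightarrow> \<omega>' \<in> U))"

definition skorokhod_topology :: "real \<Rightarrow> 'e topology \<Rightarrow> (real \<Rightarrow> 'e) topology" where
  "skorokhod_topology T E = topology (skorokhod_open T E)"

lemma skorokhod_openD:
  assumes "skorokhod_open T E U" "mtopology_of m = E" "\<omega> \<in> U"
  shows "\<exists>r>0. \<forall>\<omega>'\<in>cadlag_paths T E. skorokhod_dist T m \<omega> \<omega>' < r \<longrightarrow> \<omega>' \<in> U"
proof -
  have "\<forall>m. mtopology_of m = E \<longrightarrow> (\<forall>\<omega>\<in>U. \<exists>r>0. \<forall>\<omega>'\<in>cadlag_paths T E. skorokhod_dist T m \<omega> \<omega>' < r \<longrightarrow> \<omega>' \<in> U)"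
    using assms(1) unfolding skorokhod_open_def by (rule conjunct2)
  then show ?thesis using assms(2,3) by simp
qed

lemma istopology_skorokhod_open: "istopology (skorokhod_open T E)"
  unfolding istopology_def
proof (intro conjI allI impI)
  fix S U assume S: "skorokhod_open T E S" and U: "skorokhod_open T E U"
  show "skorokhod_open T E (S \<inter> U)"
    unfolding skorokhod_open_def
  proof (intro conjI allI impI ballI)
    show "S \<inter> U \<subseteq> cadlag_paths T E" using S by (auto simp: skorokhod_open_def)
    fix m \<omega> assume m: "mtopology_of m = E" and \<omega>: "\<omega> \<in> S \<inter> U"
    have "\<exists>r>0. \<forall>\<omega>'\<in>cadlag_paths T E. skorokhod_dist T m \<omega> \<omega>' < r \<longrightarrow> \<omega>' \<in> S"
      using \<omega> by (intro skorokhod_openD[OF S m]) simp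
    then obtain r where r: "r > 0" "\<forall>\<omega>'\<in>cadlag_paths T E. skorokhod_dist T m \<omega> \<omega>' < r \<longrightarrow> \<omega>' \<in> S" by (elim exE conjE)
    have "\<exists>r>0. \<forall>\<omega>'\<in>cadlag_paths T E. skorokhod_dist T m \<omega> \<omega>' < r \<longrightarrow> \<omega>' \<in> U"
      using \<omega> by (intro skorokhod_openD[OF U m]) simp
    then obtain s where s: "s > 0" "\<forall>\<omega>'\<in>cadlag_paths T E. skorokhod_dist T m \<omega> \<omega>' < s \<longrightarrow> \<omega>' \<in> U" by (elim exE conjE)
    show "\<exists>r>0. \<forall>\<omega>'\<in>cadlag_paths T E. skorokhod_dist T m \<omega> \<omega>' < r \<longrightarrow> \<omega>' \<in> S \<inter> U"
      using r s by (intro exI[of _ "min r s"]) simp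
  qed
next
  fix K assume K: "\<forall>S\<in>K. skorokhod_open T E S"
  show "skorokhod_open T E (\<Union>K)"
    unfolding skorokhod_open_def
  proof (intro conjI allI impI ballI)
    show "\<Union>K \<subseteq> cadlag_paths T E" using K by (auto simp: skorokhod_open_def)
    fix m \<omega> assume m: "mtopology_of m = E" and "\<omega> \<in> \<Union>K"
    then obtain S where S: "S \<in> K" "\<omega> \<in> S" by auto
    with K have "skorokhod_open T E S" by simp
    then have "\<exists>r>0. \<forall>\<omega>'\<in>cadlag_paths T E. skorokhod_dist T m \<omega> \<omega>' < r \<longrightarrow> \<omega>' \<in> S"
      using m S(2) by (rule skorokhod_openD)
    then obtain r where r: "r > 0" "\<forall>\<omega>'\<in>cadlag_paths T E. skorokhod_dist T m \<omega> \<omega>' < r \<longrightarrow> \<omega>' \<in> S" by (elim exE conjE)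
    show "\<exists>r>0. \<forall>\<omega>'\<in>cadlag_paths T E. skorokhod_dist T m \<omega> \<omega>' < r \<longrightarrow> \<omega>' \<in> \<Union>K"
      using r S(1) by (intro exI[of _ r]) auto
  qed
qed

lemma openin_skorokhod_topology: "openin (skorokhod_topology T E) U \<longleftrightarrow> skorokhod_open T E U"
  by (simp add: skorokhod_topology_def istopology_skorokhod_open)

lemma topspace_skorokhod_topology: "topspace (skorokhod_topology T E) = cadlag_paths T E"
proof -
  have "skorokhod_open T E (cadlag_paths T E)"
    unfolding skorokhod_open_def by (auto intro: exI[of _ 1])
  then show ?thesis
    unfolding topspace_def openin_skorokhod_topology by (auto simp: skorokhod_open_def)
qed

definition borel_of :: "'a topology \<Rightarrow> 'a measure" where
  "borel_of S = sigma (topspace S) {U. openin S U}"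

definition converges_in_distribution ::
    "'s topology \<Rightarrow> (nat \<Rightarrow> 'a measure) \<Rightarrow> (nat \<Rightarrow> 'a \<Rightarrow> 's) \<Rightarrow> 'b measure \<Rightarrow> ('b \<Rightarrow> 's) \<Rightarrow> bool" where
  "converges_in_distribution S P Z Q Z' \<longleftrightarrow>
     (\<forall>N\<ge>1. Z N \<in> P N \<rightarrow>\<^sub>M borel_of S) \<and> Z' \<in> Q \<rightarrow>\<^sub>M borel_of S \<and>
     (\<forall>F. continuous_map S euclideanreal F \<and> bounded (F ` topspace S) \<longrightarrow>
        (\<lambda>N. \<integral>\<omega>. F (Z N \<omega>) \<partial>P N) \<longlonglongrightarrow> (\<integral>\<omega>. F (Z' \<omega>) \<partial>Q))"

section \<open>Test functions, independence and Gaussian vectors\<close>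

definition C2_b :: "('a::real_normed_vector \<Rightarrow> real) \<Rightarrow> bool" where
  "C2_b f \<longleftrightarrow> (\<exists>(f' :: 'a \<Rightarrow> ('a \<Rightarrow>\<^sub>L real)) (f'' :: 'a \<Rightarrow> ('a \<Rightarrow>\<^sub>L ('a \<Rightarrow>\<^sub>L real))).
     (\<forall>x. (f has_derivative blinfun_apply (f' x)) (at x)) \<and> (\<forall>x. (f' has_derivative blinfun_apply (f'' x)) (at x)) \<and>
     continuous_on UNIV f'' \<and>
     bounded (range f) \<and> bounded (range f') \<and> bounded (range f''))"

text \<open>Independence of two random variables of possibly different types; the library's
  \<open>indep_var\<close> needs them to have the same type.\<close>

definition indep_rvs :: "'a measure \<Rightarrow> 'b measure \<Rightarrow> ('a \<Rightarrow> 'b) \<Rightarrow> 'c measure \<Rightarrow> ('a \<Rightarrow> 'c) \<Rightarrow> bool" where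
  "indep_rvs P S U S' V \<longleftrightarrow> U \<in> P \<rightarrow>\<^sub>M S \<and> V \<in> P \<rightarrow>\<^sub>M S' \<and>
     prob_space.indep_set P {U -` A \<inter> space P | A. A \<in> sets S} {V -` B \<inter> space P | B. B \<in> sets S'}"

definition centered_normal :: "real \<Rightarrow> real measure" where
  "centered_normal v = (if v = 0 then return borel 0 else density lborel (normal_density 0 (sqrt v)))"

text \<open>Covariance matrices may be singular, so a Gaussian vector is characterised by its linear
  functionals being normal, with variance zero allowed.\<close>

definition centered_gaussian :: "(real^'m) measure \<Rightarrow> real^'m^'m \<Rightarrow> bool" where
  "centered_gaussian \<nu> S \<longleftrightarrow> prob_space \<nu> \<and> sets \<nu> = sets borel \<and>
     (\<forall>u. distr \<nu> borel (\<lambda>v. u \<bullet> v) = centered_normal (u \<bullet> (S *v u)))"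

section \<open>Stochastic gradient descent for the one-layer network\<close>

text \<open>\<open>(1 / card I) \<Sum>i\<in>I. \<delta>\<^bsub>z i\<^esub>\<close>, for finite nonempty \<open>I\<close>\<close>

definition empirical :: "'i set \<Rightarrow> ('i \<Rightarrow> 'a::topological_space) \<Rightarrow> 'a measure" where
  "empirical I z = distr (uniform_count_measure I) borel z"

type_synonym 'd param = "real \<times> (real^'d)"

definition network :: "(real \<Rightarrow> real) \<Rightarrow> nat \<Rightarrow> (nat \<Rightarrow> 'd param) \<Rightarrow> real^'d::finite \<Rightarrow> real" where
  "network \<sigma> N p x = 1 / sqrt N * (\<Sum>i=1..N. fst (p i) * \<sigma> (snd (p i) \<bullet> x))"

primrec sgd :: "(real \<Rightarrow> real) \<Rightarrow> real \<Rightarrow> nat \<Rightarrow> (nat \<Rightarrow> 'd param) \<Rightarrow>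
    (nat \<Rightarrow> (real^'d::finite) \<times> real) \<Rightarrow> nat \<Rightarrow> nat \<Rightarrow> 'd param" where
  "sgd \<sigma> \<alpha> N p\<^sub>0 z 0 = p\<^sub>0"
| "sgd \<sigma> \<alpha> N p\<^sub>0 z (Suc k) = (\<lambda>i.
     let p = sgd \<sigma> \<alpha> N p\<^sub>0 z k; (C, W) = p i; (x, y) = z k;
         r = (\<alpha> / N) / sqrt N * (y - network \<sigma> N p x)
     in (C + r * \<sigma> (W \<bullet> x), W + (r * C * deriv \<sigma> (W \<bullet> x)) *\<^sub>R x))"

text \<open>Randomness driving the network of width \<open>N\<close>: parameters \<open>p\<^sub>0 i\<close>, \<open>1 \<le> i \<le> N\<close>,
  i.i.d. with law \<open>\<mu>\<^sub>0\<close>; samples \<open>z k\<close> i.i.d. with law \<open>\<pi>\<close>; the two families are independent.\<close>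

definition sgd_inputs :: "'a measure \<Rightarrow> nat \<Rightarrow> 'd::finite param measure \<Rightarrow> ((real^'d) \<times> real) measure \<Rightarrow>
    (nat \<Rightarrow> 'a \<Rightarrow> 'd param) \<Rightarrow> (nat \<Rightarrow> 'a \<Rightarrow> (real^'d) \<times> real) \<Rightarrow> bool" where
  "sgd_inputs P N \<mu>\<^sub>0 \<pi> p\<^sub>0 z \<longleftrightarrow> prob_space P \<and>
     prob_space.indep_vars P (\<lambda>_. borel) p\<^sub>0 {1..N} \<and> (\<forall>i\<in>{1..N}. distr P borel (p\<^sub>0 i) = \<mu>\<^sub>0) \<and>
     prob_space.indep_vars P (\<lambda>_. borel) z UNIV \<and> (\<forall>k. distr P borel (z k) = \<pi>) \<and>
     indep_rvs P
       (PiM {1..N} (\<lambda>_. borel)) (\<lambda>\<omega>. \<lambda>i\<in>{1..N}. p\<^sub>0 i \<omega>)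
       (PiM UNIV (\<lambda>_. borel)) (\<lambda>\<omega> k. z k \<omega>)"

section \<open>The rescaled process and its state space\<close>

abbreviation state_topology :: "('d::finite param measure \<times> (real^'m::finite)) topology" where
  "state_topology \<equiv> prod_topology weak_topology euclidean"

text \<open>\<open>t \<mapsto> (\<mu>\<^sup>N\<^sub>t, h\<^sup>N\<^sub>t)\<close> on \<open>[0,T]\<close>; component \<open>i\<close> of \<open>h\<^sup>N\<^sub>t\<close> is \<open>h\<^sup>N\<^sub>t(X i)\<close>.\<close>

definition sgd_path :: "(real \<Rightarrow> real) \<Rightarrow> real \<Rightarrow> real \<Rightarrow> ('m \<Rightarrow> real^'d) \<Rightarrow> nat \<Rightarrow>
    (nat \<Rightarrow> 'd::finite param) \<Rightarrow> (nat \<Rightarrow> (real^'d) \<times> real) \<Rightarrow>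
    real \<Rightarrow> 'd param measure \<times> (real^'m::finite)" where
  "sgd_path \<sigma> \<alpha> T X N p\<^sub>0 z = (\<lambda>t\<in>{0..T}. let p = sgd \<sigma> \<alpha> N p\<^sub>0 z (nat \<lfloor>N * t\<rfloor>) in
     (empirical {1..N} p, \<chi> i. network \<sigma> N p (X i)))"

end

theory Submission
  imports Defs
begin

text \<open>The parameters move by \<open>O(1/\<surd>N)\<close> up to time \<open>N T\<close>, so \<open>\<mu>\<close> stays at \<open>\<mu>\<^sub>0\<close> and \<open>h\<close> solves the linear
  equation \<open>h' = (\<alpha>/M) A (Y - h)\<close>, where \<open>A\<close> is the tangent kernel averaged over \<open>\<mu>\<^sub>0\<close>; the limit path is
  a continuous function of its starting value. Suppose that the initial network output is bounded,
  that the empirical averages of finitely many functions of the initial parameters are close to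
  their means, and that the frequencies of the samples are close to their means at all times up to
  \<open>N T\<close>. Then the trajectory of the descent is uniformly close to the limit path started from the
  initial network output. This is a deterministic estimate by summation by parts and a discrete
  Gronwall inequality, so neither martingales nor tightness in the Skorokhod space are needed.
  Hoeffding's inequality bounds the probability of the exceptional event, and the initial network
  output converges by the multivariate central limit theorem.\<close>

section \<open>The Skorokhod topology\<close>

text \<open>Scaling: one step changes a parameter by order \<open>N^(-3/2)\<close>, so
  \<open>N * T\<close> steps move it by order \<open>N^(-1/2)\<close>. The output divides a sum over
  \<open>N\<close> neurons by \<open>sqrt N\<close>, so one step changes it by order
  \<open>1/N\<close> and the total change is of order 1. The initial output stays bounded in
  probability because \<open>c * \<sigma> (w \<bullet> x)\<close> has mean zero, which is where the
  independence of \<open>c\<close> and \<open>w\<close> enters. The obstacle on the side of the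
  limit is topological: openness in the Skorokhod space refers to every metric of the state space, a
  continuous \<open>F\<close> need not be uniformly continuous, and measurability has to be derived
  from continuity of explicit maps. Hence closeness of states is phrased through finitely many test
  functions, and the initial output is confined to a compact ball up to small probability. The limit
  law is the image of a Gaussian law on starting values. The set of limit paths is shown to be
  closed, so that the differential equation, which each of them satisfies, holds almost surely under
  this law.\<close>

lemma cadlag_paths_in_space:
  "\<omega> \<in> cadlag_paths T E \<Longrightarrow> t \<in> {0..T} \<Longrightarrow> \<omega> t \<in> topspace E"
  by (auto simp: cadlag_paths_def)

lemma mdist_limitin:
  assumes "limitin (mtopology_of m) f l F" "r > 0"
  shows "\<forall>\<^sub>F x in F. f x \<in> mspace m \<and> mdist m (f x) l < r"
proof -
  interpret Metric_space "mspace m" "mdist m" by (rule Metric_space_mspace_mdist)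
  show ?thesis using assms unfolding mtopology_of_def limitin_metric by blast
qed

lemma mdist_limitin_space: "limitin (mtopology_of m) f l F \<Longrightarrow> l \<in> mspace m"
  using limitin_topspace by fastforce

lemma mdist_openin:
  assumes "openin (mtopology_of m) U" "x \<in> U"
  obtains r where "r > 0" "\<And>y. y \<in> mspace m \<Longrightarrow> mdist m x y < r \<Longrightarrow> y \<in> U"
proof -
  interpret Metric_space "mspace m" "mdist m" by (rule Metric_space_mspace_mdist)
  obtain r where "r > 0" "mball x r \<subseteq> U"
    using assms unfolding mtopology_of_def openin_mtopology by blast
  moreover have "x \<in> mspace m" using openin_subset[OF assms(1)] assms(2) by auto
  ultimately show ?thesis using that[of r] by (auto simp: subset_iff)
qed

lemma openin_mball: "openin (mtopology_of m) {y \<in> mspace m. mdist m x y < r}" if "x \<in> mspace m"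
proof -
  interpret Metric_space "mspace m" "mdist m" by (rule Metric_space_mspace_mdist)
  have "{y \<in> mspace m. mdist m x y < r} = mball x r" using that by auto
  then show ?thesis unfolding mtopology_of_def by simp
qed

lemma mdist_self: "x \<in> mspace m \<Longrightarrow> mdist m x x = 0"
  by (rule Metric_space.mdist_zero[OF Metric_space_mspace_mdist])

text \<open>One-sided limits bound the path on both sides of each time, and bisection
  (\<open>Bolzano\<close>) joins the local bounds. The value at the time itself is bounded
  separately, both limits being taken over punctured neighbourhoods.\<close>

lemma cadlag_paths_bounded:
  assumes E: "mtopology_of m = E" and \<omega>: "\<omega> \<in> cadlag_paths T E" and x: "x \<in> mspace m" and T: "T > 0"
  shows "\<exists>B. \<forall>t\<in>{0..T}. mdist m x (\<omega> t) \<le> B"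
proof -
  have sp: "\<omega> t \<in> mspace m" if "t \<in> {0..T}" for t
    using cadlag_paths_in_space[OF \<omega> that] E by auto
  \<comment> \<open>The intersection is kept because the small intervals around \<open>u\<close> in
    the bisection may leave \<open>{0..T}\<close>.\<close>
  have "\<exists>B. \<forall>t\<in>{0..T}\<inter>{0..T}. mdist m x (\<omega> t) \<le> B"
  proof (rule Bolzano[where P = "\<lambda>a b. \<exists>B. \<forall>t\<in>{a..b}\<inter>{0..T}. mdist m x (\<omega> t) \<le> B"])
    fix a b c :: real assume "\<exists>B. \<forall>t\<in>{a..b} \<inter> {0..T}. mdist m x (\<omega> t) \<le> B"
      "\<exists>B. \<forall>t\<in>{b..c} \<inter> {0..T}. mdist m x (\<omega> t) \<le> B"
    then obtain B B' where B: "\<And>t. t\<in>{a..b} \<inter> {0..T} \<Longrightarrow> mdist m x (\<omega> t) \<le> B"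
      "\<And>t. t\<in>{b..c} \<inter> {0..T} \<Longrightarrow> mdist m x (\<omega> t) \<le> B'" by blast
    have "mdist m x (\<omega> t) \<le> max B B'" if "t \<in> {a..c} \<inter> {0..T}" for t
      using B[of t] that by (cases "t \<le> b") auto
    then show "\<exists>B. \<forall>t\<in>{a..c} \<inter> {0..T}. mdist m x (\<omega> t) \<le> B" by blast
  next
    fix u assume u: "0 \<le> u" "u \<le> T"
    have *: "\<exists>d>0. \<exists>B. \<forall>t. P t \<and> \<bar>t - u\<bar> < d \<longrightarrow> mdist m x (\<omega> t) \<le> B"
      if l: "limitin E \<omega> l (at u within {t. P t})" and u: "\<not> P u" for P l
    proof -
      have l': "l \<in> mspace m" using mdist_limitin_space l E by metis
      have "\<forall>\<^sub>F t in at u within {t. P t}. \<omega> t \<in> mspace m \<and> mdist m (\<omega> t) l < 1"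
        using l E by (intro mdist_limitin) auto
      then obtain d where d: "d > 0" "\<And>t. P t \<Longrightarrow> t \<noteq> u \<Longrightarrow> \<bar>t - u\<bar> < d \<Longrightarrow> \<omega> t \<in> mspace m \<and> mdist m (\<omega> t) l < 1"
        unfolding eventually_at by (auto simp: dist_real_def)
      have "mdist m x (\<omega> t) \<le> mdist m x l + 1" if "P t" "\<bar>t - u\<bar> < d" for t
      proof -
        have "t \<noteq> u" using that u by auto
        then show ?thesis
          using d(2)[of t] that mdist_triangle[OF x l', of "\<omega> t"] by (auto simp: mdist_commute)
      qed
      with d(1) show ?thesis by blast
    qed
    have R: "\<exists>d>0. \<exists>B. \<forall>t. u < t \<and> t \<in> {0..T} \<and> \<bar>t - u\<bar> < d \<longrightarrow> mdist m x (\<omega> t) \<le> B"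
    proof (cases "u = T")
      case False
      then have "limitin E \<omega> (\<omega> u) (at u within {t. u < t})"
        using \<omega> u by (auto simp: cadlag_paths_def greaterThan_def)
      from *[OF this] show ?thesis by auto
    qed (auto intro: exI[of _ 1])
    have L: "\<exists>d>0. \<exists>B. \<forall>t. t < u \<and> t \<in> {0..T} \<and> \<bar>t - u\<bar> < d \<longrightarrow> mdist m x (\<omega> t) \<le> B"
    proof (cases "u = 0")
      case False
      then have "u \<in> {0<..T}" using u by auto
      then obtain l where "limitin E \<omega> l (at u within {t. t < u})"
        using \<omega> unfolding cadlag_paths_def lessThan_def by blast
      from *[OF this] show ?thesis by auto
    qed (auto intro: exI[of _ 1])
    obtain d B d' B' where d: "d > 0" "d' > 0"
      "\<And>t. u < t \<Longrightarrow> t \<in> {0..T} \<Longrightarrow> \<bar>t - u\<bar> < d \<Longrightarrow> mdist m x (\<omega> t) \<le> B"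
      "\<And>t. t < u \<Longrightarrow> t \<in> {0..T} \<Longrightarrow> \<bar>t - u\<bar> < d' \<Longrightarrow> mdist m x (\<omega> t) \<le> B'"
      using L R by metis
    define K where "K = max (mdist m x (\<omega> u)) (max B B')"
    have *: "mdist m x (\<omega> t) \<le> K" if "t \<in> {0..T}" "\<bar>t - u\<bar> < min d d'" for t
      using d(3,4)[of t] that by (cases t u rule: linorder_cases) (auto simp: K_def)
    then have "\<forall>a b. a \<le> u \<and> u \<le> b \<and> b - a < min d d' \<longrightarrow> (\<forall>t\<in>{a..b} \<inter> {0..T}. mdist m x (\<omega> t) \<le> K)"
      by (intro allI impI ballI) (auto intro!: *)
    then show "\<exists>d>0. \<forall>a b. a \<le> u \<and> u \<le> b \<and> b - a < d \<longrightarrow> (\<exists>B. \<forall>t\<in>{a..b} \<inter> {0..T}. mdist m x (\<omega> t) \<le> B)"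
      using d(1,2) by (intro exI[of _ "min d d'"]) (auto intro!: exI[of _ K])
  qed (use T in simp)
  then show ?thesis by simp
qed

section \<open>Time changes and the Skorokhod distance\<close>

lemma id_time_change: "(\<lambda>t. t) \<in> time_changes T"
  by (auto simp: time_changes_def strict_mono_on_def)

lemma skorokhod_dist_le:
  assumes "e > 0" "\<And>t. t \<in> {0..T} \<Longrightarrow> mdist m (\<omega> t) (\<omega>' t) \<le> e"
  shows "skorokhod_dist T m \<omega> \<omega>' \<le> e"
  unfolding skorokhod_dist_def
proof (rule cInf_lower)
  show "bdd_below {e. e > 0 \<and> (\<exists>\<theta>\<in>time_changes T. \<forall>t\<in>{0..T}. \<bar>\<theta> t - t\<bar> \<le> e \<and> mdist m (\<omega> t) (\<omega>' (\<theta> t)) \<le> e)}"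
    by (intro bdd_belowI[of _ 0]) auto
  show "e \<in> {e. e > 0 \<and> (\<exists>\<theta>\<in>time_changes T. \<forall>t\<in>{0..T}. \<bar>\<theta> t - t\<bar> \<le> e \<and> mdist m (\<omega> t) (\<omega>' (\<theta> t)) \<le> e)}"
    using assms by (auto intro!: bexI[OF _ id_time_change])
qed

text \<open>The infimum in \<^const>\<open>skorokhod_dist\<close> is over a nonempty set because \<open>cadlag\<close> paths are bounded.\<close>

lemma skorokhod_dist_lessE:
  assumes E: "mtopology_of m = E" and \<omega>: "\<omega> \<in> cadlag_paths T E" "\<omega>' \<in> cadlag_paths T E"
    and T: "T > 0" and r: "skorokhod_dist T m \<omega> \<omega>' < r"
  obtains \<theta> where "\<theta> \<in> time_changes T"
    "\<And>t. t \<in> {0..T} \<Longrightarrow> \<bar>\<theta> t - t\<bar> < r \<and> mdist m (\<omega> t) (\<omega>' (\<theta> t)) < r"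
proof -
  let ?S = "{e. e > 0 \<and> (\<exists>\<theta>\<in>time_changes T. \<forall>t\<in>{0..T}. \<bar>\<theta> t - t\<bar> \<le> e \<and> mdist m (\<omega> t) (\<omega>' (\<theta> t)) \<le> e)}"
  have sp: "\<omega> t \<in> mspace m" "\<omega>' t \<in> mspace m" if "t \<in> {0..T}" for t
    using cadlag_paths_in_space[OF \<omega>(1) that] cadlag_paths_in_space[OF \<omega>(2) that] E by auto
  obtain B B' where B: "\<And>t. t\<in>{0..T} \<Longrightarrow> mdist m (\<omega> 0) (\<omega> t) \<le> B" "\<And>t. t\<in>{0..T} \<Longrightarrow> mdist m (\<omega> 0) (\<omega>' t) \<le> B'"
    using cadlag_paths_bounded[OF E \<omega>(1) sp(1)[of 0] T] cadlag_paths_bounded[OF E \<omega>(2) sp(1)[of 0] T] T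
    by (metis atLeastAtMost_iff less_imp_le order_refl)
  have BB: "mdist m (\<omega> t) (\<omega>' t) \<le> max 1 (B + B')" if "t \<in> {0..T}" for t
    using mdist_triangle[of "\<omega> t" m "\<omega> 0" "\<omega>' t"] sp[OF that] sp[of 0] T B[OF that]
    by (auto simp: mdist_commute)
  have "max 1 (B + B') \<in> ?S" using BB by (auto intro!: bexI[OF _ id_time_change])
  then have "?S \<noteq> {}" by blast
  from cInf_lessD[OF this r[unfolded skorokhod_dist_def]]
  obtain e where e: "e \<in> ?S" "e < r" by blast
  then obtain \<theta> where "\<theta> \<in> time_changes T" "\<forall>t\<in>{0..T}. \<bar>\<theta> t - t\<bar> \<le> e \<and> mdist m (\<omega> t) (\<omega>' (\<theta> t)) \<le> e"
    by blast
  then show ?thesis using e(2) by (intro that[of \<theta>]) force+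
qed

text \<open>Makes the starting value immune to time changes: a point to the right of 0 that is
  mapped to 0 would push \<open>\<theta> 0\<close> below 0.\<close>

lemma time_change_0:
  assumes "\<theta> \<in> time_changes T" "T > 0" shows "\<theta> 0 = 0"
proof -
  have im: "\<theta> ` {0..T} = {0..T}" and mono: "strict_mono_on {0..T} \<theta>" using assms by (auto simp: time_changes_def)
  have "0 \<in> \<theta> ` {0..T}" unfolding im using assms by simp
  then obtain s where s: "s \<in> {0..T}" "\<theta> s = 0" by force
  have "\<theta> 0 \<in> {0..T}" using im assms by auto
  moreover have "s > 0 \<Longrightarrow> \<theta> 0 < \<theta> s" using mono s assms by (intro strict_mono_onD[OF mono]) auto
  ultimately show ?thesis using s by (cases "s = 0") auto
qed

lemma time_change_in: "\<theta> \<in> time_changes T \<Longrightarrow> t \<in> {0..T} \<Longrightarrow> \<theta> t \<in> {0..T}"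
  by (auto simp: time_changes_def)

text \<open>The identity is a time change, so uniform closeness implies Skorokhod closeness. The
  radius is halved because the infimum only gives \<open>\<le>\<close>.\<close>

lemma openin_skorokhod_uniform_ball:
  assumes "openin (skorokhod_topology T E) U" "mtopology_of m = E" "\<omega> \<in> U"
  obtains r where "r > 0"
    "\<And>\<omega>'. \<omega>' \<in> cadlag_paths T E \<Longrightarrow> (\<And>t. t \<in> {0..T} \<Longrightarrow> mdist m (\<omega> t) (\<omega>' t) < r) \<Longrightarrow> \<omega>' \<in> U"
proof -
  obtain r where r: "r > 0" "\<forall>\<omega>'\<in>cadlag_paths T E. skorokhod_dist T m \<omega> \<omega>' < r \<longrightarrow> \<omega>' \<in> U"
    using skorokhod_openD[of T E U m \<omega>] assms unfolding openin_skorokhod_topology by blast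
  show ?thesis
  proof (rule that[of "r/2"])
    fix \<omega>' assume w: "\<omega>' \<in> cadlag_paths T E" "\<And>t. t \<in> {0..T} \<Longrightarrow> mdist m (\<omega> t) (\<omega>' t) < r/2"
    have "skorokhod_dist T m \<omega> \<omega>' \<le> r/2" using r w by (intro skorokhod_dist_le) (auto intro: less_imp_le)
    then show "\<omega>' \<in> U" using r w by auto
  qed (use r in simp)
qed

text \<open>Evaluation at a general time is not continuous, but every time change fixes 0.\<close>

lemma continuous_map_skorokhod_eval_0:
  assumes T: "T > 0"
  shows "continuous_map (skorokhod_topology T E) E (\<lambda>\<omega>. \<omega> 0)"
  unfolding continuous_map_def topspace_skorokhod_topology
proof (intro conjI allI impI)
  show "(\<lambda>\<omega>. \<omega> 0) \<in> cadlag_paths T E \<rightarrow> topspace E"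
    using T by (auto simp: cadlag_paths_in_space)
  fix U assume U: "openin E U"
  show "openin (skorokhod_topology T E) {\<omega> \<in> cadlag_paths T E. \<omega> 0 \<in> U}"
    unfolding openin_skorokhod_topology skorokhod_open_def
  proof (intro conjI allI impI ballI)
    fix m \<omega> assume m: "mtopology_of m = E" and w: "\<omega> \<in> {\<omega> \<in> cadlag_paths T E. \<omega> 0 \<in> U}"
    obtain r where r: "r > 0" "\<And>y. y \<in> mspace m \<Longrightarrow> mdist m (\<omega> 0) y < r \<Longrightarrow> y \<in> U"
      using mdist_openin[of m U "\<omega> 0"] U w m by auto
    show "\<exists>r>0. \<forall>\<omega>'\<in>cadlag_paths T E. skorokhod_dist T m \<omega> \<omega>' < r \<longrightarrow> \<omega>' \<in> {\<omega> \<in> cadlag_paths T E. \<omega> 0 \<in> U}"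
    proof (intro exI[of _ r] conjI ballI impI r(1) CollectI)
      fix \<omega>' assume w': "\<omega>' \<in> cadlag_paths T E" "skorokhod_dist T m \<omega> \<omega>' < r"
      obtain \<theta> where t: "\<theta> \<in> time_changes T" "\<And>t. t \<in> {0..T} \<Longrightarrow> \<bar>\<theta> t - t\<bar> < r \<and> mdist m (\<omega> t) (\<omega>' (\<theta> t)) < r"
        using skorokhod_dist_lessE[OF m _ w'(1) T w'(2)] w by auto
      from t(2)[of 0] have "mdist m (\<omega> 0) (\<omega>' 0) < r" using T time_change_0[OF t(1) T] by simp
      moreover have "\<omega>' 0 \<in> mspace m" using cadlag_paths_in_space[OF w'(1), of 0] T m by auto
      ultimately show "\<omega>' 0 \<in> U" using r by blast
    qed
  qed auto
qed

text \<open>A single metric of \<open>E\<close> suffices: openness provides a ball for each metric,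
  and a uniform ball for one of them already yields a neighbourhood inside the preimage.\<close>

lemma continuous_map_into_skorokhod:
  fixes \<Psi> :: "'x::topological_space \<Rightarrow> real \<Rightarrow> 'e"
  assumes m: "mtopology_of m = E" and c: "\<And>x. \<Psi> x \<in> cadlag_paths T E"
    and V: "\<And>x r. r > 0 \<Longrightarrow> \<exists>V. open V \<and> x \<in> V \<and> (\<forall>x'\<in>V. \<forall>t\<in>{0..T}. mdist m (\<Psi> x t) (\<Psi> x' t) < r)"
  shows "continuous_map euclidean (skorokhod_topology T E) \<Psi>"
  unfolding continuous_map_def topspace_skorokhod_topology
proof (intro conjI allI impI)
  fix U assume U: "openin (skorokhod_topology T E) U"
  have "\<exists>V. open V \<and> x \<in> V \<and> V \<subseteq> {x \<in> topspace euclidean. \<Psi> x \<in> U}" if x: "\<Psi> x \<in> U" for x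
  proof -
    obtain r where r: "r > 0" "\<And>\<omega>'. \<omega>' \<in> cadlag_paths T E \<Longrightarrow> (\<And>t. t \<in> {0..T} \<Longrightarrow> mdist m (\<Psi> x t) (\<omega>' t) < r) \<Longrightarrow> \<omega>' \<in> U"
      using openin_skorokhod_uniform_ball[OF U m x] by metis
    show ?thesis using V[OF r(1), of x] r(2)[OF c] by auto
  qed
  then have "open {x \<in> topspace euclidean. \<Psi> x \<in> U}"
    by (subst open_subopen) auto
  then show "openin euclidean {x \<in> topspace euclidean. \<Psi> x \<in> U}" by simp
qed (use c in auto)

text \<open>If \<open>\<omega> \<noteq> H g\<close> for the only candidate \<open>g = e (\<omega> 0)\<close>, then a path \<open>H g'\<close> Skorokhod-close
  to \<open>\<omega>\<close> has \<open>g'\<close> close to \<open>g\<close>, hence is uniformly close to \<open>H g\<close>, and the time change is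
  absorbed by the continuity of \<open>H g\<close>.\<close>

lemma openin_skorokhod_compl_range:
  fixes H :: "'g::metric_space \<Rightarrow> real \<Rightarrow> 'e"
  assumes T: "T > 0" and c: "\<And>g. H g \<in> cadlag_paths T E"
    and cont: "\<And>g t. t \<in> {0..T} \<Longrightarrow> limitin E (H g) (H g t) (at t within {0..T})"
    and unif: "\<And>m g r. mtopology_of m = E \<Longrightarrow> r > 0 \<Longrightarrow>
      \<exists>d>0. \<forall>g'. dist g' g < d \<longrightarrow> (\<forall>t\<in>{0..T}. mdist m (H g t) (H g' t) < r)"
    and e: "continuous_map E euclidean e" "\<And>g. e (H g 0) = g"
  shows "openin (skorokhod_topology T E) (cadlag_paths T E - range H)"
  unfolding openin_skorokhod_topology skorokhod_open_def
proof (intro conjI allI impI ballI)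
  fix m \<omega> assume m: "mtopology_of m = E" and w: "\<omega> \<in> cadlag_paths T E - range H"
  define g where "g = e (\<omega> 0)"
  have sp: "\<omega> t \<in> mspace m" if "t \<in> {0..T}" "\<omega> \<in> cadlag_paths T E" for t \<omega>
    using cadlag_paths_in_space[OF that(2,1)] m by auto
  have "\<omega> \<noteq> H g" using w by auto
  have "\<exists>t\<in>{0..T}. \<omega> t \<noteq> H g t"
  proof (rule ccontr)
    assume "\<not> ?thesis"
    moreover have "\<omega> \<in> extensional {0..T}" "H g \<in> extensional {0..T}"
      using w c[of g] by (auto simp: cadlag_paths_def PiE_def)
    ultimately have "\<omega> = H g" by (auto intro: extensionalityI)
    then show False using \<open>\<omega> \<noteq> H g\<close> by simp
  qed
  then obtain t where t: "t \<in> {0..T}" "\<omega> t \<noteq> H g t" by blast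
  define \<rho> where "\<rho> = mdist m (\<omega> t) (H g t)"
  have \<rho>: "\<rho> > 0" unfolding \<rho>_def using t sp[OF t(1) c] sp[OF t(1), of \<omega>] w by (auto intro: Metric_space.mdist_pos_less[OF Metric_space_mspace_mdist])
  have "\<forall>\<^sub>F s in at t within {0..T}. H g s \<in> mspace m \<and> mdist m (H g s) (H g t) < \<rho>/3"
    using cont[OF t(1), of g] \<rho> m by (intro mdist_limitin) auto
  then obtain d1 where d1: "d1 > 0" "\<And>s. s \<in> {0..T} \<Longrightarrow> s \<noteq> t \<Longrightarrow> \<bar>s - t\<bar> < d1 \<Longrightarrow> mdist m (H g s) (H g t) < \<rho>/3"
    unfolding eventually_at by (auto simp: dist_real_def)
  have d1': "mdist m (H g s) (H g t) < \<rho>/3" if "s \<in> {0..T}" "\<bar>s - t\<bar> < d1" for s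
    using d1(2)[of s] that \<rho> sp[OF t(1) c] by (cases "s = t") (auto simp: mdist_self)
  obtain d2 where d2: "d2 > 0" "\<And>g' t. dist g' g < d2 \<Longrightarrow> t \<in> {0..T} \<Longrightarrow> mdist m (H g t) (H g' t) < \<rho>/3"
    using unif[OF m, of "\<rho>/3" g] \<rho> by auto
  have "openin E {q \<in> topspace E. e q \<in> ball g d2}"
    using e(1) by (intro openin_continuous_map_preimage) auto
  moreover have "\<omega> 0 \<in> {q \<in> topspace E. e q \<in> ball g d2}"
    using d2(1) sp[of 0 \<omega>] w T m by (auto simp: g_def)
  ultimately obtain d3 where d3: "d3 > 0" "\<And>q. q \<in> mspace m \<Longrightarrow> mdist m (\<omega> 0) q < d3 \<Longrightarrow> dist (e q) g < d2"
    unfolding m[symmetric] by (elim mdist_openin) (auto simp: dist_commute)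
  \<comment> \<open>\<open>d1\<close> makes the time shift harmless for \<open>H g\<close>,
    \<open>d3\<close> forces the starting values close enough for \<open>d2\<close>, and the last
    bound completes a triangle inequality with three pieces below \<open>\<rho>/3\<close>.\<close>
  let ?r = "min (min d1 d3) (\<rho>/3)"
  show "\<exists>r>0. \<forall>\<omega>'\<in>cadlag_paths T E. skorokhod_dist T m \<omega> \<omega>' < r \<longrightarrow> \<omega>' \<in> cadlag_paths T E - range H"
  proof (intro exI[of _ ?r] conjI ballI impI)
    fix \<omega>' assume w': "\<omega>' \<in> cadlag_paths T E" "skorokhod_dist T m \<omega> \<omega>' < ?r"
    show "\<omega>' \<in> cadlag_paths T E - range H"
    proof (rule DiffI[OF w'(1)], rule notI)
      assume "\<omega>' \<in> range H"
      then obtain g' where g': "\<omega>' = H g'" by blast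
      obtain \<theta> where th: "\<theta> \<in> time_changes T" "\<And>t. t \<in> {0..T} \<Longrightarrow> \<bar>\<theta> t - t\<bar> < ?r \<and> mdist m (\<omega> t) (\<omega>' (\<theta> t)) < ?r"
        using skorokhod_dist_lessE[OF m _ w'(1) T w'(2)] w by auto
      have th': "\<theta> t \<in> {0..T}" using time_change_in[OF th(1) t(1)] .
      have "mdist m (\<omega> 0) (H g' 0) < d3"
        using th(2)[of 0] T time_change_0[OF th(1) T] g' by simp
      then have "dist g' g < d2" using d3(2)[of "H g' 0"] sp[of 0 \<omega>'] w' T g' e(2)[of g'] by auto
      then have "mdist m (H g (\<theta> t)) (H g' (\<theta> t)) < \<rho>/3" using d2(2) th' by blast
      moreover have "mdist m (H g (\<theta> t)) (H g t) < \<rho>/3" using d1'[OF th'] th(2)[OF t(1)] by auto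
      moreover have "mdist m (\<omega> t) (H g' (\<theta> t)) < \<rho>/3" using th(2)[OF t(1)] g' by auto
      moreover have "mdist m (\<omega> t) (H g t) \<le> mdist m (\<omega> t) (H g' (\<theta> t)) + mdist m (H g' (\<theta> t)) (H g t)"
        using w t(1) th' c by (intro mdist_triangle sp) auto
      moreover have "mdist m (H g' (\<theta> t)) (H g t) \<le> mdist m (H g' (\<theta> t)) (H g (\<theta> t)) + mdist m (H g (\<theta> t)) (H g t)"
        using w t(1) th' c by (intro mdist_triangle sp) auto
      ultimately show False using mdist_commute[of m "H g' (\<theta> t)" "H g (\<theta> t)"] by (simp add: \<rho>_def)
    qed
  qed (use d1 d3 \<rho> in auto)
qed auto


section \<open>The state space\<close>

definition test_family :: "('a::topological_space \<Rightarrow> real) set \<Rightarrow> bool" where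
  "test_family Fs \<longleftrightarrow> finite Fs \<and> (\<forall>f\<in>Fs. continuous_on UNIV f \<and> bounded (range f))"

definition weak_ball :: "'a::topological_space measure \<Rightarrow> ('a \<Rightarrow> real) set \<Rightarrow> real \<Rightarrow> 'a measure set" where
  "weak_ball \<mu> Fs e = {\<nu> \<in> space (prob_algebra borel). \<forall>f\<in>Fs. \<bar>(\<integral>x. f x \<partial>\<nu>) - (\<integral>x. f x \<partial>\<mu>)\<bar> < e}"

lemma weak_ball_mono: "Fs \<subseteq> Gs \<Longrightarrow> e \<le> d \<Longrightarrow> weak_ball \<mu> Gs e \<subseteq> weak_ball \<mu> Fs d"
  by (force simp: weak_ball_def)

text \<open>Induction over the generation of the open set, for all its points at once, since unions
  and intersections pass the same point to their members.\<close>

lemma weak_topology_nbhd: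
  fixes \<mu> :: "'a::topological_space measure"
  assumes V: "openin weak_topology V" and \<mu>: "\<mu> \<in> V"
  obtains Fs e where "test_family Fs" "e > 0" "weak_ball \<mu> Fs e \<subseteq> V"
proof -
  have "generate_topology_on {{\<nu> \<in> space (prob_algebra borel). (\<integral>x. f x \<partial>\<nu>) \<in> U} | (f :: 'a \<Rightarrow> real) U.
        continuous_on UNIV f \<and> bounded (range f) \<and> open U} V"
    using V unfolding weak_topology_def by (rule openin_topology_generated_by)
  then have "\<forall>\<mu>\<in>V. \<exists>Fs e. test_family Fs \<and> e > 0 \<and> weak_ball \<mu> Fs e \<subseteq> V"
  proof induction
    case (Int a b)
    show ?case
    proof
      fix \<mu> assume "\<mu> \<in> a \<inter> b"
      with Int.IH obtain Fa ea Fb eb where *: "test_family Fa" "ea > 0" "weak_ball \<mu> Fa ea \<subseteq> a"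
        "test_family Fb" "eb > 0" "weak_ball \<mu> Fb eb \<subseteq> b"
        by (metis IntE)
      have "weak_ball \<mu> (Fa \<union> Fb) (min ea eb) \<subseteq> weak_ball \<mu> Fa ea"
        "weak_ball \<mu> (Fa \<union> Fb) (min ea eb) \<subseteq> weak_ball \<mu> Fb eb"
        by (simp_all add: weak_ball_mono)
      then have "weak_ball \<mu> (Fa \<union> Fb) (min ea eb) \<subseteq> a \<inter> b" using *(3,6) by blast
      moreover have "test_family (Fa \<union> Fb)" using * by (auto simp: test_family_def)
      ultimately show "\<exists>Fs e. test_family Fs \<and> e > 0 \<and> weak_ball \<mu> Fs e \<subseteq> a \<inter> b"
        using *(2,5) by (intro exI[of _ "Fa \<union> Fb"] exI[of _ "min ea eb"]) auto
    qed
  next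
    case (UN K)
    then show ?case by (meson Union_iff Sup_upper subset_trans)
  next
    case (Basis s)
    then obtain f :: "'a \<Rightarrow> real" and U where f: "s = {\<nu> \<in> space (prob_algebra borel). (\<integral>x. f x \<partial>\<nu>) \<in> U}"
      "continuous_on UNIV f" "bounded (range f)" "open U" by blast
    show ?case
    proof
      fix \<mu> assume "\<mu> \<in> s"
      then have "(\<integral>x. f x \<partial>\<mu>) \<in> U" using f(1) by simp
      then obtain e where "e > 0" "\<And>y. \<bar>y - (\<integral>x. f x \<partial>\<mu>)\<bar> < e \<Longrightarrow> y \<in> U"
        using f(4) unfolding open_dist dist_real_def by blast
      then have "e > 0" "weak_ball \<mu> {f} e \<subseteq> s" by (auto simp: weak_ball_def f(1))
      moreover have "test_family {f}" using f by (simp add: test_family_def)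
      ultimately show "\<exists>Fs e. test_family Fs \<and> e > 0 \<and> weak_ball \<mu> Fs e \<subseteq> s" by blast
    qed
  qed simp
  then show ?thesis using \<mu> that by blast
qed

text \<open>As \<open>m\<close> is an arbitrary metric of the product topology, its balls are only
  accessible through basic open sets inside them. A finite subcover of \<open>K\<close> makes the
  test family and the radius independent of \<open>h\<close>.\<close>

lemma state_uniform_nbhd:
  fixes \<mu> :: "'a::topological_space measure" and K :: "'b::metric_space set"
  assumes m: "mtopology_of m = prod_topology weak_topology euclidean"
    and \<mu>: "\<mu> \<in> space (prob_algebra borel)" and K: "compact K" and r: "r > 0"
  obtains Fs e where "test_family Fs" "e > 0"
    "\<And>\<nu> h h'. \<nu> \<in> weak_ball \<mu> Fs e \<Longrightarrow> h \<in> K \<Longrightarrow> dist h' h < e \<Longrightarrow> mdist m (\<mu>, h) (\<nu>, h') < r"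
proof -
  have sp: "mspace m = space (prob_algebra borel) \<times> UNIV"
    using arg_cong[OF m, of topspace] by (simp add: topspace_weak_topology)
  \<comment> \<open>Half of \<open>r\<close> is left for the triangle inequality through a centre
    \<open>c\<close> of the cover. The radius \<open>2 * e\<close> accommodates \<open>h'\<close>,
    which lies within \<open>e c\<close> of \<open>h\<close>, itself within \<open>e c\<close> of
    \<open>c\<close>.\<close>
  define P where "P h Fs e \<longleftrightarrow> test_family Fs \<and> e > 0 \<and>
    (\<forall>\<nu>\<in>weak_ball \<mu> Fs e. \<forall>h'. dist h' h < 2 * e \<longrightarrow> mdist m (\<mu>, h) (\<nu>, h') < r / 2)" for h :: 'b and Fs e
  have "\<exists>Fs e. P h Fs e" for h
  proof -
    have "openin (mtopology_of m) {y \<in> mspace m. mdist m (\<mu>, h) y < r / 2}"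
      using \<mu> by (intro openin_mball) (simp add: sp)
    moreover have "(\<mu>, h) \<in> {y \<in> mspace m. mdist m (\<mu>, h) y < r / 2}"
      using \<mu> r by (simp add: sp mdist_self)
    ultimately have "\<exists>V W. openin weak_topology V \<and> openin euclidean W \<and> \<mu> \<in> V \<and> h \<in> W \<and>
        V \<times> W \<subseteq> {y \<in> mspace m. mdist m (\<mu>, h) y < r / 2}"
      using m openin_prod_topology_alt[of weak_topology euclidean "{y \<in> mspace m. mdist m (\<mu>, h) y < r / 2}"]
      by simp
    then obtain V W where VW: "openin weak_topology V" "open W" "\<mu> \<in> V" "h \<in> W"
      "V \<times> W \<subseteq> {y \<in> mspace m. mdist m (\<mu>, h) y < r / 2}"
      by auto
    obtain d where d: "d > 0" "ball h d \<subseteq> W" using VW(2,4) open_contains_ball by blast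
    obtain Fs e where F: "test_family Fs" "e > 0" "weak_ball \<mu> Fs e \<subseteq> V"
      using weak_topology_nbhd[OF VW(1,3)] by blast
    have "P h Fs (min e (d/2))"
      unfolding P_def
    proof (intro conjI ballI allI impI)
      fix \<nu> :: "'a measure" and h' assume "\<nu> \<in> weak_ball \<mu> Fs (min e (d/2))"
        and h': "dist h' h < 2 * min e (d/2)"
      then have "\<nu> \<in> V" using F(3) weak_ball_mono[of Fs Fs "min e (d/2)" e \<mu>] by auto
      moreover have "dist h h' < d" using h' by (auto simp: dist_commute)
      then have "h' \<in> W" using d(2) by auto
      ultimately show "mdist m (\<mu>, h) (\<nu>, h') < r / 2" using VW(5) by blast
    qed (use F d in auto)
    then show ?thesis by blast
  qed
  then obtain Fs e where P: "\<And>h. P h (Fs h) (e h)" by metis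
  have e0: "e h > 0" for h using P[of h] by (simp add: P_def)
  obtain C where C: "C \<subseteq> K" "finite C" "K \<subseteq> (\<Union>h\<in>C. ball h (e h))"
  proof (rule compactE_image[OF K, of K "\<lambda>h. ball h (e h)"])
    show "K \<subseteq> (\<Union>h\<in>K. ball h (e h))" using e0 by auto
  qed auto
  define F where "F = (\<Union>h\<in>C. Fs h)"
  define d where "d = Min (insert 1 (e ` C))"
  have d: "d > 0" "\<And>h. h \<in> C \<Longrightarrow> d \<le> e h" using C(2) e0 by (auto simp: d_def)
  show ?thesis
  proof (rule that[of F d])
    show "test_family F" using C(2) P by (auto simp: F_def P_def test_family_def)
    show "d > 0" by (fact d)
  next
    fix \<nu> :: "'a measure" and h h' assume \<nu>: "\<nu> \<in> weak_ball \<mu> F d" and h: "h \<in> K" "dist h' h < d"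
    obtain c where c: "c \<in> C" "dist c h < e c" using C(3) h(1) by auto
    have *: "mdist m (\<mu>, c) (\<nu>, x) < r / 2" if "dist x c < 2 * e c" "\<nu> \<in> weak_ball \<mu> F d" for x \<nu>
    proof -
      have "Fs c \<subseteq> F" using c(1) by (auto simp: F_def)
      then have "\<nu> \<in> weak_ball \<mu> (Fs c) (e c)"
        using that(2) d(2)[OF c(1)] weak_ball_mono by blast
      then show ?thesis using P[of c] that(1) unfolding P_def by blast
    qed
    have \<mu>': "\<mu> \<in> weak_ball \<mu> F d" using \<mu> d(1) by (simp add: weak_ball_def)
    have "mdist m (\<mu>, c) (\<nu>, h') < r / 2"
    proof (rule *)
      have "dist h' c \<le> dist h' h + dist c h" by (rule dist_triangle2)
      then show "dist h' c < 2 * e c" using c h d(2)[OF c(1)] by linarith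
    qed (fact \<nu>)
    moreover have "dist h c < 2 * e c" using c e0[of c] by (simp add: dist_commute)
    then have "mdist m (\<mu>, c) (\<mu>, h) < r / 2" using \<mu>' by (rule *)
    moreover have "mdist m (\<mu>, h) (\<nu>, h') \<le> mdist m (\<mu>, h) (\<mu>, c) + mdist m (\<mu>, c) (\<nu>, h')"
      using \<mu> \<nu> by (intro mdist_triangle) (auto simp: sp weak_ball_def)
    ultimately show "mdist m (\<mu>, h) (\<nu>, h') < r" using mdist_commute[of m "(\<mu>, h)" "(\<mu>, c)"] by linarith
  qed
qed

section \<open>Linear differential equations\<close>

text \<open>The matrix exponential \<open>exp (t A)\<close> applied to \<open>v\<close>, expanded in
  each coordinate so that results on scalar power series apply.\<close>

definition lin_flow :: "real^'m^'m::finite \<Rightarrow> real \<Rightarrow> real^'m \<Rightarrow> real^'m" where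
  "lin_flow A t v = (\<chi> i. \<Sum>n. ((((*v) A ^^ n) v) $ i / fact n) * t ^ n)"

lemma matrix_vector_bound:
  fixes A :: "real^'m::finite^'n::finite"
  obtains c where "c > 0" "\<And>v. norm (A *v v) \<le> c * norm v"
proof -
  obtain c where "c > 0" "\<And>v. norm (A *v v) \<le> norm v * c"
    using bounded_linear.pos_bounded[OF matrix_vector_mul_bounded_linear[of A]] by blast
  then show ?thesis by (intro that[of c]) (auto simp: mult.commute)
qed

context
  fixes A :: "real^'m^'m::finite" and c :: real
  assumes c: "c \<ge> 0" "\<And>v. norm (A *v v) \<le> c * norm v"
begin

lemma matrix_iterate_bound: "norm (((*v) A ^^ n) v) \<le> c ^ n * norm v"
proof (induction n)
  case (Suc n)
  have "norm (((*v) A ^^ Suc n) v) \<le> c * norm (((*v) A ^^ n) v)" by (simp add: c)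
  also have "\<dots> \<le> c * (c ^ n * norm v)" using Suc c by (intro mult_left_mono)
  finally show ?case by (simp add: mult.assoc)
qed simp

lemma lin_flow_term_bound:
  "norm ((((*v) A ^^ n) v) $ i / fact n * t ^ n) \<le> norm v * ((c * \<bar>t\<bar>) ^ n /\<^sub>R fact n)"
proof -
  have "\<bar>(((*v) A ^^ n) v) $ i\<bar> \<le> c ^ n * norm v"
    using component_le_norm_cart[of "((*v) A ^^ n) v" i] matrix_iterate_bound[of n v] by linarith
  then have "\<bar>(((*v) A ^^ n) v) $ i\<bar> * (\<bar>t\<bar> ^ n / fact n) \<le> c ^ n * norm v * (\<bar>t\<bar> ^ n / fact n)"
    by (intro mult_right_mono) auto
  then show ?thesis by (simp add: abs_mult power_abs power_mult_distrib divide_inverse mult_ac)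
qed

lemma lin_flow_summable: "summable (\<lambda>n. (((*v) A ^^ n) v) $ i / fact n * t ^ n)"
  by (rule summable_comparison_test'[OF summable_mult[OF summable_exp_generic], of 0])
    (rule lin_flow_term_bound)

lemma lin_flow_component_bound: "\<bar>lin_flow A t v $ i\<bar> \<le> norm v * exp (c * \<bar>t\<bar>)"
proof -
  have s: "summable (\<lambda>n. norm v * ((c * \<bar>t\<bar>) ^ n /\<^sub>R fact n))"
    by (intro summable_mult summable_exp_generic)
  have "norm (\<Sum>n. (((*v) A ^^ n) v) $ i / fact n * t ^ n) \<le> (\<Sum>n. norm v * ((c * \<bar>t\<bar>) ^ n /\<^sub>R fact n))"
    using lin_flow_term_bound s by (rule norm_suminf_le)
  also have "\<dots> = norm v * exp (c * \<bar>t\<bar>)"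
    unfolding exp_def by (rule suminf_mult[OF summable_exp_generic])
  finally show ?thesis by (simp add: lin_flow_def)
qed

lemma lin_flow_bound: "norm (lin_flow A t v) \<le> CARD('m) * exp (c * \<bar>t\<bar>) * norm v"
proof -
  have "norm (lin_flow A t v) \<le> (\<Sum>i\<in>UNIV. \<bar>lin_flow A t v $ i\<bar>)" by (rule norm_le_l1_cart)
  also have "\<dots> \<le> (\<Sum>i\<in>(UNIV :: 'm set). norm v * exp (c * \<bar>t\<bar>))"
    by (intro sum_mono lin_flow_component_bound)
  finally show ?thesis by (simp add: mult_ac)
qed

end

lemma lin_flow_0: "lin_flow A 0 v = v"
proof -
  have "(\<Sum>n. ((((*v) A ^^ n) v) $ i / fact n) * 0 ^ n) = v $ i" for i
    using powser_zero[of "\<lambda>n. (((*v) A ^^ n) v) $ i / fact n"] by simp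
  then show ?thesis by (simp add: lin_flow_def)
qed

lemma lin_flow_diff: "lin_flow A t (v - w) = lin_flow A t v - lin_flow A t w"
proof -
  obtain c where c: "c > 0" "\<And>v. norm (A *v v) \<le> c * norm v" by (rule matrix_vector_bound[of A]) blast
  have "((*v) A ^^ n) (v - w) = ((*v) A ^^ n) v - ((*v) A ^^ n) w" for n
    by (induction n) (auto simp: matrix_vector_mult_diff_distrib)
  then have "((((*v) A ^^ n) (v - w)) $ i / fact n) * t ^ n
      = ((((*v) A ^^ n) v) $ i / fact n) * t ^ n - ((((*v) A ^^ n) w) $ i / fact n) * t ^ n" for n i
    by (simp add: diff_divide_distrib left_diff_distrib)
  then show ?thesis
    using suminf_diff[OF lin_flow_summable[OF less_imp_le[OF c(1)] c(2)] lin_flow_summable[OF less_imp_le[OF c(1)] c(2)], symmetric]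
    by (simp add: lin_flow_def vec_eq_iff)
qed

text \<open>Termwise differentiation shifts the coefficients by one, which turns each iterate of
  \<open>A\<close> into the next; the additional factor \<open>A\<close> is a finite sum and can be
  taken out of the series.\<close>

lemma lin_flow_component_derivative:
  "((\<lambda>t. lin_flow A t v $ i) has_real_derivative (A *v lin_flow A t v) $ i) (at t)"
proof -
  obtain c where c: "c > 0" "\<And>v. norm (A *v v) \<le> c * norm v" by (rule matrix_vector_bound[of A]) blast
  let ?a = "\<lambda>i n. (((*v) A ^^ n) v) $ i / fact n"
  have s: "summable (\<lambda>n. ?a i n * t ^ n)" for i t
    using lin_flow_summable[OF less_imp_le[OF c(1)] c(2)] by blast
  have "((\<lambda>t. \<Sum>n. ?a i n * t ^ n) has_real_derivative (\<Sum>n. diffs (?a i) n * t ^ n)) (at t)"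
    by (rule termdiffs_strong_converges_everywhere[OF s])
  moreover have "diffs (?a i) n * t ^ n = (\<Sum>j\<in>UNIV. A $ i $ j * (?a j n * t ^ n))" for n
  proof -
    have "(((*v) A ^^ Suc n) v) $ i = (\<Sum>j\<in>UNIV. A $ i $ j * (((*v) A ^^ n) v) $ j)"
      by (simp add: matrix_vector_mult_def)
    then have "diffs (?a i) n = (\<Sum>j\<in>UNIV. A $ i $ j * (((*v) A ^^ n) v) $ j) / fact n"
      by (simp add: diffs_def field_simps del: of_nat_Suc)
    then show ?thesis by (simp add: sum_divide_distrib sum_distrib_right mult.assoc)
  qed
  moreover have "(\<Sum>n. \<Sum>j\<in>UNIV. A $ i $ j * (?a j n * t ^ n)) = (\<Sum>j\<in>UNIV. A $ i $ j * (\<Sum>n. ?a j n * t ^ n))"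
    by (subst suminf_sum) (intro summable_mult s sum.cong refl suminf_mult)+
  ultimately show ?thesis by (simp add: lin_flow_def matrix_vector_mult_def)
qed

text \<open>The explicit solution of \<open>h' = A (y - h)\<close> with \<open>h 0 = g\<close>: the
  deviation from the fixed point \<open>y\<close> follows the flow of \<open>- A\<close>.\<close>

definition relax :: "real^'m^'m::finite \<Rightarrow> real^'m \<Rightarrow> real^'m \<Rightarrow> real \<Rightarrow> real^'m" where
  "relax A y g t = y + lin_flow (- A) t (g - y)"

lemma relax_0: "relax A y g 0 = g"
  by (simp add: relax_def lin_flow_0)

lemma neg_matrix_vector: "(- A) *v v = A *v (- v)" for A :: "real^'m::finite^'m"
  by (simp add: matrix_vector_mult_def vec_eq_iff)

lemma relax_component_derivative:
  "((\<lambda>t. relax A y g t $ i) has_real_derivative (A *v (y - relax A y g t)) $ i) (at t)"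
proof -
  have "((\<lambda>t. y $ i + lin_flow (- A) t (g - y) $ i) has_real_derivative 0 + ((- A) *v lin_flow (- A) t (g - y)) $ i) (at t)"
    by (intro DERIV_add DERIV_const lin_flow_component_derivative)
  then show ?thesis by (simp add: relax_def neg_matrix_vector)
qed

lemma relax_vector_derivative:
  "(relax A y g has_vector_derivative A *v (y - relax A y g t)) (at t within S)"
proof -
  let ?D = "A *v (y - relax A y g t)"
  have "((\<lambda>t. relax A y g t $ k) has_derivative (\<lambda>d. d * ?D $ k)) (at t within S)" for k
  proof (rule has_derivative_at_withinI)
    have "((\<lambda>t. relax A y g t $ k) has_derivative (*) (?D $ k)) (at t)"
      using relax_component_derivative unfolding has_field_derivative_def .
    then show "((\<lambda>t. relax A y g t $ k) has_derivative (\<lambda>d. d * ?D $ k)) (at t)"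
      by (rule has_derivative_eq_rhs) (simp add: fun_eq_iff)
  qed
  then have "((\<lambda>x. relax A y g x \<bullet> i) has_derivative (\<lambda>d. (d *\<^sub>R ?D) \<bullet> i)) (at t within S)" if "i \<in> Basis" for i
    using that by (auto simp: Basis_vec_def inner_axis)
  then show ?thesis
    unfolding has_vector_derivative_def by (subst has_derivative_componentwise_within) blast
qed

lemma relax_continuous: "continuous_on S (relax A y g)"
  by (rule continuous_on_vector_derivative) (rule relax_vector_derivative)

text \<open>Two solutions differ by the linear flow of the difference of their starting
  values.\<close>

lemma relax_lipschitz_initial:
  fixes A :: "real^'m^'m::finite"
  obtains c where "c > 0" "\<And>g g' t. t \<in> {0..T} \<Longrightarrow> norm (relax A y g t - relax A y g' t) \<le> c * norm (g - g')"
proof -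
  obtain c where c: "c > 0" "\<And>v. norm ((- A) *v v) \<le> c * norm v" by (rule matrix_vector_bound[of "- A"]) blast
  show ?thesis
  proof (rule that[of "CARD('m) * exp (c * \<bar>T\<bar>)"])
    fix g g' t assume t: "t \<in> {0..T}"
    have "norm (relax A y g t - relax A y g' t) = norm (lin_flow (- A) t (g - g'))"
      using lin_flow_diff[of "- A" t "g - y" "g' - y"] by (simp add: relax_def)
    also have "\<dots> \<le> CARD('m) * exp (c * \<bar>t\<bar>) * norm (g - g')"
      using lin_flow_bound[OF less_imp_le[OF c(1)] c(2)] by blast
    also have "\<dots> \<le> CARD('m) * exp (c * \<bar>T\<bar>) * norm (g - g')"
      using t c by (intro mult_right_mono mult_left_mono) auto
    finally show "norm (relax A y g t - relax A y g' t) \<le> CARD('m) * exp (c * \<bar>T\<bar>) * norm (g - g')" .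
  qed auto
qed

lemma relax_bound:
  fixes A :: "real^'m^'m::finite"
  obtains K where "\<And>g t. norm g \<le> R \<Longrightarrow> t \<in> {0..T} \<Longrightarrow> norm (relax A y g t) \<le> K"
proof -
  obtain c where c: "c > 0" "\<And>g g' t. t \<in> {0..T} \<Longrightarrow> norm (relax A y g t - relax A y g' t) \<le> c * norm (g - g')"
    by (rule relax_lipschitz_initial[of T A y]) blast
  \<comment> \<open>The constant solution \<open>y\<close> serves as reference, from which the
    Lipschitz bound in the starting value reaches all bounded \<open>g\<close>.\<close>
  have ry: "relax A y y t = y" for t
  proof -
    have "lin_flow (- A) t (0 - 0) = 0" unfolding lin_flow_diff by simp
    then show ?thesis by (simp add: relax_def)
  qed
  show ?thesis
  proof (rule that[of "norm y + c * (R + norm y)"])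
    fix g :: "real^'m" and t assume g: "norm g \<le> R" and t: "t \<in> {0..T}"
    have "norm (relax A y g t) \<le> norm y + norm (relax A y g t - y)" by (metis norm_triangle_sub)
    also have "norm (relax A y g t - y) \<le> c * norm (g - y)" using c(2)[OF t, of g y] by (simp add: ry)
    also have "c * norm (g - y) \<le> c * (R + norm y)"
      using g norm_triangle_ineq4[of g y] c(1) by (intro mult_left_mono) auto
    finally show "norm (relax A y g t) \<le> norm y + c * (R + norm y)" by simp
  qed
qed

text \<open>The second estimate says that the solution satisfies the Euler scheme of step
  \<open>1 / N\<close> up to an error of order \<open>1 / N^2\<close>, uniformly in bounded starting
  values. This allows a comparison with a discrete recursion.\<close>

lemma relax_taylor:
  fixes A :: "real^'m^'m::finite"
  obtains K where "K > 0"
    "\<And>g s t. norm g \<le> R \<Longrightarrow> s \<in> {0..T} \<Longrightarrow> t \<in> {0..T} \<Longrightarrow> norm (relax A y g t - relax A y g s) \<le> K * \<bar>t - s\<bar>"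
    "\<And>g s t. norm g \<le> R \<Longrightarrow> s \<in> {0..T} \<Longrightarrow> t \<in> {0..T} \<Longrightarrow>
      norm (relax A y g t - relax A y g s - (t - s) *\<^sub>R (A *v (y - relax A y g s))) \<le> K * (t - s)\<^sup>2"
proof -
  obtain B where B: "\<And>g t. norm g \<le> R \<Longrightarrow> t \<in> {0..T} \<Longrightarrow> norm (relax A y g t) \<le> B" by (rule relax_bound[of R T A y]) blast
  obtain c where c: "c > 0" "\<And>v. norm (A *v v) \<le> c * norm v" by (rule matrix_vector_bound[of A]) blast
  define K1 where "K1 = c * (norm y + \<bar>B\<bar>)"
  have K1: "K1 \<ge> 0" using c by (simp add: K1_def)
  have on: "onorm (\<lambda>d. d *\<^sub>R v) \<le> norm v" for v :: "real^'m"
    by (rule onorm_le) (simp add: mult.commute)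
  have d1: "norm (relax A y g t - relax A y g s) \<le> K1 * \<bar>t - s\<bar>"
    if g: "norm g \<le> R" "s \<in> {0..T}" "t \<in> {0..T}" for g s t
  proof -
    have "norm (relax A y g t - relax A y g s) \<le> K1 * norm (t - s)"
    proof (rule differentiable_bound[of "{0..T}" _ "\<lambda>u d. d *\<^sub>R (A *v (y - relax A y g u))"])
      fix u assume u: "u \<in> {0..T}"
      show "(relax A y g has_derivative (\<lambda>d. d *\<^sub>R (A *v (y - relax A y g u)))) (at u within {0..T})"
        using relax_vector_derivative unfolding has_vector_derivative_def .
      have "norm (A *v (y - relax A y g u)) \<le> c * norm (y - relax A y g u)" by (rule c)
      also have "\<dots> \<le> c * (norm y + \<bar>B\<bar>)"
        using norm_triangle_ineq4[of y "relax A y g u"] B[OF g(1) u] c(1) by (intro mult_left_mono) auto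
      finally show "onorm (\<lambda>d. d *\<^sub>R (A *v (y - relax A y g u))) \<le> K1" using on K1_def order_trans by blast
    qed (use g in auto)
    then show ?thesis by simp
  qed
  have d2: "norm (relax A y g t - relax A y g s - (t - s) *\<^sub>R (A *v (y - relax A y g s))) \<le> c * K1 * (t - s)\<^sup>2"
    if g: "norm g \<le> R" "s \<in> {0..T}" "t \<in> {0..T}" for g s t
  proof -
    let ?v = "A *v (y - relax A y g s)"
    \<comment> \<open>Removing the linear part leaves a function whose derivative is
      \<open>A\<close> applied to a displacement of order \<open>\<bar>t - s\<bar>\<close>; the mean
      value estimate then gives the square.\<close>
    let ?f = "\<lambda>u. relax A y g u - u *\<^sub>R ?v"
    have seg: "u \<in> {0..T}" "\<bar>u - s\<bar> \<le> \<bar>t - s\<bar>" if "u \<in> closed_segment s t" for u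
      using that g by (auto simp: closed_segment_eq_real_ivl split: if_splits)
    have "norm (?f t - ?f s) \<le> (c * K1 * \<bar>t - s\<bar>) * norm (t - s)"
    proof (rule differentiable_bound[of "closed_segment s t" _ "\<lambda>u d. d *\<^sub>R (A *v (y - relax A y g u)) - d *\<^sub>R ?v"])
      fix u assume u: "u \<in> closed_segment s t"
      show "(?f has_derivative (\<lambda>d. d *\<^sub>R (A *v (y - relax A y g u)) - d *\<^sub>R ?v)) (at u within closed_segment s t)"
        by (intro has_derivative_diff relax_vector_derivative[unfolded has_vector_derivative_def]
              has_derivative_scaleR_left has_derivative_ident)
      have eq: "A *v (y - relax A y g u) - ?v = A *v (relax A y g s - relax A y g u)"
        by (simp add: matrix_vector_mult_diff_distrib[symmetric])
      have "norm (A *v (relax A y g s - relax A y g u)) \<le> c * norm (relax A y g s - relax A y g u)" by (rule c)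
      also have "\<dots> \<le> c * (K1 * \<bar>s - u\<bar>)" using d1[OF g(1) seg(1)[OF u] g(2)] c(1) by (intro mult_left_mono) auto
      also have "\<dots> \<le> c * (K1 * \<bar>t - s\<bar>)" using seg(2)[OF u] c(1) K1 by (intro mult_left_mono) auto
      finally have le: "norm (A *v (y - relax A y g u) - ?v) \<le> c * K1 * \<bar>t - s\<bar>" unfolding eq by simp
      have fe: "(\<lambda>d. d *\<^sub>R (A *v (y - relax A y g u)) - d *\<^sub>R ?v) = (\<lambda>d. d *\<^sub>R (A *v (y - relax A y g u) - ?v))"
        by (simp add: scaleR_diff_right)
      show "onorm (\<lambda>d. d *\<^sub>R (A *v (y - relax A y g u)) - d *\<^sub>R ?v) \<le> c * K1 * \<bar>t - s\<bar>"
        unfolding fe using on[of "A *v (y - relax A y g u) - ?v"] le by linarith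
    qed auto
    moreover have "?f t - ?f s = relax A y g t - relax A y g s - (t - s) *\<^sub>R ?v"
      by (simp add: scaleR_diff_left)
    moreover have "c * K1 * \<bar>t - s\<bar> * norm (t - s) = c * K1 * (t - s)\<^sup>2"
      by (simp add: power2_eq_square)
    ultimately show ?thesis by (simp only:)
  qed
  show ?thesis
  proof (rule that[of "max 1 (max K1 (c * K1))"])
    fix g :: "real^'m" and s t assume g: "norm g \<le> R" "s \<in> {0..T}" "t \<in> {0..T}"
    have "K1 * \<bar>t - s\<bar> \<le> max 1 (max K1 (c * K1)) * \<bar>t - s\<bar>" by (intro mult_right_mono) auto
    with d1[OF g] show "norm (relax A y g t - relax A y g s) \<le> max 1 (max K1 (c * K1)) * \<bar>t - s\<bar>" by linarith
    have "c * K1 * (t - s)\<^sup>2 \<le> max 1 (max K1 (c * K1)) * (t - s)\<^sup>2" by (intro mult_right_mono) auto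
    with d2[OF g] show "norm (relax A y g t - relax A y g s - (t - s) *\<^sub>R (A *v (y - relax A y g s))) \<le> max 1 (max K1 (c * K1)) * (t - s)\<^sup>2"
      by linarith
  qed simp
qed

section \<open>Averaging of the sampled recursion\<close>

text \<open>The bound \<open>e * (1 + a) ^ k\<close> solves the recursion with equality, so it
  propagates by strong induction.\<close>

lemma discrete_gronwall:
  fixes d :: "nat \<Rightarrow> real"
  assumes "\<And>k. k \<le> n \<Longrightarrow> d k \<le> e + a * (\<Sum>l<k. d l)" "a \<ge> 0" "e \<ge> 0"
  shows "d n \<le> e * (1 + a) ^ n"
proof -
  have gs: "e + a * (\<Sum>l<k. e * (1 + a) ^ l) = e * (1 + a) ^ k" for k
    by (induction k) (auto simp: algebra_simps)
  have "k \<le> n \<Longrightarrow> d k \<le> e * (1 + a) ^ k" for k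
  proof (induction k rule: less_induct)
    case (less k)
    have "d k \<le> e + a * (\<Sum>l<k. d l)" using assms(1) less by blast
    also have "\<dots> \<le> e + a * (\<Sum>l<k. e * (1 + a) ^ l)"
      using less assms by (intro add_left_mono mult_left_mono sum_mono) auto
    finally show ?case unfolding gs .
  qed
  then show ?thesis by simp
qed

lemma power_one_plus_le_exp:
  fixes a T :: real and N k :: nat
  assumes "a \<ge> 0" "N \<ge> 1" "real k \<le> N * T"
  shows "(1 + a / N) ^ k \<le> exp (a * T)"
proof -
  have "(1 + a / N) ^ k \<le> exp (a / N) ^ k" using assms by (intro power_mono) auto
  also have "\<dots> = exp (a / N * k)" by (simp add: exp_of_nat_mult[symmetric] mult.commute)
  also have "\<dots> \<le> exp (a * T)"
  proof -
    have "a * real k \<le> a * (N * T)" using assms by (intro mult_left_mono) auto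
    then show ?thesis using assms by (simp add: field_simps)
  qed
  finally show ?thesis .
qed

text \<open>Summation by parts leaves a boundary term at \<open>n\<close>, bounded by
  \<open>e * K\<close>, and \<open>n\<close> terms with increments of \<open>b\<close>, each bounded
  by \<open>e * d\<close>. The boundary term at 0 vanishes with \<open>s 0\<close>.\<close>

lemma abel_summation_bound:
  fixes b :: "nat \<Rightarrow> 'a::real_normed_vector" and s :: "nat \<Rightarrow> real"
  assumes "s 0 = 0" "\<And>k. k \<le> n \<Longrightarrow> \<bar>s k\<bar> \<le> e" "norm (b n) \<le> K"
    "\<And>k. k < n \<Longrightarrow> norm (b (Suc k) - b k) \<le> d"
  shows "norm (\<Sum>k<n. (s (Suc k) - s k) *\<^sub>R b k) \<le> e * (K + n * d)"
proof -
  have e: "e \<ge> 0" using assms(2)[of 0] by simp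
  have "(\<Sum>k<m. (s (Suc k) - s k) *\<^sub>R b k) = s m *\<^sub>R b m - (\<Sum>k<m. s (Suc k) *\<^sub>R (b (Suc k) - b k))" for m
    by (induction m) (auto simp: assms(1) algebra_simps)
  then have "norm (\<Sum>k<n. (s (Suc k) - s k) *\<^sub>R b k) \<le> norm (s n *\<^sub>R b n) + norm (\<Sum>k<n. s (Suc k) *\<^sub>R (b (Suc k) - b k))"
    using norm_triangle_ineq4 by metis
  also have "norm (s n *\<^sub>R b n) \<le> e * K" using assms e by (simp add: mult_mono)
  also have "norm (\<Sum>k<n. s (Suc k) *\<^sub>R (b (Suc k) - b k)) \<le> (\<Sum>k<n. e * d)"
    using assms e by (intro sum_norm_le) (simp add: mult_mono)
  finally show ?thesis by (simp add: algebra_simps)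
qed

text \<open>The fluctuation of the sampling weights \<open>w k j\<close> around their mean enters only through its
  partial sums: summation by parts moves the difference onto the slowly varying \<open>B j (G k)\<close>.\<close>

lemma sampled_recursion_close:
  fixes G V E :: "nat \<Rightarrow> 'a::real_normed_vector" and B :: "'m::finite \<Rightarrow> 'a \<Rightarrow> 'a" and w :: "nat \<Rightarrow> 'm \<Rightarrow> real"
    and N n :: nat and T :: real
  assumes N: "N \<ge> 1" and n: "real n \<le> N * T" and init: "G 0 = V 0"
    and step: "\<And>k. k < n \<Longrightarrow> G (Suc k) = G k + (1 / N) *\<^sub>R (\<Sum>j\<in>UNIV. w k j *\<^sub>R B j (G k)) + E k"
    and E: "\<And>k. k < n \<Longrightarrow> norm (E k) \<le> e / N"
    and V: "\<And>k. k < n \<Longrightarrow> norm (V (Suc k) - V k - (1 / N) *\<^sub>R ((1 / CARD('m)) *\<^sub>R (\<Sum>j\<in>UNIV. B j (V k)))) \<le> \<kappa> / (real N)\<^sup>2"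
    and w: "\<And>k j. k \<le> n \<Longrightarrow> \<bar>1 / N * (\<Sum>l<k. w l j - 1 / CARD('m))\<bar> \<le> \<eta>"
    and B: "\<And>j g g'. norm (B j g - B j g') \<le> K * norm (g - g')"
    and K': "\<And>k j. k \<le> n \<Longrightarrow> norm (B j (G k)) \<le> K'"
    and inc: "\<And>k. k < n \<Longrightarrow> norm (G (Suc k) - G k) \<le> \<kappa>' / N"
    and pos: "e \<ge> 0" "\<kappa> \<ge> 0" "K \<ge> 0" "K' \<ge> 0" "\<kappa>' \<ge> 0" "T \<ge> 0"
  shows "norm (G n - V n) \<le> (e * T + \<kappa> * T / N + CARD('m) * (\<eta> * (K' + K * \<kappa>' * T))) * exp (K * T)"
proof -
  \<comment> \<open>\<open>F\<close> is the drift averaged over the indices, \<open>s\<close> the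
    rescaled partial sums of the centered weights, and \<open>q\<close> the defect of
    \<open>V\<close> in the averaged Euler scheme.\<close>
  define F where "F g = (1 / CARD('m)) *\<^sub>R (\<Sum>j\<in>UNIV. B j g)" for g
  define s where "s j k = 1 / N * (\<Sum>l<k. w l j - 1 / CARD('m))" for j k
  define q where "q k = V (Suc k) - V k - (1 / N) *\<^sub>R F (V k)" for k
  let ?e = "e * T + \<kappa> * T / N + CARD('m) * (\<eta> * (K' + K * \<kappa>' * T))"
  have \<eta>: "\<eta> \<ge> 0" using w[of 0] by simp
  have N0: "real N > 0" using N by simp
  have FL: "norm (F g - F g') \<le> K * norm (g - g')" for g g'
  proof -
    have "norm (F g - F g') = 1 / CARD('m) * norm (\<Sum>j\<in>UNIV. B j g - B j g')"
      unfolding F_def scaleR_diff_right[symmetric] by (simp add: sum_subtractf)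
    also have "norm (\<Sum>j\<in>UNIV. B j g - B j g') \<le> (\<Sum>j\<in>(UNIV :: 'm set). K * norm (g - g'))"
      by (intro sum_norm_le B)
    finally show ?thesis by (simp add: field_simps)
  qed
  \<comment> \<open>Only the first of the three sums feeds back into the Gronwall inequality. The
    second is handled by \<open>abel_summation_bound\<close>, and the third collects the local
    errors of both recursions.\<close>
  have id: "G k - V k = (1 / N) *\<^sub>R (\<Sum>l<k. F (G l) - F (V l)) + (\<Sum>j\<in>UNIV. \<Sum>l<k. (s j (Suc l) - s j l) *\<^sub>R B j (G l))
      + (\<Sum>l<k. E l - q l)" if "k \<le> n" for k
    using that
  proof (induction k)
    case (Suc k)
    have 1: "(1 / N) *\<^sub>R (\<Sum>j\<in>UNIV. w k j *\<^sub>R B j (G k)) = (1 / N) *\<^sub>R F (G k) + (\<Sum>j\<in>UNIV. (s j (Suc k) - s j k) *\<^sub>R B j (G k))"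
    proof -
      have "s j (Suc k) - s j k = 1 / N * w k j - 1 / N * (1 / CARD('m))" for j
        by (simp add: s_def algebra_simps)
      then show ?thesis unfolding F_def
        by (simp add: scaleR_diff_left sum_subtractf scaleR_sum_right)
    qed
    have "G (Suc k) - V (Suc k) = (G k - V k) + ((1 / N) *\<^sub>R (F (G k) - F (V k)) + (\<Sum>j\<in>UNIV. (s j (Suc k) - s j k) *\<^sub>R B j (G k)) + (E k - q k))"
      using step[of k] Suc.prems unfolding 1 q_def by (simp add: algebra_simps)
    then show ?case
      by (simp only: Suc.IH[OF Suc_leD[OF Suc.prems]] sum.lessThan_Suc sum.distrib scaleR_add_right add_ac)
  qed (simp add: init)
  have "norm (G k - V k) \<le> ?e + K / N * (\<Sum>l<k. norm (G l - V l))" if k: "k \<le> n" for k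
  proof -
    have kT: "real k \<le> N * T" using k n by linarith
    then have kN: "k / N \<le> T" using N0 by (simp add: field_simps)
    have "norm (\<Sum>l<k. F (G l) - F (V l)) \<le> (\<Sum>l<k. K * norm (G l - V l))"
      by (intro sum_norm_le FL)
    then have 1: "norm ((1 / N) *\<^sub>R (\<Sum>l<k. F (G l) - F (V l))) \<le> K / N * (\<Sum>l<k. norm (G l - V l))"
      using N0 by (simp add: sum_distrib_left[symmetric] field_simps)
    have "norm (\<Sum>l<k. (s j (Suc l) - s j l) *\<^sub>R B j (G l)) \<le> \<eta> * (K' + k * (K * (\<kappa>' / N)))" for j
    proof (rule abel_summation_bound)
      fix l assume "l < k"
      then have "K * norm (G (Suc l) - G l) \<le> K * (\<kappa>' / N)" using inc[of l] k pos by (intro mult_left_mono) auto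
      with B[of j "G (Suc l)" "G l"] show "norm (B j (G (Suc l)) - B j (G l)) \<le> K * (\<kappa>' / N)" by linarith
    qed (use k w[of _ j] K' in \<open>auto simp: s_def\<close>)
    then have "norm (\<Sum>j\<in>UNIV. \<Sum>l<k. (s j (Suc l) - s j l) *\<^sub>R B j (G l)) \<le> (\<Sum>j\<in>(UNIV :: 'm set). \<eta> * (K' + k * (K * (\<kappa>' / N))))"
      by (intro sum_norm_le)
    also have "k * (K * (\<kappa>' / N)) = k / N * (K * \<kappa>')" by simp
    also have "(\<Sum>j\<in>(UNIV :: 'm set). \<eta> * (K' + k / N * (K * \<kappa>'))) \<le> (\<Sum>j\<in>(UNIV :: 'm set). \<eta> * (K' + T * (K * \<kappa>')))"
      using kN \<eta> pos by (intro sum_mono mult_left_mono add_left_mono mult_right_mono) auto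
    finally have 2: "norm (\<Sum>j\<in>UNIV. \<Sum>l<k. (s j (Suc l) - s j l) *\<^sub>R B j (G l)) \<le> CARD('m) * (\<eta> * (K' + K * \<kappa>' * T))"
      by (simp add: mult_ac)
    have "norm (E l - q l) \<le> e / N + \<kappa> / (real N)\<^sup>2" if "l < k" for l
      using norm_triangle_ineq4[of "E l" "q l"] E[of l] V[of l] that k by (auto simp: q_def F_def)
    then have "norm (\<Sum>l<k. E l - q l) \<le> (\<Sum>l<k. e / N + \<kappa> / (real N)\<^sup>2)" by (intro sum_norm_le) auto
    also have "\<dots> = (k / N) * (e + \<kappa> / N)" using N0 by (simp add: field_simps power2_eq_square)
    also have "\<dots> \<le> T * (e + \<kappa> / N)" using kN pos N0 by (intro mult_right_mono) auto
    finally have 3: "norm (\<Sum>l<k. E l - q l) \<le> e * T + \<kappa> * T / N" by (simp add: algebra_simps)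
    have "norm (G k - V k) \<le> norm ((1 / N) *\<^sub>R (\<Sum>l<k. F (G l) - F (V l)))
       + norm (\<Sum>j\<in>UNIV. \<Sum>l<k. (s j (Suc l) - s j l) *\<^sub>R B j (G l)) + norm (\<Sum>l<k. E l - q l)"
      unfolding id[OF k] by (meson norm_triangle_ineq norm_triangle_le add_mono order_refl order_trans)
    with 1 2 3 show ?thesis by linarith
  qed
  then have "norm (G n - V n) \<le> ?e * (1 + K / N) ^ n"
    using pos \<eta> N0 by (intro discrete_gronwall) auto
  also have "\<dots> \<le> ?e * exp (K * T)"
    using pos \<eta> N n by (intro mult_left_mono power_one_plus_le_exp) auto
  finally show ?thesis .
qed

section \<open>Gaussian vectors and the multivariate central limit theorem\<close>

text \<open>Cholesky factorization by induction on the index set. Singular kernels are allowed, so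
  the pivot \<open>K a a\<close> may vanish; positivity then forces its whole row to vanish. For a
  positive pivot the induction hypothesis is applied to the Schur complement.\<close>

lemma psd_kernel_factorization:
  fixes K :: "'i \<Rightarrow> 'i \<Rightarrow> real"
  assumes "finite I" "\<And>i j. i \<in> I \<Longrightarrow> j \<in> I \<Longrightarrow> K i j = K j i"
    "\<And>u. 0 \<le> (\<Sum>i\<in>I. \<Sum>j\<in>I. u i * u j * K i j)"
  shows "\<exists>b. \<forall>i\<in>I. \<forall>j\<in>I. K i j = (\<Sum>k\<in>I. b i k * b j k)"
  using assms
proof (induction I arbitrary: K rule: finite_induct)
  case (insert a I)
  have sum': "(\<Sum>i\<in>insert a I. \<Sum>j\<in>insert a I. u i * u j * K i j) =
      u a * u a * K a a + 2 * u a * (\<Sum>i\<in>I. u i * K i a) + (\<Sum>i\<in>I. \<Sum>j\<in>I. u i * u j * K i j)" for u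
  proof -
    have "K a j = K j a" if "j \<in> I" for j using insert.prems(1) that by blast
    then show ?thesis using insert.hyps
      by (simp add: sum.distrib sum_distrib_left algebra_simps)
  qed
  show ?case
  proof (cases "K a a = 0")
    case True
    have z: "K i a = 0" if i: "i \<in> I" for i
    proof (rule ccontr)
      assume nz: "K i a \<noteq> 0"
      \<comment> \<open>Chosen so that the quadratic form takes the value
        \<open>2 * s * K i a + K i i = -1\<close>.\<close>
      define s where "s = - (K i i + 1) / (2 * K i a)"
      define u where "u = (\<lambda>j. if j = a then s else if j = i then 1 else 0)"
      have ai: "i \<noteq> a" using i insert.hyps by auto
      have "(\<Sum>j\<in>I. u j * K j a) = (\<Sum>j\<in>I. if j = i then K i a else 0)"
        using insert.hyps by (intro sum.cong) (auto simp: u_def)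
      then have "(\<Sum>j\<in>I. u j * K j a) = K i a" using i insert.hyps by simp
      moreover have "(\<Sum>k\<in>I. \<Sum>j\<in>I. u k * u j * K k j) = K i i"
      proof -
        have uj: "u j = (if j = i then 1 else 0)" if "j \<in> I" for j
          using that insert.hyps by (auto simp: u_def)
        have "(\<Sum>k\<in>I. \<Sum>j\<in>I. u k * u j * K k j) = (\<Sum>k\<in>I. if k = i then (\<Sum>j\<in>I. if j = i then K k j else 0) else 0)"
        proof (intro sum.cong refl)
          fix k assume "k \<in> I"
          have "(\<Sum>j\<in>I. u k * u j * K k j) = (\<Sum>j\<in>I. if j = i then (if k = i then K k j else 0) else 0)"
            using \<open>k \<in> I\<close> by (intro sum.cong) (auto simp: uj)
          then show "(\<Sum>j\<in>I. u k * u j * K k j) = (if k = i then (\<Sum>j\<in>I. if j = i then K k j else 0) else 0)"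
            by (cases "k = i") (auto cong: if_cong)
        qed
        then show ?thesis using i insert.hyps by simp
      qed
      ultimately have "0 \<le> 2 * s * K i a + K i i"
        using insert.prems(2)[of u] unfolding sum' by (simp add: True u_def)
      also have "\<dots> = -1" using nz by (simp add: s_def field_simps)
      finally show False by simp
    qed
    have "\<exists>b. \<forall>i\<in>I. \<forall>j\<in>I. K i j = (\<Sum>k\<in>I. b i k * b j k)"
    proof (rule insert.IH)
      fix u :: "'i \<Rightarrow> real"
      have "0 \<le> (\<Sum>i\<in>insert a I. \<Sum>j\<in>insert a I. (u(a := 0)) i * (u(a := 0)) j * K i j)" by (rule insert.prems)
      also have "\<dots> = (\<Sum>i\<in>I. \<Sum>j\<in>I. (u(a := 0)) i * (u(a := 0)) j * K i j)" unfolding sum' by simp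
      also have "\<dots> = (\<Sum>i\<in>I. \<Sum>j\<in>I. u i * u j * K i j)" using insert.hyps by (intro sum.cong) auto
      finally show "0 \<le> (\<Sum>i\<in>I. \<Sum>j\<in>I. u i * u j * K i j)" .
    qed (use insert.prems in auto)
    then obtain b where b: "\<And>i j. i \<in> I \<Longrightarrow> j \<in> I \<Longrightarrow> K i j = (\<Sum>k\<in>I. b i k * b j k)" by blast
    \<comment> \<open>A vanishing pivot contributes a zero row and a zero column to the
      factor.\<close>
    define b' where "b' i k = (if i = a \<or> k = a then 0 else b i k)" for i k
    have "K i j = (\<Sum>k\<in>insert a I. b' i k * b' j k)" if ij: "i \<in> insert a I" "j \<in> insert a I" for i j
    proof (cases "i = a \<or> j = a")
      case True
      have "K j a = K a j" "K i a = K a i" using ij insert.prems(1) by auto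
      then have "K i j = 0" using True z ij \<open>K a a = 0\<close> by auto
      moreover have "(\<Sum>k\<in>insert a I. b' i k * b' j k) = 0"
        using True by (intro sum.neutral) (auto simp: b'_def)
      ultimately show ?thesis by simp
    next
      case False
      then have "(\<Sum>k\<in>I. b' i k * b' j k) = (\<Sum>k\<in>I. b i k * b j k)"
        using insert.hyps by (intro sum.cong) (auto simp: b'_def)
      then show ?thesis using insert.hyps False ij b[of i j] by (auto simp: b'_def)
    qed
    then show ?thesis by blast
  next
    case False
    define c where "c = K a a"
    have "0 \<le> (\<Sum>i\<in>insert a I. \<Sum>j\<in>insert a I. (if i = a then 1 else 0) * (if j = a then 1 else 0) * K i j)" by (rule insert.prems)
    moreover have "(\<Sum>i\<in>I. (if i = a then 1 else 0) * K i a) = 0"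
      "(\<Sum>i\<in>I. \<Sum>j\<in>I. (if i = a then 1 else 0) * (if j = a then 1 else 0) * K i j) = 0"
      using insert.hyps by (auto intro!: sum.neutral)
    ultimately have "c \<ge> 0" unfolding sum' c_def by simp
    then have c: "c > 0" using False by (simp add: c_def)
    \<comment> \<open>The Schur complement of the pivot. Its form at \<open>u\<close> is the
      original form with the entry of \<open>u\<close> at \<open>a\<close> chosen to minimize it,
      which is the value \<open>- s / c\<close> below.\<close>
    define K' where "K' i j = K i j - K i a * K j a / c" for i j
    have "\<exists>b. \<forall>i\<in>I. \<forall>j\<in>I. K' i j = (\<Sum>k\<in>I. b i k * b j k)"
    proof (rule insert.IH)
      fix u :: "'i \<Rightarrow> real"
      define s where "s = (\<Sum>i\<in>I. u i * K i a)"
      let ?v = "u(a := - s / c)"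
      have v: "(\<Sum>i\<in>I. ?v i * K i a) = s" "(\<Sum>i\<in>I. \<Sum>j\<in>I. ?v i * ?v j * K i j) = (\<Sum>i\<in>I. \<Sum>j\<in>I. u i * u j * K i j)"
        unfolding s_def using insert.hyps by (auto intro!: sum.cong)
      have "0 \<le> (\<Sum>i\<in>insert a I. \<Sum>j\<in>insert a I. ?v i * ?v j * K i j)" by (rule insert.prems)
      also have "\<dots> = (\<Sum>i\<in>I. \<Sum>j\<in>I. u i * u j * K i j) - s * s / c"
        unfolding sum' v using c by (simp add: c_def[symmetric] field_simps)
      also have "s * s / c = (\<Sum>i\<in>I. \<Sum>j\<in>I. u i * u j * (K i a * K j a / c))"
        unfolding s_def sum_product by (simp add: sum_divide_distrib mult_ac)
      finally show "0 \<le> (\<Sum>i\<in>I. \<Sum>j\<in>I. u i * u j * K' i j)"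
        by (simp add: K'_def sum_subtractf right_diff_distrib)
    qed (use insert.prems in \<open>auto simp: K'_def\<close>)
    then obtain b where b: "\<And>i j. i \<in> I \<Longrightarrow> j \<in> I \<Longrightarrow> K' i j = (\<Sum>k\<in>I. b i k * b j k)" by blast
    define b' where "b' i k = (if k = a then K i a / sqrt c else if i = a then 0 else b i k)" for i k
    have cc: "sqrt c * sqrt c = c" using c by simp
    have "K i j = (\<Sum>k\<in>insert a I. b' i k * b' j k)" if ij: "i \<in> insert a I" "j \<in> insert a I" for i j
    proof -
      have "(\<Sum>k\<in>insert a I. b' i k * b' j k) = K i a * K j a / c + (\<Sum>k\<in>I. b' i k * b' j k)"
        using insert.hyps cc by (simp add: b'_def)
      moreover have "(\<Sum>k\<in>I. b' i k * b' j k) = K i j - K i a * K j a / c"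
      proof (cases "i = a \<or> j = a")
        case True
        have "K j a = K a j" "K i a = K a i" using ij insert.prems(1) by auto
        moreover have "(\<Sum>k\<in>I. b' i k * b' j k) = 0"
          using True insert.hyps by (intro sum.neutral) (auto simp: b'_def)
        ultimately show ?thesis using True c by (auto simp: c_def)
      next
        case False
        then have "(\<Sum>k\<in>I. b' i k * b' j k) = (\<Sum>k\<in>I. b i k * b j k)"
          using insert.hyps by (intro sum.cong) (auto simp: b'_def)
        then show ?thesis using False ij b[of i j] by (auto simp: K'_def)
      qed
      ultimately show ?thesis by simp
    qed
    then show ?thesis by blast
  qed
qed simp

section \<open>Normal laws and Gaussian vectors with given covariance\<close>

lemma real_distribution_centered_normal: "real_distribution (centered_normal v)" if "v \<ge> 0"
proof -
  have "prob_space (centered_normal v)"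
    using that prob_space_return[of "0::real" borel] prob_space_normal_density[of "sqrt v" 0]
    by (auto simp: centered_normal_def)
  then show ?thesis
    by (auto simp: real_distribution_def real_distribution_axioms_def centered_normal_def)
qed

lemma char_scale: "char (distr M borel (\<lambda>x. c * X x)) t = char (distr M borel X) (t * c)"
  if "X \<in> borel_measurable M"
  using that by (simp add: char_def integral_distr mult.assoc)

lemma char_centered_normal:
  assumes "v \<ge> 0"
  shows "char (centered_normal v) t = exp (- (v * t\<^sup>2) / 2)"
proof (cases "v = 0")
  case True
  then show ?thesis by (simp add: centered_normal_def char_def integral_return)
next
  case False
  with assms have v: "v > 0" by simp
  interpret prob_space std_normal_distribution by (rule prob_space_normal_density) simp
  have "distributed std_normal_distribution lborel (\<lambda>x. x) std_normal_density"
    by (auto simp: distributed_def distr_id2)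
  then have "distributed std_normal_distribution lborel (\<lambda>x. 0 + sqrt v * x) (normal_density (0 + sqrt v * 0) (\<bar>sqrt v\<bar> * 1))"
    using v by (intro normal_density_affine) auto
  then have "distr std_normal_distribution lborel (\<lambda>x. sqrt v * x) = centered_normal v"
    using v by (simp add: distributed_def centered_normal_def)
  then have "centered_normal v = distr std_normal_distribution borel (\<lambda>x. sqrt v * x)"
    by (metis distr_cong sets_lborel)
  then have "char (centered_normal v) t = char (distr std_normal_distribution borel (\<lambda>x. x)) (t * sqrt v)"
    by (simp add: char_scale)
  also have "distr std_normal_distribution borel (\<lambda>x. x) = std_normal_distribution"
    by (rule distr_id2) simp
  also have "char std_normal_distribution (t * sqrt v) = exp (- (v * t\<^sup>2) / 2)"
  proof -
    have "(t * sqrt v)\<^sup>2 = v * t\<^sup>2" using v by (simp add: power_mult_distrib)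
    then show ?thesis unfolding char_std_normal_distribution by simp
  qed
  finally show ?thesis .
qed

lemma borel_measurable_vec_lambda:
  fixes f :: "'m::finite \<Rightarrow> 'a \<Rightarrow> real"
  assumes "\<And>i. f i \<in> borel_measurable M"
  shows "(\<lambda>x. \<chi> i. f i x) \<in> borel_measurable M"
  using assms by (subst borel_measurable_euclidean_space) (auto simp: Basis_vec_def inner_axis)

text \<open>The image of independent standard normals under the Cholesky factor \<open>b\<close>.
  Its linear functionals are sums of independent normals, identified through characteristic
  functions, which also covers variance zero.\<close>

lemma centered_gaussian_exists:
  fixes K :: "'m::finite \<Rightarrow> 'm \<Rightarrow> real"
  assumes "\<And>i j. K i j = K j i" "\<And>u. 0 \<le> (\<Sum>i\<in>UNIV. \<Sum>j\<in>UNIV. u i * u j * K i j)"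
  shows "\<exists>\<nu>. centered_gaussian \<nu> (\<chi> i j. K i j)"
proof -
  have "\<exists>b. \<forall>i\<in>UNIV. \<forall>j\<in>UNIV. K i j = (\<Sum>k\<in>(UNIV :: 'm set). b i k * b j k)"
    using assms by (intro psd_kernel_factorization) auto
  then obtain b where b: "\<And>i j. K i j = (\<Sum>k\<in>(UNIV :: 'm set). b i k * b j k)" by blast
  define P where "P = PiM (UNIV :: 'm set) (\<lambda>_. std_normal_distribution)"
  interpret std: prob_space std_normal_distribution by (rule prob_space_normal_density) simp
  interpret product_prob_space "\<lambda>_. std_normal_distribution" "UNIV :: 'm set" ..
  have P: "prob_space P" unfolding P_def
    by (rule prob_space_PiM) (rule std.prob_space_axioms)
  interpret PP: prob_space P by (fact P)
  define Z where "Z \<omega> = (\<chi> i. \<Sum>k\<in>UNIV. b i k * \<omega> k)" for \<omega> :: "'m \<Rightarrow> real"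
  have comp: "(\<lambda>\<omega>. \<omega> k) \<in> borel_measurable P" for k :: 'm
  proof -
    have "(\<lambda>\<omega>. \<omega> k) \<in> P \<rightarrow>\<^sub>M std_normal_distribution"
      unfolding P_def by (rule measurable_component_singleton) simp
    then show ?thesis by (simp add: measurable_def)
  qed
  have Z[measurable]: "Z \<in> borel_measurable P"
    unfolding Z_def using comp by (intro borel_measurable_vec_lambda) measurable
  have dk: "distr P borel (\<lambda>\<omega>. \<omega> k) = std_normal_distribution" for k
  proof -
    have "distr P std_normal_distribution (\<lambda>\<omega>. \<omega> k) = std_normal_distribution"
      unfolding P_def by (rule PiM_component) simp
    then show ?thesis by (metis distr_cong sets_density sets_lborel)
  qed
  have indep: "PP.indep_vars (\<lambda>_. borel) (\<lambda>k \<omega>. \<omega> k) (UNIV :: 'm set)"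
  proof (subst PP.indep_vars_iff_distr_eq_PiM)
    have "sets P = sets (PiM UNIV (\<lambda>_. borel))" unfolding P_def by (intro sets_PiM_cong) auto
    then show "distr P (PiM UNIV (\<lambda>_. borel)) (\<lambda>x. \<lambda>i\<in>UNIV. x i) = (\<Pi>\<^sub>M i\<in>UNIV. distr P borel (\<lambda>\<omega>. \<omega> i))"
      unfolding dk by (simp add: restrict_UNIV distr_id2 P_def)
  qed (use comp in auto)
  show ?thesis
  proof (intro exI[of _ "distr P borel Z"], unfold centered_gaussian_def, intro conjI allI)
    show "prob_space (distr P borel Z)" by (rule PP.prob_space_distr) simp
    fix u :: "real^'m"
    define c where "c k = (\<Sum>i\<in>UNIV. u $ i * b i k)" for k
    have uZ: "u \<bullet> Z \<omega> = (\<Sum>k\<in>UNIV. c k * \<omega> k)" for \<omega>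
      unfolding inner_vec_def Z_def c_def by (simp add: sum_distrib_left sum_distrib_right mult_ac) (rule sum.swap)
    have uS: "u \<bullet> ((\<chi> i j. K i j) *v u) = (\<Sum>k\<in>UNIV. (c k)\<^sup>2)"
    proof -
      have "u \<bullet> ((\<chi> i j. K i j) *v u) = (\<Sum>i\<in>UNIV. \<Sum>j\<in>UNIV. \<Sum>k\<in>UNIV. (u $ i * b i k) * (u $ j * b j k))"
        by (simp add: inner_vec_def matrix_vector_mult_def b sum_distrib_left sum_distrib_right mult_ac)
      also have "\<dots> = (\<Sum>k\<in>UNIV. \<Sum>i\<in>UNIV. \<Sum>j\<in>UNIV. (u $ i * b i k) * (u $ j * b j k))"
        by (subst (2) sum.swap, subst sum.swap) simp
      also have "\<dots> = (\<Sum>k\<in>UNIV. (c k)\<^sup>2)"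
        by (simp add: c_def power2_eq_square sum_product)
      finally show ?thesis .
    qed
    let ?v = "\<Sum>k\<in>UNIV. (c k)\<^sup>2"
    have v: "?v \<ge> 0" by (simp add: sum_nonneg)
    have m: "(\<lambda>\<omega>. \<Sum>k\<in>UNIV. c k * \<omega> k) \<in> borel_measurable P" using comp by measurable
    have "distr (distr P borel Z) borel (\<lambda>v. u \<bullet> v) = distr P borel (\<lambda>\<omega>. \<Sum>k\<in>UNIV. c k * \<omega> k)"
      by (subst distr_distr) (auto simp: comp_def uZ)
    also have "\<dots> = centered_normal ?v"
    proof (rule Levy_uniqueness)
      show "real_distribution (distr P borel (\<lambda>\<omega>. \<Sum>k\<in>UNIV. c k * \<omega> k))"
        using m by (intro PP.real_distribution_distr) auto
      show "real_distribution (centered_normal ?v)" using v by (rule real_distribution_centered_normal)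
      show "char (distr P borel (\<lambda>\<omega>. \<Sum>k\<in>UNIV. c k * \<omega> k)) = char (centered_normal ?v)"
      proof
        fix t
        have "PP.indep_vars (\<lambda>_. borel) (\<lambda>k \<omega>. c k * \<omega> k) UNIV"
          using PP.indep_vars_compose2[OF indep, of "\<lambda>k x. c k * x" "\<lambda>_. borel"] by simp
        then have "char (distr P borel (\<lambda>\<omega>. \<Sum>k\<in>UNIV. c k * \<omega> k)) t = (\<Prod>k\<in>UNIV. char (distr P borel (\<lambda>\<omega>. c k * \<omega> k)) t)"
          by (rule PP.char_distr_sum)
        also have "\<dots> = (\<Prod>k\<in>UNIV. exp (of_real (- ((c k)\<^sup>2 * t\<^sup>2) / 2)))"
        proof (intro prod.cong refl)
          fix k
          have "char (distr P borel (\<lambda>\<omega>. c k * \<omega> k)) t = char std_normal_distribution (t * c k)"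
            by (simp only: char_scale[OF comp] dk)
          then show "char (distr P borel (\<lambda>\<omega>. c k * \<omega> k)) t = exp (of_real (- ((c k)\<^sup>2 * t\<^sup>2) / 2))"
            unfolding exp_of_real char_std_normal_distribution by (simp add: power_mult_distrib mult.commute)
        qed
        also have "\<dots> = exp (of_real (\<Sum>k\<in>UNIV. - ((c k)\<^sup>2 * t\<^sup>2) / 2))"
          by (simp add: exp_sum)
        also have "(\<Sum>k\<in>UNIV. - ((c k)\<^sup>2 * t\<^sup>2) / 2) = - (?v * t\<^sup>2) / 2"
          by (simp add: sum_negf sum_divide_distrib sum_distrib_right)
        finally show "char (distr P borel (\<lambda>\<omega>. \<Sum>k\<in>UNIV. c k * \<omega> k)) t = char (centered_normal ?v) t"
          unfolding char_centered_normal[OF v] exp_of_real .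
      qed
    qed
    finally show "distr (distr P borel Z) borel (\<lambda>v. u \<bullet> v) = centered_normal (u \<bullet> ((\<chi> i j. K i j) *v u))"
      unfolding uS .
  qed simp
qed

text \<open>\<open>\<phi>(t / \<surd>N)\<^sup>N\<close> is compared with \<open>(1 - t\<^sup>2 v / 2N)\<^sup>N\<close> through \<open>\<bar>a\<^sup>N - b\<^sup>N\<bar> \<le> N \<bar>a - b\<bar>\<close>.\<close>

lemma char_normalized_sum_tendsto:
  fixes \<xi> :: "nat \<Rightarrow> nat \<Rightarrow> 'a \<Rightarrow> real" and \<rho> :: "real measure"
  assumes P: "\<And>N. N \<ge> 1 \<Longrightarrow> prob_space (P N)"
    and indep: "\<And>N. N \<ge> 1 \<Longrightarrow> prob_space.indep_vars (P N) (\<lambda>_. borel) (\<xi> N) {1..N}"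
    and law: "\<And>N i. N \<ge> 1 \<Longrightarrow> i \<in> {1..N} \<Longrightarrow> distr (P N) borel (\<xi> N i) = \<rho>"
    and \<rho>: "real_distribution \<rho>" "AE x in \<rho>. \<bar>x\<bar> \<le> b" "(\<integral>x. x \<partial>\<rho>) = 0" "(\<integral>x. x\<^sup>2 \<partial>\<rho>) = v"
  shows "(\<lambda>N. char (distr (P N) borel (\<lambda>\<omega>. 1 / sqrt N * (\<Sum>i=1..N. \<xi> N i \<omega>))) 1) \<longlonglongrightarrow> exp (- v / 2)"
proof -
  interpret R: real_distribution \<rho> by fact
  have b0: "b \<ge> 0"
  proof (rule ccontr)
    assume "\<not> 0 \<le> b"
    then have "\<not> \<bar>x\<bar> \<le> b" for x using abs_ge_zero[of x] by linarith
    then have "AE x in \<rho>. False" using \<rho>(2) by simp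
    then show False by (simp add: R.AE_False)
  qed
  have i1: "integrable \<rho> (\<lambda>x. x)" by (rule R.integrable_const_bound[of _ b]) (use \<rho> in auto)
  have i2: "integrable \<rho> (\<lambda>x. x\<^sup>2)"
  proof (rule R.integrable_const_bound[of _ "b\<^sup>2"])
    show "AE x in \<rho>. norm (x\<^sup>2) \<le> b\<^sup>2" using \<rho>(2)
      by eventually_elim (simp add: power_mono abs_le_square_iff power2_le_iff_abs_le b0)
  qed auto
  have v0: "v \<ge> 0" using \<rho>(4) by (auto intro!: integral_nonneg_AE)
  \<comment> \<open>A law supported in \<open>[-b, b]\<close> has third absolute moment at most
    \<open>b^3\<close>, so the second order expansion has a cubic error. At
    \<open>t = 1 / sqrt N\<close> it still tends to 0 after multiplication by
    \<open>N\<close>.\<close>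
  have est: "cmod (char \<rho> t - (1 - t\<^sup>2 * v / 2)) \<le> \<bar>t\<bar>^3 * b^3 / 6" for t
  proof -
    have "cmod (char \<rho> t - (1 - t^2 * v / 2)) \<le> (t^2 / 6) * R.expectation (\<lambda>x. min (6 * x^2) (\<bar>t\<bar> * \<bar>x\<bar>^3))"
      using i1 i2 \<rho>(3,4) by (intro R.char_approx3) auto
    also have "R.expectation (\<lambda>x. min (6 * x^2) (\<bar>t\<bar> * \<bar>x\<bar>^3)) \<le> R.expectation (\<lambda>x. \<bar>t\<bar> * b^3)"
    proof (rule integral_mono_AE)
      have bd: "AE x in \<rho>. min (6 * x^2) (\<bar>t\<bar> * \<bar>x\<bar>^3) \<le> \<bar>t\<bar> * b^3"
        using \<rho>(2)
      proof eventually_elim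
        case (elim x)
        then have "\<bar>x\<bar>^3 \<le> b^3" by (intro power_mono) auto
        then have "\<bar>t\<bar> * \<bar>x\<bar>^3 \<le> \<bar>t\<bar> * b^3" by (intro mult_left_mono) auto
        then show ?case by linarith
      qed
      then show "AE x in \<rho>. min (6 * x^2) (\<bar>t\<bar> * \<bar>x\<bar>^3) \<le> \<bar>t\<bar> * b^3" .
      show "integrable \<rho> (\<lambda>x. min (6 * x^2) (\<bar>t\<bar> * \<bar>x\<bar>^3))"
        using bd by (intro R.integrable_const_bound[of _ "\<bar>t\<bar> * b^3"]) auto
    qed auto
    also have "R.expectation (\<lambda>x. \<bar>t\<bar> * b^3) = \<bar>t\<bar> * b^3" using R.prob_space by simp
    also have "t\<^sup>2 / 6 * (\<bar>t\<bar> * b^3) = \<bar>t\<bar>^3 * b^3 / 6"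
      by (simp add: power3_eq_cube power2_eq_square abs_mult[symmetric])
    finally show ?thesis by (simp add: mult_left_mono)
  qed
  have eq: "char (distr (P N) borel (\<lambda>\<omega>. 1 / sqrt N * (\<Sum>i=1..N. \<xi> N i \<omega>))) 1 = char \<rho> (1 / sqrt N) ^ N" if N: "N \<ge> 1" for N
  proof -
    interpret prob_space "P N" by (rule P[OF N])
    have m: "\<And>i. i \<in> {1..N} \<Longrightarrow> \<xi> N i \<in> borel_measurable (P N)" using indep[OF N] unfolding indep_vars_def by blast
    have "char (distr (P N) borel (\<lambda>\<omega>. 1 / sqrt N * (\<Sum>i=1..N. \<xi> N i \<omega>))) 1 =
       char (distr (P N) borel (\<lambda>\<omega>. \<Sum>i=1..N. \<xi> N i \<omega>)) (1 * (1 / sqrt N))"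
      using m by (intro char_scale borel_measurable_sum) auto
    also have "\<dots> = (\<Prod>i=1..N. char (distr (P N) borel (\<xi> N i)) (1 / sqrt N))"
      using char_distr_sum[OF indep[OF N]] by simp
    also have "\<dots> = (\<Prod>i=1..N. char \<rho> (1 / sqrt N))" using law[OF N] by (intro prod.cong) auto
    finally show ?thesis by simp
  qed
  define w where "w N = (1 + complex_of_real (- v / 2) / of_nat N)" for N :: nat
  have wlim: "(\<lambda>N. w N ^ N) \<longlonglongrightarrow> exp (of_real (- v / 2))"
  proof -
    have "(\<lambda>N. complex_of_real ((1 + (- v / 2) / real N) ^ N)) \<longlonglongrightarrow> of_real (exp (- v / 2))"
      by (intro tendsto_of_real tendsto_exp_limit_sequentially)
    then show ?thesis by (simp add: w_def exp_of_real[symmetric])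
  qed
  have diff: "\<forall>\<^sub>F N in sequentially. norm (char \<rho> (1 / sqrt N) ^ N - w N ^ N) \<le> b^3 / 6 / sqrt N"
  proof -
    have "\<forall>\<^sub>F N in sequentially. N \<ge> max 1 (nat \<lceil>v\<rceil>)" by (rule eventually_ge_at_top)
    then show ?thesis
    proof eventually_elim
      case (elim N)
      then have N: "N \<ge> 1" "v \<le> N" by (auto simp: nat_le_iff ceiling_le_iff)
      have t: "(1 / sqrt N)\<^sup>2 = 1 / N" by (simp add: power_divide)
      \<comment> \<open>Uses \<open>v \<le> N\<close>; the comparison of powers requires both bases
        to lie in the unit disc.\<close>
      have "norm (w N) \<le> 1"
      proof -
        have "w N = of_real (1 - v / 2 / N)" by (simp add: w_def)
        then have "norm (w N) = \<bar>1 - v / 2 / N\<bar>" by (simp only: norm_of_real)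
        also have "\<dots> \<le> 1" using N v0 by (auto simp: abs_le_iff field_simps)
        finally show ?thesis .
      qed
      then have "norm (char \<rho> (1 / sqrt N) ^ N - w N ^ N) \<le> N * norm (char \<rho> (1 / sqrt N) - w N)"
        by (intro norm_power_diff R.cmod_char_le_1)
      also have "norm (char \<rho> (1 / sqrt N) - w N) \<le> \<bar>1 / sqrt N\<bar>^3 * b^3 / 6"
        using est[of "1 / sqrt N"] unfolding t by (simp add: w_def mult.commute)
      also have "real N * (\<bar>1 / sqrt N\<bar>^3 * b^3 / 6) = b^3 / 6 / sqrt N"
        using N by (simp add: power3_eq_cube field_simps)
      finally show ?case using N by (simp add: mult_left_mono)
    qed
  qed
  have "(\<lambda>N. b^3 / 6 / sqrt (real N)) \<longlonglongrightarrow> 0"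
    by (intro tendsto_divide_0[OF tendsto_const] filterlim_at_top_imp_at_infinity
          filterlim_compose[OF sqrt_at_top filterlim_real_sequentially])
  then have "(\<lambda>N. char \<rho> (1 / sqrt N) ^ N - w N ^ N) \<longlonglongrightarrow> 0"
    using diff by (rule Lim_null_comparison[rotated])
  from tendsto_add[OF this wlim] have "(\<lambda>N. char \<rho> (1 / sqrt N) ^ N) \<longlonglongrightarrow> exp (of_real (- v / 2))" by simp
  then have "(\<lambda>N. char (distr (P N) borel (\<lambda>\<omega>. 1 / sqrt N * (\<Sum>i=1..N. \<xi> N i \<omega>))) 1) \<longlonglongrightarrow> exp (of_real (- v / 2))"
    by (rule Lim_transform_eventually) (intro eventually_sequentiallyI[of 1] eq[symmetric])
  then show ?thesis by (simp add: exp_of_real[symmetric])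
qed


section \<open>Trigonometric sums and weak convergence\<close>

text \<open>Real trigonometric polynomials with arbitrary frequencies; the phase \<open>b\<close>
  provides the sines. Their integrals are determined by characteristic functions.\<close>

inductive trig_sum :: "('a::real_inner \<Rightarrow> real) \<Rightarrow> bool" where
  cos: "trig_sum (\<lambda>x. a * cos (u \<bullet> x + b))"
| add: "trig_sum f \<Longrightarrow> trig_sum g \<Longrightarrow> trig_sum (\<lambda>x. f x + g x)"

lemma trig_sum_const: "trig_sum (\<lambda>x. c)"
  using trig_sum.cos[of c 0 0] by simp

lemma trig_sum_sum: "finite I \<Longrightarrow> (\<And>i. i \<in> I \<Longrightarrow> trig_sum (f i)) \<Longrightarrow> trig_sum (\<lambda>x. \<Sum>i\<in>I. f i x)"
  by (induction I rule: finite_induct) (auto intro: trig_sum_const trig_sum.add)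

text \<open>A product of two cosines is a sum of two cosines, with frequencies added and subtracted.
  This makes trigonometric sums an algebra.\<close>

lemma trig_sum_cos_mult: "trig_sum g \<Longrightarrow> trig_sum (\<lambda>x. a * cos (u \<bullet> x + b) * g x)"
proof (induction rule: trig_sum.induct)
  case (cos a' u' b')
  have "(\<lambda>x. a * cos (u \<bullet> x + b) * (a' * cos (u' \<bullet> x + b'))) =
    (\<lambda>x. a * a' / 2 * cos ((u - u') \<bullet> x + (b - b')) + a * a' / 2 * cos ((u + u') \<bullet> x + (b + b')))"
  proof
    fix x
    have "cos (u \<bullet> x + b) * cos (u' \<bullet> x + b') =
        (cos ((u - u') \<bullet> x + (b - b')) + cos ((u + u') \<bullet> x + (b + b'))) / 2"
      by (simp add: cos_times_cos inner_diff_left inner_add_left algebra_simps)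
    then show "a * cos (u \<bullet> x + b) * (a' * cos (u' \<bullet> x + b')) =
       a * a' / 2 * cos ((u - u') \<bullet> x + (b - b')) + a * a' / 2 * cos ((u + u') \<bullet> x + (b + b'))"
      by (simp add: field_simps)
  qed
  then show ?case by (simp only:) (intro trig_sum.intros)
next
  case (add f g)
  then have "trig_sum (\<lambda>x. a * cos (u \<bullet> x + b) * f x + a * cos (u \<bullet> x + b) * g x)"
    by (intro trig_sum.add)
  then show ?case by (simp add: distrib_left)
qed

lemma trig_sum_mult: "trig_sum f \<Longrightarrow> trig_sum g \<Longrightarrow> trig_sum (\<lambda>x. f x * g x)"
proof (induction rule: trig_sum.induct)
  case (cos a u b)
  then show ?case by (rule trig_sum_cos_mult)
next
  case (add f f')
  then have "trig_sum (\<lambda>x. f x * g x + f' x * g x)" by (intro trig_sum.add) auto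
  then show ?case by (simp add: distrib_right)
qed

text \<open>By the algebra property it is enough to treat linear functions, and each coordinate sine
  is a cosine with phase \<open>- pi / 2\<close>.\<close>

lemma trig_sum_polynomial_sin:
  fixes p :: "real^'m::finite \<Rightarrow> real"
  assumes "real_polynomial_function p"
  shows "trig_sum (\<lambda>x. p (\<chi> j. sin (c * x $ j)))"
  using assms
proof (induction rule: real_polynomial_function.induct)
  case (linear f)
  interpret bounded_linear f by fact
  have "f (\<chi> j. sin (c * x $ j)) = (\<Sum>j\<in>UNIV. f (axis j 1) * cos ((c *\<^sub>R axis j 1) \<bullet> x + (- pi / 2)))" for x
  proof -
    have "(\<chi> j. sin (c * x $ j)) = (\<Sum>j\<in>UNIV. sin (c * x $ j) *\<^sub>R axis j 1)"
      using basis_expansion[of "\<chi> j. sin (c * x $ j)"] by (simp add: scalar_mult_eq_scaleR)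
    then have "f (\<chi> j. sin (c * x $ j)) = (\<Sum>j\<in>UNIV. sin (c * x $ j) * f (axis j 1))"
      by (simp add: sum scaleR)
    also have "\<dots> = (\<Sum>j\<in>UNIV. f (axis j 1) * cos ((c *\<^sub>R axis j 1) \<bullet> x + (- pi / 2)))"
    proof (intro sum.cong refl)
      fix j
      have "cos ((c *\<^sub>R axis j 1) \<bullet> x + (- pi / 2)) = cos (c * x $ j - pi / 2)"
        by (simp add: inner_axis' )
      also have "\<dots> = sin (c * x $ j)" by (simp add: cos_diff)
      finally show "sin (c * x $ j) * f (axis j 1) = f (axis j 1) * cos ((c *\<^sub>R axis j 1) \<bullet> x + (- pi / 2))" by simp
    qed
    finally show ?thesis .
  qed
  then show ?case by (simp only:) (intro trig_sum_sum trig_sum.cos, simp)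
qed (auto intro: trig_sum_const trig_sum.add trig_sum_mult)

lemma trig_sum_continuous: "trig_sum f \<Longrightarrow> continuous_on UNIV f"
  by (induction rule: trig_sum.induct) (auto intro!: continuous_intros)

lemma trig_sum_bounded: "trig_sum f \<Longrightarrow> \<exists>B. \<forall>x. \<bar>f x\<bar> \<le> B"
proof (induction rule: trig_sum.induct)
  case (cos a u b)
  have "\<bar>a * cos (u \<bullet> x + b)\<bar> \<le> \<bar>a\<bar>" for x
    by (simp add: abs_mult mult_left_le)
  then show ?case by blast
next
  case (add f g)
  then obtain A B where "\<And>x. \<bar>f x\<bar> \<le> A" "\<And>x. \<bar>g x\<bar> \<le> B" by blast
  then have "\<bar>f x + g x\<bar> \<le> A + B" for x using abs_triangle_ineq[of "f x" "g x"] by (smt (verit))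
  then show ?case by blast
qed

lemma integral_cos_char:
  fixes M :: "'a::euclidean_space measure"
  assumes "prob_space M" and [measurable_cong]: "sets M = sets borel"
  shows "(\<integral>x. cos (u \<bullet> x + b) \<partial>M) = Re (iexp b * char (distr M borel (\<lambda>x. u \<bullet> x)) 1)"
proof -
  interpret prob_space M by fact
  have i: "integrable M (\<lambda>x. iexp (u \<bullet> x))"
    by (rule integrable_const_bound[of _ 1]) auto
  have "char (distr M borel (\<lambda>x. u \<bullet> x)) 1 = (CLINT x|M. iexp (u \<bullet> x))"
    unfolding char_def by (subst integral_distr) auto
  then have "iexp b * char (distr M borel (\<lambda>x. u \<bullet> x)) 1 = (CLINT x|M. iexp (u \<bullet> x + b))"
    by (simp add: exp_add distrib_left mult_ac)
  moreover have "integrable M (\<lambda>x. iexp (u \<bullet> x + b))"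
    by (rule integrable_const_bound[of _ 1]) (auto simp del: of_real_add)
  ultimately have "Re (iexp b * char (distr M borel (\<lambda>x. u \<bullet> x)) 1) = (\<integral>x. Re (iexp (u \<bullet> x + b)) \<partial>M)"
    by (simp del: of_real_add)
  then show ?thesis by (simp add: Re_exp)
qed

text \<open>Off \<open>Bad\<close> the integrands differ by at most \<open>e\<close>, on
  \<open>Bad\<close> by at most \<open>b + c\<close>. Closeness is only asked almost everywhere,
  because the bounds on the random inputs hold only almost surely.\<close>

lemma (in prob_space) integral_close:
  fixes f g :: "'a \<Rightarrow> real"
  assumes [measurable]: "f \<in> borel_measurable M" "g \<in> borel_measurable M" "Bad \<in> sets M"
    and f: "\<And>x. \<bar>f x\<bar> \<le> b" and g: "\<And>x. \<bar>g x\<bar> \<le> c"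
    and close: "AE x in M. x \<notin> Bad \<longrightarrow> \<bar>f x - g x\<bar> \<le> e" and e: "e \<ge> 0"
  shows "\<bar>(\<integral>x. f x \<partial>M) - (\<integral>x. g x \<partial>M)\<bar> \<le> e + (b + c) * prob Bad"
proof -
  have fi: "integrable M f" "integrable M g"
    using integrable_const_bound[of f b] integrable_const_bound[of g c] f g by auto
  have ind: "integrable M (indicator Bad :: 'a \<Rightarrow> real)" by (rule integrable_const_bound[of _ 1]) auto
  have bc: "b \<ge> 0" "c \<ge> 0" using f g abs_ge_zero order_trans by blast+
  have "\<bar>(\<integral>x. f x \<partial>M) - (\<integral>x. g x \<partial>M)\<bar> = \<bar>\<integral>x. f x - g x \<partial>M\<bar>" using fi by simp
  also have "\<dots> \<le> (\<integral>x. \<bar>f x - g x\<bar> \<partial>M)" by (rule integral_abs_bound)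
  also have "\<dots> \<le> (\<integral>x. e + (b + c) * indicator Bad x \<partial>M)"
  proof (rule integral_mono_AE)
    show "AE x in M. \<bar>f x - g x\<bar> \<le> e + (b + c) * indicator Bad x"
      using close
    proof eventually_elim
      case (elim x)
      have "\<bar>f x - g x\<bar> \<le> b + c" using f[of x] g[of x] by linarith
      then show ?case using elim e by (cases "x \<in> Bad") auto
    qed
    show "integrable M (\<lambda>x. e + (b + c) * indicator Bad x)" using ind by simp
  qed (use fi in auto)
  also have "\<dots> = e + (b + c) * prob Bad" using ind by (simp add: prob_space)
  finally show ?thesis .
qed

text \<open>A bounded continuous function is approximated on a cube by a polynomial in the sines of
  rescaled coordinates. Unlike an ordinary polynomial this approximation stays bounded outside the
  cube, since the sines remain in \<open>[-1,1]\<close>.\<close>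

lemma trig_sum_approximation:
  fixes F :: "real^'m::finite \<Rightarrow> real"
  assumes F: "continuous_on UNIV F" "\<And>x. \<bar>F x\<bar> \<le> b" and L: "L > 0" and e: "e > 0"
  obtains q where "trig_sum q" "\<And>x. norm x \<le> L \<Longrightarrow> \<bar>F x - q x\<bar> \<le> e" "\<And>x. \<bar>q x\<bar> \<le> b + e"
proof -
  \<comment> \<open>Maps \<open>[-L, L]\<close> onto \<open>[-pi/2, pi/2]\<close>, where
    \<open>arcsin\<close> inverts \<open>sin\<close>.\<close>
  define c where "c = pi / (2 * L)"
  have c: "c > 0" using L by (simp add: c_def)
  let ?B = "cbox (\<chi> _. -1) (\<chi> _. 1) :: (real^'m) set"
  \<comment> \<open>Seen as a function of the sines, \<open>F\<close> lives on a compact cube, where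
    Stone-Weierstrass applies.\<close>
  define G where "G s = F (\<chi> j. arcsin (s $ j) / c)" for s :: "real^'m"
  have "continuous_on ?B G"
    unfolding G_def
  proof (rule continuous_on_compose2[OF F(1)])
    show "continuous_on ?B (\<lambda>s. \<chi> j. arcsin (s $ j) / c)"
      using c by (intro continuous_on_vec_lambda continuous_intros continuous_on_arcsin) (auto simp: mem_box_cart)
  qed simp
  then obtain p where p: "real_polynomial_function p" "\<And>s. s \<in> ?B \<Longrightarrow> \<bar>G s - p s\<bar> < e"
    using Stone_Weierstrass_real_polynomial_function[OF compact_cbox _ e] by blast
  define S where "S x = (\<chi> j. sin (c * x $ j))" for x :: "real^'m"
  have S: "S x \<in> ?B" for x by (auto simp: S_def mem_box_cart)
  show ?thesis
  proof (rule that[of "\<lambda>x. p (S x)"])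
    show "trig_sum (\<lambda>x. p (S x))" unfolding S_def by (rule trig_sum_polynomial_sin[OF p(1)])
    fix x
    show "\<bar>p (S x)\<bar> \<le> b + e" using p(2)[OF S[of x]] F(2)[of "\<chi> j. arcsin (S x $ j) / c"] unfolding G_def by linarith
    assume x: "norm x \<le> L"
    have "arcsin (sin (c * x $ j)) = c * x $ j" for j
    proof -
      have "\<bar>c * x $ j\<bar> \<le> c * L" using component_le_norm_cart[of x j] x c by (simp add: abs_mult)
      also have "c * L = pi / 2" using L by (simp add: c_def)
      finally show ?thesis by (intro arcsin_sin) (auto simp: abs_le_iff)
    qed
    then have "G (S x) = F x" using c by (simp add: G_def S_def)
    then show "\<bar>F x - p (S x)\<bar> \<le> e" using p(2)[OF S[of x]] by simp
  qed
qed

text \<open>The complements of growing balls decrease to the empty set.\<close>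

lemma prob_space_tight:
  fixes \<nu> :: "'a::euclidean_space measure"
  assumes "prob_space \<nu>" and sets: "sets \<nu> = sets borel" and e: "e > 0"
  shows "\<exists>L>0. measure \<nu> {x. norm x > L} \<le> e"
proof -
  interpret prob_space \<nu> by fact
  have "(\<lambda>n. prob {x. norm x > real n}) \<longlonglongrightarrow> prob (\<Inter>n. {x. norm x > real n})"
    by (rule finite_Lim_measure_decseq) (auto simp: sets decseq_def intro: order.strict_trans1)
  moreover have "(\<Inter>n. {x :: 'a. norm x > real n}) = {}"
  proof -
    have "\<exists>n. norm x \<le> real n" for x :: 'a by (rule real_arch_simple)
    then show ?thesis by (auto simp: not_less[symmetric])
  qed
  ultimately have "(\<lambda>n. prob {x. norm x > real n}) \<longlonglongrightarrow> 0" by simp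
  then have "\<forall>\<^sub>F n in sequentially. prob {x. norm x > real n} < e" using e by (rule order_tendstoD)
  then obtain n where n: "n \<ge> 1" "prob {x. norm x > real n} < e"
    using eventually_happens'[OF _ eventually_conj[OF eventually_ge_at_top[of 1]]] by fastforce
  then show ?thesis by (intro exI[of _ "real n"]) auto
qed

text \<open>Characteristic functions give convergence for trigonometric sums. By tightness all but
  little mass lies in one ball, on which \<open>F\<close> is close to such a sum, and outside the
  ball the sum stays bounded. Tightness is a hypothesis because Hoeffding's inequality supplies it
  for the network output.\<close>

lemma weak_convergence_from_char:
  fixes \<nu>N :: "nat \<Rightarrow> (real^'m::finite) measure" and F :: "real^'m \<Rightarrow> real"
  assumes pN: "\<And>N. N \<ge> 1 \<Longrightarrow> prob_space (\<nu>N N)" "\<And>N. N \<ge> 1 \<Longrightarrow> sets (\<nu>N N) = sets borel"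
    and p: "prob_space \<nu>" "sets \<nu> = sets borel"
    and ch: "\<And>u. (\<lambda>N. char (distr (\<nu>N N) borel (\<lambda>x. u \<bullet> x)) 1) \<longlonglongrightarrow> char (distr \<nu> borel (\<lambda>x. u \<bullet> x)) 1"
    and tight: "\<And>e. e > 0 \<Longrightarrow> \<exists>L>0. \<forall>N\<ge>1. measure (\<nu>N N) {x. norm x > L} \<le> e"
    and F: "continuous_on UNIV F" "bounded (range F)"
  shows "(\<lambda>N. \<integral>x. F x \<partial>\<nu>N N) \<longlonglongrightarrow> (\<integral>x. F x \<partial>\<nu>)"
proof -
  obtain b where b: "\<And>x. \<bar>F x\<bar> \<le> b" using F(2) unfolding bounded_iff by (auto simp: )
  have b0: "b \<ge> 0" using b[of 0] by linarith
  have int: "integrable M f" if M: "prob_space M" "sets M = sets borel" "trig_sum f" for M and f :: "real^'m \<Rightarrow> real"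
  proof -
    interpret prob_space M by fact
    obtain B where "\<And>x. \<bar>f x\<bar> \<le> B" using trig_sum_bounded[OF M(3)] by blast
    moreover have "f \<in> borel_measurable M"
      using borel_measurable_continuous_onI[OF trig_sum_continuous[OF M(3)]] M(2) measurable_cong_sets by blast
    ultimately show ?thesis by (intro integrable_const_bound[of _ B]) auto
  qed
  have trig: "(\<lambda>N. \<integral>x. q x \<partial>\<nu>N N) \<longlonglongrightarrow> (\<integral>x. q x \<partial>\<nu>)" if "trig_sum q" for q
    using that
  proof (induction rule: trig_sum.induct)
    case (cos a u b)
    have "(\<lambda>N. a * Re (iexp b * char (distr (\<nu>N N) borel (\<lambda>x. u \<bullet> x)) 1)) \<longlonglongrightarrow> a * Re (iexp b * char (distr \<nu> borel (\<lambda>x. u \<bullet> x)) 1)"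
      by (intro tendsto_intros ch)
    then have "(\<lambda>N. a * Re (iexp b * char (distr (\<nu>N N) borel (\<lambda>x. u \<bullet> x)) 1)) \<longlonglongrightarrow> (\<integral>x. a * cos (u \<bullet> x + b) \<partial>\<nu>)"
      by (simp add: integral_cos_char[OF p])
    then show ?case
    proof (rule Lim_transform_eventually, intro eventually_sequentiallyI[of 1])
      fix N :: nat assume "1 \<le> N"
      then show "a * Re (iexp b * char (distr (\<nu>N N) borel (\<lambda>x. u \<bullet> x)) 1) = (\<integral>x. a * cos (u \<bullet> x + b) \<partial>\<nu>N N)"
        by (simp add: integral_cos_char[OF pN])
    qed
  next
    case (add f g)
    from tendsto_add[OF add.IH] have "(\<lambda>N. (\<integral>x. f x \<partial>\<nu>N N) + (\<integral>x. g x \<partial>\<nu>N N)) \<longlonglongrightarrow> (\<integral>x. f x + g x \<partial>\<nu>)"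
      using int[OF p] add.hyps by simp
    then show ?case
    proof (rule Lim_transform_eventually, intro eventually_sequentiallyI[of 1])
      fix N :: nat assume "1 \<le> N"
      then show "(\<integral>x. f x \<partial>\<nu>N N) + (\<integral>x. g x \<partial>\<nu>N N) = (\<integral>x. f x + g x \<partial>\<nu>N N)"
        using int[OF pN] add.hyps by simp
    qed
  qed
  show ?thesis
  proof (rule LIMSEQ_I)
    fix r :: real assume r: "r > 0"
    \<comment> \<open>With \<open>e \<le> 1\<close> each replacement of \<open>F\<close> by
      \<open>q\<close> costs at most \<open>e + (2 * b + e) * e \<le> r / 4\<close>. Two
      replacements and the convergence for \<open>q\<close> use up three quarters of
      \<open>r\<close>.\<close>
    define e where "e = min 1 (r / (4 * (2 * b + 3)))"
    have e: "e > 0" using r b0 by (auto simp: e_def)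
    obtain L1 where L1: "L1 > 0" "\<And>N. N \<ge> 1 \<Longrightarrow> measure (\<nu>N N) {x. norm x > L1} \<le> e" using tight[OF e] by blast
    obtain L2 where L2: "L2 > 0" "measure \<nu> {x. norm x > L2} \<le> e" using prob_space_tight[OF p e] by blast
    define L where "L = max L1 L2"
    have L: "L > 0" using L1 by (simp add: L_def)
    obtain q where q: "trig_sum q" "\<And>x. norm x \<le> L \<Longrightarrow> \<bar>F x - q x\<bar> \<le> e" "\<And>x. \<bar>q x\<bar> \<le> b + e"
      using trig_sum_approximation[OF F(1) b L e] by blast
    have close: "\<bar>(\<integral>x. F x \<partial>M) - (\<integral>x. q x \<partial>M)\<bar> \<le> r / 4"
      if M: "prob_space M" "sets M = sets borel" "measure M {x. norm x > L'} \<le> e" "L' \<le> L" for M L'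
    proof -
      interpret prob_space M by fact
      have [measurable]: "F \<in> borel_measurable M" "q \<in> borel_measurable M"
        using borel_measurable_continuous_onI[OF trig_sum_continuous[OF q(1)]]
          borel_measurable_continuous_onI[OF F(1)] M(2) measurable_cong_sets by blast+
      have "\<bar>(\<integral>x. F x \<partial>M) - (\<integral>x. q x \<partial>M)\<bar> \<le> e + (b + (b + e)) * prob {x. norm x > L}"
        using q b e M(2) by (intro integral_close) auto
      also have "prob {x. norm x > L} \<le> prob {x. norm x > L'}"
        using M(2,4) by (intro finite_measure_mono) auto
      also have "\<dots> \<le> e" by fact
      also have "e + (b + (b + e)) * e \<le> e * (2 * b + 3)"
      proof -
        have "e + (b + (b + e)) * e = e * (1 + 2 * b + e)" by algebra
        also have "\<dots> \<le> e * (2 * b + 3)" using e by (intro mult_left_mono) (auto simp: e_def)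
        finally show ?thesis .
      qed
      also have "\<dots> \<le> (r / (4 * (2 * b + 3))) * (2 * b + 3)"
        using b0 by (intro mult_right_mono) (auto simp: e_def)
      also have "\<dots> = r / 4"
      proof -
        have "2 * b + 3 > 0" using b0 by simp
        then show ?thesis by (simp add: divide_simps)
      qed
      finally show ?thesis using b0 e by (simp add: mult_left_mono)
    qed
    obtain n0 where n0: "\<And>N. N \<ge> n0 \<Longrightarrow> \<bar>(\<integral>x. q x \<partial>\<nu>N N) - (\<integral>x. q x \<partial>\<nu>)\<bar> < r / 4"
      using LIMSEQ_D[OF trig[OF q(1)], of "r / 4"] r by auto
    have "norm ((\<integral>x. F x \<partial>\<nu>N N) - (\<integral>x. F x \<partial>\<nu>)) < r" if N: "N \<ge> max 1 n0" for N
    proof -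
      have "\<bar>(\<integral>x. F x \<partial>\<nu>N N) - (\<integral>x. q x \<partial>\<nu>N N)\<bar> \<le> r / 4" "\<bar>(\<integral>x. F x \<partial>\<nu>) - (\<integral>x. q x \<partial>\<nu>)\<bar> \<le> r / 4"
        using close[OF pN L1(2), of N] close[OF p L2(2)] N by (auto simp: L_def)
      then show ?thesis using n0[of N] N r unfolding real_norm_def by linarith
    qed
    then show "\<exists>n0. \<forall>N\<ge>n0. norm ((\<integral>x. F x \<partial>\<nu>N N) - (\<integral>x. F x \<partial>\<nu>)) < r" by blast
  qed
qed

section \<open>Stochastic gradient descent on a good event\<close>

abbreviation avg :: "nat \<Rightarrow> ('b \<Rightarrow> real) \<Rightarrow> (nat \<Rightarrow> 'b) \<Rightarrow> real" where
  "avg N \<phi> p \<equiv> 1 / N * (\<Sum>i=1..N. \<phi> (p i))"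

text \<open>The inner product of the gradients of \<open>c * \<sigma> (w \<bullet> x)\<close> in
  \<open>(c, w)\<close> at the inputs \<open>x\<close> and \<open>x'\<close>.\<close>

definition tangent_kernel :: "(real \<Rightarrow> real) \<Rightarrow> real^'d::finite \<Rightarrow> real^'d \<Rightarrow> 'd param \<Rightarrow> real" where
  "tangent_kernel \<sigma> x x' q = \<sigma> (snd q \<bullet> x) * \<sigma> (snd q \<bullet> x')
     + (fst q)\<^sup>2 * deriv \<sigma> (snd q \<bullet> x') * deriv \<sigma> (snd q \<bullet> x) * (x \<bullet> x')"

section \<open>Bounds on the activation function\<close>

text \<open>The derivatives in \<open>C2_b\<close> are bounded linear maps; on the real line they
  are recovered as numbers by evaluation at 1.\<close>

lemma C2_b_derivatives:
  assumes "C2_b (\<sigma> :: real \<Rightarrow> real)"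
  obtains d where "\<And>x. (\<sigma> has_real_derivative deriv \<sigma> x) (at x)" "\<And>x. (deriv \<sigma> has_real_derivative d x) (at x)"
    "bounded (range \<sigma>)" "bounded (range (deriv \<sigma>))" "bounded (range d)"
proof -
  obtain f' :: "real \<Rightarrow> (real \<Rightarrow>\<^sub>L real)" and f'' :: "real \<Rightarrow> (real \<Rightarrow>\<^sub>L (real \<Rightarrow>\<^sub>L real))" where
    f: "\<And>x. (\<sigma> has_derivative blinfun_apply (f' x)) (at x)" "\<And>x. (f' has_derivative blinfun_apply (f'' x)) (at x)"
    "bounded (range \<sigma>)" "bounded (range f')" "bounded (range f'')"
    using assms unfolding C2_b_def by blast
  have lin: "blinfun_apply g x = blinfun_apply g 1 * x" for g :: "real \<Rightarrow>\<^sub>L real" and x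
    using blinfun.scaleR_right[of g x 1] by (simp add: mult.commute)
  have der: "(\<sigma> has_real_derivative blinfun_apply (f' x) 1) (at x)" for x
    unfolding has_field_derivative_def using f(1)[of x] lin[of "f' x"] by (metis (no_types, lifting) ext)
  then have d: "deriv \<sigma> = (\<lambda>x. blinfun_apply (f' x) 1)" by (auto intro: DERIV_imp_deriv)
  have lin2: "blinfun_apply (blinfun_apply g x) 1 = blinfun_apply (blinfun_apply g 1) 1 * x" for g :: "real \<Rightarrow>\<^sub>L (real \<Rightarrow>\<^sub>L real)" and x
    using blinfun.scaleR_right[of g x 1] by (simp add: blinfun.scaleR_left mult.commute)
  have der2: "(deriv \<sigma> has_real_derivative blinfun_apply (blinfun_apply (f'' x) 1) 1) (at x)" for x
  proof -
    have "((\<lambda>x. blinfun_apply (f' x) 1) has_derivative (\<lambda>h. blinfun_apply (blinfun_apply (f'' x) h) 1)) (at x)"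
      by (rule bounded_linear.has_derivative[OF blinfun.bounded_linear_left f(2)])
    then have "((\<lambda>x. blinfun_apply (f' x) 1) has_derivative (\<lambda>h. blinfun_apply (blinfun_apply (f'' x) 1) 1 * h)) (at x)"
      by (rule has_derivative_eq_rhs) (rule ext, rule lin2)
    then show ?thesis unfolding d has_field_derivative_def .
  qed
  obtain b1 where b1: "\<And>x. norm (f' x) \<le> b1" using f(4) unfolding bounded_iff by blast
  obtain b2 where b2: "\<And>x. norm (f'' x) \<le> b2" using f(5) unfolding bounded_iff by blast
  show ?thesis
  proof (rule that[OF _ der2 f(3)])
    show "(\<sigma> has_real_derivative deriv \<sigma> x) (at x)" for x using der by (simp add: d)
    have "norm (blinfun_apply (f' x) 1) \<le> b1" for x
      using norm_blinfun[of "f' x" 1] b1[of x] by simp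
    then show "bounded (range (deriv \<sigma>))" unfolding d by (auto intro!: boundedI[of _ b1])
    have "norm (blinfun_apply (blinfun_apply (f'' x) 1) 1) \<le> b2" for x
      using norm_blinfun[of "blinfun_apply (f'' x) 1" 1] norm_blinfun[of "f'' x" 1] b2[of x] by simp
    then show "bounded (range (\<lambda>x. blinfun_apply (blinfun_apply (f'' x) 1) 1))" by (auto intro!: boundedI[of _ b2])
  qed
qed

text \<open>One constant serves all estimates. The Taylor bound carries \<open>S\<close> without a
  factor \<open>1/2\<close>, since it comes from the mean value estimate for
  \<open>\<sigma> u - deriv \<sigma> x * u\<close>.\<close>

lemma C2_b_bounds:
  assumes "C2_b (\<sigma> :: real \<Rightarrow> real)"
  obtains S where "S \<ge> 1" "\<And>x. \<bar>\<sigma> x\<bar> \<le> S" "\<And>x. \<bar>deriv \<sigma> x\<bar> \<le> S"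
    "\<And>x y. \<bar>\<sigma> x - \<sigma> y\<bar> \<le> S * \<bar>x - y\<bar>" "\<And>x y. \<bar>deriv \<sigma> x - deriv \<sigma> y\<bar> \<le> S * \<bar>x - y\<bar>"
    "\<And>x y. \<bar>\<sigma> y - \<sigma> x - deriv \<sigma> x * (y - x)\<bar> \<le> S * (y - x)\<^sup>2"
proof -
  obtain d where d: "\<And>x. (\<sigma> has_real_derivative deriv \<sigma> x) (at x)" "\<And>x. (deriv \<sigma> has_real_derivative d x) (at x)"
    "bounded (range \<sigma>)" "bounded (range (deriv \<sigma>))" "bounded (range d)"
    using C2_b_derivatives[OF assms] by blast
  obtain s0 where s0: "\<And>x. \<bar>\<sigma> x\<bar> \<le> s0" using d(3) unfolding bounded_iff by auto
  obtain s1 where s1: "\<And>x. \<bar>deriv \<sigma> x\<bar> \<le> s1" using d(4) unfolding bounded_iff by auto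
  obtain s2 where s2: "\<And>x. \<bar>d x\<bar> \<le> s2" using d(5) unfolding bounded_iff by auto
  define S where "S = max 1 (max s0 (max s1 s2))"
  have S: "S \<ge> 1" "\<bar>\<sigma> x\<bar> \<le> S" "\<bar>deriv \<sigma> x\<bar> \<le> S" "\<bar>d x\<bar> \<le> S" for x
    using s0[of x] s1[of x] s2[of x] by (auto simp: S_def)
  have l1: "\<bar>\<sigma> x - \<sigma> y\<bar> \<le> S * \<bar>x - y\<bar>" for x y
    using field_differentiable_bound[of UNIV \<sigma> "deriv \<sigma>" S x y] d(1) S(3) by simp
  have l2: "\<bar>deriv \<sigma> x - deriv \<sigma> y\<bar> \<le> S * \<bar>x - y\<bar>" for x y
    using field_differentiable_bound[of UNIV "deriv \<sigma>" d S x y] d(2) S(4) by simp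
  have t: "\<bar>\<sigma> y - \<sigma> x - deriv \<sigma> x * (y - x)\<bar> \<le> S * (y - x)\<^sup>2" for x y
  proof -
    have "norm ((\<sigma> y - deriv \<sigma> x * y) - (\<sigma> x - deriv \<sigma> x * x)) \<le> S * \<bar>y - x\<bar> * norm (y - x)"
    proof (rule field_differentiable_bound[of "closed_segment x y" _ "\<lambda>u. deriv \<sigma> u - deriv \<sigma> x"])
      fix u assume u: "u \<in> closed_segment x y"
      show "((\<lambda>u. \<sigma> u - deriv \<sigma> x * u) has_real_derivative deriv \<sigma> u - deriv \<sigma> x) (at u within closed_segment x y)"
        using has_field_derivative_at_within[OF d(1)] by (auto intro!: derivative_eq_intros)
      have "\<bar>u - x\<bar> \<le> \<bar>y - x\<bar>" using u by (auto simp: closed_segment_eq_real_ivl split: if_splits)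
      then have "S * \<bar>u - x\<bar> \<le> S * \<bar>y - x\<bar>" using S(1) by (intro mult_left_mono) auto
      with l2[of u x] show "norm (deriv \<sigma> u - deriv \<sigma> x) \<le> S * \<bar>y - x\<bar>" by simp
    qed auto
    then show ?thesis by (simp add: power2_eq_square algebra_simps abs_mult[symmetric])
  qed
  show ?thesis using that[OF S(1-3) l1 l2 t] .
qed

lemma abs_mult_le: "\<bar>a\<bar> \<le> A \<Longrightarrow> \<bar>b\<bar> \<le> B \<Longrightarrow> \<bar>a * b\<bar> \<le> A * B" for a b :: real
  by (simp add: abs_mult mult_mono')

lemma abs_mult_diff_le:
  fixes a b a' b' :: real
  assumes "\<bar>a\<bar> \<le> A" "\<bar>b'\<bar> \<le> B" "\<bar>a - a'\<bar> \<le> da" "\<bar>b - b'\<bar> \<le> db"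
  shows "\<bar>a * b - a' * b'\<bar> \<le> A * db + da * B"
proof -
  have "a * b - a' * b' = a * (b - b') + (a - a') * b'" by algebra
  then show ?thesis using abs_mult_le[OF assms(1,4)] abs_mult_le[OF assms(3,2)] by linarith
qed

text \<open>Repeated data points share their weight, so that every index \<open>j\<close> has mean weight \<open>1 / M\<close>.\<close>

definition sample_weight :: "('m::finite \<Rightarrow> 'a) \<Rightarrow> ('m \<Rightarrow> 'b) \<Rightarrow> 'm \<Rightarrow> 'a \<times> 'b \<Rightarrow> real" where
  "sample_weight X Y j q = (if q = (X j, Y j) then 1 / card {i. (X i, Y i) = (X j, Y j)} else 0)"

text \<open>\<open>B\<close> bounds the outer weights at the start. The estimates below allow
  \<open>2 * B\<close>, which leaves room for the drift during training.\<close>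

locale network_data =
  fixes \<sigma> :: "real \<Rightarrow> real" and \<alpha> T :: real and X :: "'m::finite \<Rightarrow> real^'d::finite" and Y :: "'m \<Rightarrow> real"
    and S D B :: real
  assumes S: "\<And>x. \<bar>\<sigma> x\<bar> \<le> S" "\<And>x. \<bar>deriv \<sigma> x\<bar> \<le> S"
      "\<And>x y. \<bar>\<sigma> x - \<sigma> y\<bar> \<le> S * \<bar>x - y\<bar>" "\<And>x y. \<bar>deriv \<sigma> x - deriv \<sigma> y\<bar> \<le> S * \<bar>x - y\<bar>"
      "\<And>x y. \<bar>\<sigma> y - \<sigma> x - deriv \<sigma> x * (y - x)\<bar> \<le> S * (y - x)\<^sup>2"
    and pos: "\<alpha> > 0" "T > 0" "S \<ge> 1" "D \<ge> 1" "B \<ge> 1"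
    and D: "\<And>j. norm (X j) \<le> D" "\<And>j. \<bar>Y j\<bar> \<le> D"
begin

text \<open>\<open>2 * B * S * D\<^sup>2\<close> bounds the change of a preactivation per unit of
  step size. The first summand comes from the product of the changes of outer weight and activation,
  the second from the Taylor remainder of the activation.\<close>

definition "step_err = S * S * (2 * B * S * D\<^sup>2) + 2 * B * S * (2 * B * S * D\<^sup>2)\<^sup>2"
definition "kernel_bound = S * S + (2 * B)\<^sup>2 * S * S * D\<^sup>2"
definition "kernel_lip = S * (S * D) + S * D * S + ((2 * B)\<^sup>2 * (S * (S * D) + S * D * S) + 4 * B * (S * S)) * D\<^sup>2"
text \<open>Rate of the a priori growth of the output; the \<open>+ 1\<close> absorbs the second
  order error of a step.\<close>

definition "growth = \<alpha> * (kernel_bound + 1)"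
text \<open>Contains \<open>R + D\<close> rather than \<open>R\<close> because the quantity
  estimated geometrically is \<open>\<bar>g\<bar> + D\<close>, which dominates the residual
  \<open>\<bar>Y - g\<bar>\<close>.\<close>

definition "residual_bound R = (R + D) * exp (growth * T)"
text \<open>Bounds the displacement of a parameter in one step, up to the factor
  \<open>1 / (N * sqrt N)\<close>.\<close>

definition "drift_bound R = \<alpha> * residual_bound R * (2 * B * S * D)"

abbreviation "sampling_error N j k z \<equiv> 1 / real N * (\<Sum>l<k. sample_weight X Y j (z l) - 1 / CARD('m))"

text \<open>Collects the conditions on the inputs apart from averages of functions of the
  parameters, which enter as separate hypotheses.\<close>

definition good_inputs :: "nat \<Rightarrow> real \<Rightarrow> real \<Rightarrow> (nat \<Rightarrow> 'd param) \<Rightarrow> (nat \<Rightarrow> (real^'d) \<times> real) \<Rightarrow> bool" where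
  "good_inputs N R \<eta> p z \<longleftrightarrow> (\<forall>i\<in>{1..N}. \<bar>fst (p i)\<bar> \<le> B) \<and> (\<forall>k. z k \<in> range (\<lambda>j. (X j, Y j))) \<and>
    (\<forall>j. \<bar>network \<sigma> N p (X j)\<bar> \<le> R) \<and> (\<forall>k j. real k \<le> N * T \<longrightarrow> \<bar>sampling_error N j k z\<bar> \<le> \<eta>)"

section \<open>One step of the descent\<close>

lemma input_inner_bound: "\<bar>X i \<bullet> X j\<bar> \<le> D\<^sup>2"
proof -
  have "\<bar>X i \<bullet> X j\<bar> \<le> norm (X i) * norm (X j)" by (rule Cauchy_Schwarz_ineq2)
  also have "\<dots> \<le> D * D" using D(1) by (intro mult_mono) (auto intro: order_trans[OF norm_ge_zero])
  finally show ?thesis by (simp add: power2_eq_square)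
qed

lemma const_nonneg: "step_err \<ge> 0" "kernel_bound \<ge> 0" "kernel_lip \<ge> 0" "growth \<ge> 0"
  using pos by (auto simp: step_err_def kernel_bound_def kernel_lip_def growth_def)

lemma residual_bound_pos: "R \<ge> 0 \<Longrightarrow> residual_bound R > 0"
  using pos by (simp add: residual_bound_def add_nonneg_pos)

lemma drift_bound_pos: "R \<ge> 0 \<Longrightarrow> drift_bound R > 0"
  using pos residual_bound_pos by (simp add: drift_bound_def)

lemma tangent_kernel_bound:
  assumes "\<bar>fst q\<bar> \<le> 2 * B" shows "\<bar>tangent_kernel \<sigma> (X i) (X j) q\<bar> \<le> kernel_bound"
proof -
  have c2: "\<bar>(fst q)\<^sup>2\<bar> \<le> (2 * B)\<^sup>2" using abs_mult_le[OF assms assms] by (simp add: power2_eq_square)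
  have "\<bar>(fst q)\<^sup>2 * deriv \<sigma> (snd q \<bullet> X j) * deriv \<sigma> (snd q \<bullet> X i) * (X i \<bullet> X j)\<bar> \<le> (2 * B)\<^sup>2 * S * S * D\<^sup>2"
    by (intro abs_mult_le c2 S input_inner_bound)
  moreover have "\<bar>\<sigma> (snd q \<bullet> X i) * \<sigma> (snd q \<bullet> X j)\<bar> \<le> S * S" by (intro abs_mult_le S)
  ultimately show ?thesis unfolding tangent_kernel_def kernel_bound_def by linarith
qed

text \<open>Telescoping of products: every factor is bounded and Lipschitz in the parameter, where
  the square of the outer weight needs \<open>\<bar>fst q\<bar> \<le> 2 * B\<close>.\<close>

lemma tangent_kernel_lipschitz:
  assumes q: "\<bar>fst q\<bar> \<le> 2 * B" "\<bar>fst q'\<bar> \<le> 2 * B" and h: "\<bar>fst q - fst q'\<bar> \<le> h" "norm (snd q - snd q') \<le> h"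
  shows "\<bar>tangent_kernel \<sigma> (X i) (X j) q - tangent_kernel \<sigma> (X i) (X j) q'\<bar> \<le> kernel_lip * h"
proof -
  have c2: "\<bar>(fst q)\<^sup>2\<bar> \<le> (2 * B)\<^sup>2" using abs_mult_le[OF q(1) q(1)] by (simp add: power2_eq_square)
  have h0: "h \<ge> 0" using h by linarith
  have w: "\<bar>snd q \<bullet> X k - snd q' \<bullet> X k\<bar> \<le> D * h" for k
  proof -
    have "\<bar>snd q \<bullet> X k - snd q' \<bullet> X k\<bar> = \<bar>(snd q - snd q') \<bullet> X k\<bar>" by (simp add: inner_diff_left)
    also have "\<dots> \<le> norm (snd q - snd q') * norm (X k)" by (rule Cauchy_Schwarz_ineq2)
    also have "\<dots> \<le> h * D" using h D(1) h0 by (intro mult_mono) auto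
    finally show ?thesis by (simp add: mult.commute)
  qed
  have Sw: "S * \<bar>snd q \<bullet> X k - snd q' \<bullet> X k\<bar> \<le> S * D * h" for k
    using mult_left_mono[OF w[of k], of S] pos by (simp add: mult.assoc)
  have s: "\<bar>\<sigma> (snd q \<bullet> X k) - \<sigma> (snd q' \<bullet> X k)\<bar> \<le> S * D * h" for k
    using S(3)[of "snd q \<bullet> X k" "snd q' \<bullet> X k"] Sw[of k] by linarith
  have ds: "\<bar>deriv \<sigma> (snd q \<bullet> X k) - deriv \<sigma> (snd q' \<bullet> X k)\<bar> \<le> S * D * h" for k
    using S(4)[of "snd q \<bullet> X k" "snd q' \<bullet> X k"] Sw[of k] by linarith
  have 1: "\<bar>\<sigma> (snd q \<bullet> X i) * \<sigma> (snd q \<bullet> X j) - \<sigma> (snd q' \<bullet> X i) * \<sigma> (snd q' \<bullet> X j)\<bar> \<le> S * (S * D * h) + (S * D * h) * S"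
    by (intro abs_mult_diff_le S s)
  have c2d: "\<bar>(fst q)\<^sup>2 - (fst q')\<^sup>2\<bar> \<le> 4 * B * h"
    using abs_mult_diff_le[OF q(1) q(2) h(1) h(1)] by (simp add: power2_eq_square)
  have dd: "\<bar>deriv \<sigma> (snd q \<bullet> X j) * deriv \<sigma> (snd q \<bullet> X i) - deriv \<sigma> (snd q' \<bullet> X j) * deriv \<sigma> (snd q' \<bullet> X i)\<bar> \<le> S * (S * D * h) + (S * D * h) * S"
    by (intro abs_mult_diff_le S ds)
  have "\<bar>(fst q)\<^sup>2 * (deriv \<sigma> (snd q \<bullet> X j) * deriv \<sigma> (snd q \<bullet> X i)) - (fst q')\<^sup>2 * (deriv \<sigma> (snd q' \<bullet> X j) * deriv \<sigma> (snd q' \<bullet> X i))\<bar>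
      \<le> (2 * B)\<^sup>2 * (S * (S * D * h) + (S * D * h) * S) + 4 * B * h * (S * S)"
    by (intro abs_mult_diff_le[OF c2 abs_mult_le[OF S(2) S(2)] c2d dd])
  from abs_mult_le[OF this input_inner_bound[of i j]]
  have 2: "\<bar>(fst q)\<^sup>2 * deriv \<sigma> (snd q \<bullet> X j) * deriv \<sigma> (snd q \<bullet> X i) * (X i \<bullet> X j) - (fst q')\<^sup>2 * deriv \<sigma> (snd q' \<bullet> X j) * deriv \<sigma> (snd q' \<bullet> X i) * (X i \<bullet> X j)\<bar>
      \<le> ((2 * B)\<^sup>2 * (S * (S * D * h) + (S * D * h) * S) + 4 * B * h * (S * S)) * D\<^sup>2"
    by (simp add: left_diff_distrib mult.assoc)
  have "kernel_lip * h = (S * (S * D * h) + (S * D * h) * S) + ((2 * B)\<^sup>2 * (S * (S * D * h) + (S * D * h) * S) + 4 * B * h * (S * S)) * D\<^sup>2"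
    unfolding kernel_lip_def by algebra
  with 1 2 show ?thesis unfolding tangent_kernel_def by linarith
qed

text \<open>First order expansion in the step size \<open>r\<close>: the moving outer weight yields
  the product of activations in the tangent kernel, the moving inner weight the product of
  derivatives. The remainder is quadratic in \<open>r\<close>.\<close>

lemma neuron_step:
  assumes "\<bar>c\<bar> \<le> 2 * B"
  shows "\<bar>(c + r * \<sigma> (w \<bullet> X j)) * \<sigma> ((w + (r * c * deriv \<sigma> (w \<bullet> X j)) *\<^sub>R X j) \<bullet> X i) - c * \<sigma> (w \<bullet> X i)
     - r * tangent_kernel \<sigma> (X i) (X j) (c, w)\<bar> \<le> step_err * r\<^sup>2"
proof -
  \<comment> \<open>Change of the preactivation at \<open>X i\<close>, of order
    \<open>r\<close>.\<close>
  define \<delta> where "\<delta> = r * c * deriv \<sigma> (w \<bullet> X j) * (X j \<bullet> X i)"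
  define u where "u = w \<bullet> X i"
  let ?b = "2 * B * S * D\<^sup>2"
  have "\<bar>r * c * deriv \<sigma> (w \<bullet> X j) * (X j \<bullet> X i)\<bar> \<le> \<bar>r\<bar> * (2 * B) * S * D\<^sup>2"
    by (intro abs_mult_le assms S input_inner_bound order_refl)
  then have \<delta>: "\<bar>\<delta>\<bar> \<le> \<bar>r\<bar> * ?b" unfolding \<delta>_def by (simp add: mult_ac)
  then have \<delta>2: "\<delta>\<^sup>2 \<le> r\<^sup>2 * ?b\<^sup>2"
    using power_mono[OF \<delta>, of 2] by (simp add: power_mult_distrib)
  have "\<bar>\<sigma> (u + \<delta>) - \<sigma> u\<bar> \<le> S * \<bar>\<delta>\<bar>" using S(3)[of "u + \<delta>" u] by simp
  also have "\<dots> \<le> S * (\<bar>r\<bar> * ?b)" using \<delta> pos by (intro mult_left_mono) auto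
  finally have "\<bar>\<sigma> (u + \<delta>) - \<sigma> u\<bar> \<le> S * (\<bar>r\<bar> * ?b)" .
  with S(1)[of "w \<bullet> X j"] have "\<bar>\<bar>r\<bar> * \<sigma> (w \<bullet> X j) * (\<sigma> (u + \<delta>) - \<sigma> u)\<bar> \<le> \<bar>r\<bar> * S * (S * (\<bar>r\<bar> * ?b))"
    by (intro abs_mult_le) auto
  then have 1: "\<bar>r * \<sigma> (w \<bullet> X j) * (\<sigma> (u + \<delta>) - \<sigma> u)\<bar> \<le> S * S * ?b * r\<^sup>2"
    by (simp add: abs_mult power2_eq_square mult_ac)
  have "\<bar>\<sigma> (u + \<delta>) - \<sigma> u - deriv \<sigma> u * \<delta>\<bar> \<le> S * \<delta>\<^sup>2" using S(5)[of "u + \<delta>" u] by simp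
  also have "\<dots> \<le> S * (r\<^sup>2 * ?b\<^sup>2)" using \<delta>2 pos by (intro mult_left_mono) auto
  finally have "\<bar>c * (\<sigma> (u + \<delta>) - \<sigma> u - deriv \<sigma> u * \<delta>)\<bar> \<le> 2 * B * (S * (r\<^sup>2 * ?b\<^sup>2))"
    by (intro abs_mult_le assms)
  then have 2: "\<bar>c * (\<sigma> (u + \<delta>) - \<sigma> u - deriv \<sigma> u * \<delta>)\<bar> \<le> 2 * B * S * ?b\<^sup>2 * r\<^sup>2" by (simp add: mult_ac)
  have "(w + (r * c * deriv \<sigma> (w \<bullet> X j)) *\<^sub>R X j) \<bullet> X i = u + \<delta>"
    by (simp add: inner_add_left u_def \<delta>_def)
  then have "(c + r * \<sigma> (w \<bullet> X j)) * \<sigma> ((w + (r * c * deriv \<sigma> (w \<bullet> X j)) *\<^sub>R X j) \<bullet> X i) - c * \<sigma> (w \<bullet> X i)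
     - r * tangent_kernel \<sigma> (X i) (X j) (c, w)
     = r * \<sigma> (w \<bullet> X j) * (\<sigma> (u + \<delta>) - \<sigma> u) + c * (\<sigma> (u + \<delta>) - \<sigma> u - deriv \<sigma> u * \<delta>)"
    by (simp add: tangent_kernel_def u_def[symmetric] \<delta>_def inner_commute[of "X j"] power2_eq_square algebra_simps)
  moreover have "step_err * r\<^sup>2 = S * S * ?b * r\<^sup>2 + 2 * B * S * ?b\<^sup>2 * r\<^sup>2"
    by (simp add: step_err_def distrib_right)
  ultimately show ?thesis using 1 2 by linarith
qed

lemma sgd_Suc_data:
  fixes N :: nat and p\<^sub>0 :: "nat \<Rightarrow> 'd param"
  assumes "z k = (X j, Y j)"
  defines "p \<equiv> sgd \<sigma> \<alpha> N p\<^sub>0 z k"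
  defines "r \<equiv> \<alpha> / N / sqrt N * (Y j - network \<sigma> N p (X j))"
  shows "fst (sgd \<sigma> \<alpha> N p\<^sub>0 z (Suc k) i) = fst (p i) + r * \<sigma> (snd (p i) \<bullet> X j)"
    "snd (sgd \<sigma> \<alpha> N p\<^sub>0 z (Suc k) i) = snd (p i) + (r * fst (p i) * deriv \<sigma> (snd (p i) \<bullet> X j)) *\<^sub>R X j"
  using assms(1) by (simp_all add: p_def[symmetric] r_def Let_def split: prod.split)

text \<open>With \<open>r\<close> of order \<open>N^(-3/2)\<close> the linear parts add up to
  \<open>\<alpha> / N\<close> times residual and averaged kernel, while \<open>N\<close> errors of
  order \<open>r^2\<close>, divided by \<open>sqrt N\<close>, are of order
  \<open>N^(-5/2)\<close>.\<close>

lemma network_step: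
  assumes N: "N \<ge> 1" and z: "z k = (X j, Y j)" and c: "\<And>i. i \<in> {1..N} \<Longrightarrow> \<bar>fst (sgd \<sigma> \<alpha> N p\<^sub>0 z k i)\<bar> \<le> 2 * B"
    and e: "\<bar>Y j - network \<sigma> N (sgd \<sigma> \<alpha> N p\<^sub>0 z k) (X j)\<bar> \<le> e"
  shows "\<bar>network \<sigma> N (sgd \<sigma> \<alpha> N p\<^sub>0 z (Suc k)) (X i) - network \<sigma> N (sgd \<sigma> \<alpha> N p\<^sub>0 z k) (X i)
     - \<alpha> / N * (Y j - network \<sigma> N (sgd \<sigma> \<alpha> N p\<^sub>0 z k) (X j)) * avg N (tangent_kernel \<sigma> (X i) (X j)) (sgd \<sigma> \<alpha> N p\<^sub>0 z k)\<bar>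
     \<le> step_err * \<alpha>\<^sup>2 * e\<^sup>2 / ((real N)\<^sup>2 * sqrt N)"
proof -
  let ?p = "sgd \<sigma> \<alpha> N p\<^sub>0 z k" and ?p' = "sgd \<sigma> \<alpha> N p\<^sub>0 z (Suc k)"
  define \<rho> where "\<rho> = Y j - network \<sigma> N ?p (X j)"
  define r where "r = \<alpha> / N / sqrt N * \<rho>"
  define K where "K l = tangent_kernel \<sigma> (X i) (X j) (?p l)" for l
  have N0: "real N > 0" "sqrt N > 0" using N by auto
  have sq: "sqrt N * sqrt N = N" using N0 by simp
  have t: "\<bar>fst (?p' l) * \<sigma> (snd (?p' l) \<bullet> X i) - fst (?p l) * \<sigma> (snd (?p l) \<bullet> X i) - r * K l\<bar> \<le> step_err * r\<^sup>2"
    if "l \<in> {1..N}" for l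
    using neuron_step[OF c[OF that], of r "snd (?p l)" j i] sgd_Suc_data[where p\<^sub>0 = p\<^sub>0 and N = N and z = z and k = k, OF z, of l]
    unfolding K_def r_def \<rho>_def by (simp only: prod.collapse)
  have eq: "network \<sigma> N ?p' (X i) - network \<sigma> N ?p (X i) - \<alpha> / N * \<rho> * (1 / N * (\<Sum>l=1..N. K l))
      = 1 / sqrt N * (\<Sum>l=1..N. fst (?p' l) * \<sigma> (snd (?p' l) \<bullet> X i) - fst (?p l) * \<sigma> (snd (?p l) \<bullet> X i) - r * K l)"
  proof -
    have "1 / sqrt N * r = \<alpha> / N * \<rho> * (1 / N)" using sq N0 by (simp add: r_def field_simps)
    then have "\<alpha> / N * \<rho> * (1 / N * (\<Sum>l=1..N. K l)) = 1 / sqrt N * (\<Sum>l=1..N. r * K l)"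
      by (simp add: sum_distrib_left[symmetric] mult.assoc[symmetric])
    then show ?thesis by (simp only: network_def sum_subtractf right_diff_distrib)
  qed
  have "\<bar>\<Sum>l=1..N. fst (?p' l) * \<sigma> (snd (?p' l) \<bullet> X i) - fst (?p l) * \<sigma> (snd (?p l) \<bullet> X i) - r * K l\<bar> \<le> (\<Sum>l=1..N. step_err * r\<^sup>2)"
    by (intro order_trans[OF sum_abs] sum_mono t)
  also have "\<dots> = N * (step_err * r\<^sup>2)" by simp
  finally have "\<bar>1 / sqrt N * (\<Sum>l=1..N. fst (?p' l) * \<sigma> (snd (?p' l) \<bullet> X i) - fst (?p l) * \<sigma> (snd (?p l) \<bullet> X i) - r * K l)\<bar>
      \<le> 1 / sqrt N * (N * (step_err * r\<^sup>2))"
    using N0 by (simp add: abs_mult divide_right_mono)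
  also have "\<dots> = step_err * \<alpha>\<^sup>2 * \<rho>\<^sup>2 / ((real N)\<^sup>2 * sqrt N)"
  proof -
    have "r\<^sup>2 = \<alpha>\<^sup>2 * \<rho>\<^sup>2 / (N * N * N)"
      using N0 by (simp add: r_def power_mult_distrib power_divide power2_eq_square[of "real N"])
    then show ?thesis using N0 by (simp add: power2_eq_square mult_ac)
  qed
  also have "\<dots> \<le> step_err * \<alpha>\<^sup>2 * e\<^sup>2 / ((real N)\<^sup>2 * sqrt N)"
  proof -
    have "\<rho>\<^sup>2 \<le> e\<^sup>2" using e power_mono[of "\<bar>\<rho>\<bar>" e 2] by (simp add: \<rho>_def)
    then show ?thesis using N0 const_nonneg(1) by (intro divide_right_mono mult_left_mono) auto
  qed
  finally have "\<bar>network \<sigma> N ?p' (X i) - network \<sigma> N ?p (X i) - \<alpha> / N * \<rho> * (1 / N * (\<Sum>l=1..N. K l))\<bar>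
      \<le> step_err * \<alpha>\<^sup>2 * e\<^sup>2 / ((real N)\<^sup>2 * sqrt N)" unfolding eq .
  then show ?thesis unfolding \<rho>_def K_def .
qed

end

section \<open>A priori bounds along a run\<close>

text \<open>The first inequality in \<open>large\<close> keeps the outer weights below
  \<open>2 * B\<close> for \<open>N * T\<close> steps; the second lets \<open>growth\<close> absorb
  the quadratic error of a step.\<close>

locale sgd_run = network_data \<sigma> \<alpha> T X Y S D B
  for \<sigma> \<alpha> T and X :: "'m::finite \<Rightarrow> real^'d::finite" and Y S D B +
  fixes N :: nat and p\<^sub>0 :: "nat \<Rightarrow> 'd param" and z :: "nat \<Rightarrow> (real^'d) \<times> real" and R :: real
  assumes N: "N \<ge> 1" and R: "R \<ge> 0"
    and z: "\<And>k. z k \<in> range (\<lambda>j. (X j, Y j))"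
    and c0: "\<And>i. i \<in> {1..N} \<Longrightarrow> \<bar>fst (p\<^sub>0 i)\<bar> \<le> B"
    and g0: "\<And>j. \<bar>network \<sigma> N p\<^sub>0 (X j)\<bar> \<le> R"
    and large: "drift_bound R * T \<le> B * sqrt N" "step_err * \<alpha> * residual_bound R \<le> sqrt N"
begin

abbreviation "p \<equiv> sgd \<sigma> \<alpha> N p\<^sub>0 z"
abbreviation "g k j \<equiv> network \<sigma> N (p k) (X j)"

lemma N0: "real N > 0" "sqrt N > 0" "sqrt N \<ge> 1" "sqrt N * sqrt N = N" using N by auto

text \<open>A joint induction, since the bounds depend on each other: bounded outputs limit the
  parameter steps, and outer weights below \<open>2 * B\<close> limit the kernel that drives the
  outputs.\<close>

lemma apriori:
  assumes "real k \<le> N * T"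
  shows "(\<forall>j. \<bar>g k j\<bar> + D \<le> (R + D) * (1 + growth / N) ^ k) \<and>
    (\<forall>i\<in>{1..N}. \<bar>fst (p k i) - fst (p\<^sub>0 i)\<bar> \<le> k * (drift_bound R / (N * sqrt N)) \<and>
        norm (snd (p k i) - snd (p\<^sub>0 i)) \<le> k * (drift_bound R / (N * sqrt N)))"
  using assms
proof (induction k)
  case 0
  then show ?case using g0 by simp
next
  case (Suc k)
  define \<rho> where "\<rho> = (R + D) * (1 + growth / N) ^ k"
  define h where "h = drift_bound R / (N * sqrt N)"
  have k: "real k \<le> N * T" using Suc.prems by simp
  note IH = Suc.IH[OF k, folded \<rho>_def h_def]
  have IHg: "\<bar>g k i\<bar> + D \<le> \<rho>" for i using IH by blast
  have \<rho>: "\<rho> \<le> residual_bound R"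
    using power_one_plus_le_exp[OF const_nonneg(4) N k] R pos
    by (auto simp: \<rho>_def residual_bound_def intro!: mult_left_mono)
  have \<rho>0: "\<rho> \<ge> 0" using R pos const_nonneg(4) by (auto simp: \<rho>_def)
  have hk: "k * h \<le> B"
  proof -
    have "drift_bound R \<ge> 0" using drift_bound_pos[OF R] by simp
    then have "real k * drift_bound R \<le> N * T * drift_bound R" using k by (intro mult_right_mono)
    also have "\<dots> \<le> N * (B * sqrt N)" using large(1) N0 by (simp add: mult_ac)
    finally show ?thesis using N0 by (simp add: h_def field_simps)
  qed
  have c: "\<bar>fst (p k i)\<bar> \<le> 2 * B" if "i \<in> {1..N}" for i
  proof -
    have "\<bar>fst (p k i) - fst (p\<^sub>0 i)\<bar> \<le> k * h" using IH that by blast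
    then show ?thesis using c0[OF that] hk by linarith
  qed
  obtain j where j: "z k = (X j, Y j)" using z[of k] by auto
  have e: "\<bar>Y j - g k j\<bar> \<le> \<rho>" using IHg[of j] D(2)[of j] by linarith
  define r where "r = \<alpha> / N / sqrt N * (Y j - g k j)"
  have "\<bar>r\<bar> \<le> \<alpha> / N / sqrt N * residual_bound R"
    using e \<rho> pos N0 by (auto simp: r_def abs_mult intro!: mult_left_mono divide_right_mono)
  then have r: "\<bar>r\<bar> \<le> \<alpha> * residual_bound R / (N * sqrt N)" by simp
  have rb0: "residual_bound R > 0" by (rule residual_bound_pos[OF R])
  have hh: "\<alpha> * residual_bound R / (N * sqrt N) * (2 * B * S * D) = h"
    by (simp add: h_def drift_bound_def)
  \<comment> \<open>Lets a single \<open>h\<close> bound the steps of inner and outer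
    weights.\<close>
  have one: "S \<le> 2 * B * S * D"
  proof -
    have "1 * S * 1 \<le> 2 * B * S * D" using pos by (intro mult_mono) auto
    then show ?thesis by simp
  qed
  have step: "\<bar>fst (p (Suc k) i) - fst (p k i)\<bar> \<le> h" "norm (snd (p (Suc k) i) - snd (p k i)) \<le> h"
    if i: "i \<in> {1..N}" for i
  proof -
    have "\<bar>fst (p (Suc k) i) - fst (p k i)\<bar> = \<bar>r * \<sigma> (snd (p k i) \<bullet> X j)\<bar>"
      unfolding sgd_Suc_data(1)[where z = z and k = k, OF j] r_def by simp
    also have "\<dots> \<le> \<alpha> * residual_bound R / (N * sqrt N) * S" by (intro abs_mult_le r S)
    also have "\<dots> \<le> \<alpha> * residual_bound R / (N * sqrt N) * (2 * B * S * D)"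
      using one pos rb0 N0 by (intro mult_left_mono) auto
    finally show "\<bar>fst (p (Suc k) i) - fst (p k i)\<bar> \<le> h" unfolding hh .
    have "norm (snd (p (Suc k) i) - snd (p k i)) = \<bar>r * fst (p k i) * deriv \<sigma> (snd (p k i) \<bullet> X j) * norm (X j)\<bar>"
      unfolding sgd_Suc_data(2)[where z = z and k = k, OF j] r_def by (simp add: abs_mult)
    also have "\<dots> \<le> \<alpha> * residual_bound R / (N * sqrt N) * (2 * B) * S * D"
      using D(1) by (intro abs_mult_le r S c[OF i]) auto
    also have "\<dots> = h" unfolding hh[symmetric] by simp
    finally show "norm (snd (p (Suc k) i) - snd (p k i)) \<le> h" .
  qed
  show ?case
  proof (intro conjI allI ballI)
    fix i assume i: "i \<in> {1..N}"
    have "\<bar>fst (p k i) - fst (p\<^sub>0 i)\<bar> \<le> k * h" "norm (snd (p k i) - snd (p\<^sub>0 i)) \<le> k * h" using IH i by blast+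
    moreover have "norm (snd (p (Suc k) i) - snd (p\<^sub>0 i)) \<le> norm (snd (p (Suc k) i) - snd (p k i)) + norm (snd (p k i) - snd (p\<^sub>0 i))"
      using norm_triangle_ineq[of "snd (p (Suc k) i) - snd (p k i)" "snd (p k i) - snd (p\<^sub>0 i)"] by simp
    moreover have "real (Suc k) * h = h + k * h" by (simp add: algebra_simps)
    ultimately show "\<bar>fst (p (Suc k) i) - fst (p\<^sub>0 i)\<bar> \<le> (Suc k) * (drift_bound R / (N * sqrt N))"
      "norm (snd (p (Suc k) i) - snd (p\<^sub>0 i)) \<le> (Suc k) * (drift_bound R / (N * sqrt N))"
      using step[OF i] unfolding h_def[symmetric] by linarith+
  next
    fix i
    let ?K = "avg N (tangent_kernel \<sigma> (X i) (X j)) (p k)"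
    have "\<bar>\<Sum>l=1..N. tangent_kernel \<sigma> (X i) (X j) (p k l)\<bar> \<le> (\<Sum>l=1..N. kernel_bound)"
      by (intro order_trans[OF sum_abs] sum_mono tangent_kernel_bound c)
    then have K: "\<bar>?K\<bar> \<le> kernel_bound" using N0 by (simp add: field_simps abs_mult)
    have "\<bar>\<alpha> / N * (Y j - g k j) * ?K\<bar> \<le> \<alpha> / N * \<rho> * kernel_bound"
      using pos N0 by (intro abs_mult_le e K) auto
    \<comment> \<open>The quadratic error costs at most one further
      \<open>\<alpha> / N * \<rho>\<close>, which is the \<open>+ 1\<close> in
      \<open>growth\<close>.\<close>
    moreover have "step_err * \<alpha>\<^sup>2 * \<rho>\<^sup>2 / ((real N)\<^sup>2 * sqrt N) \<le> \<alpha> / N * \<rho>"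
    proof -
      have "step_err * \<alpha> * \<rho> \<le> step_err * \<alpha> * residual_bound R"
        using const_nonneg pos \<rho> by (intro mult_left_mono) auto
      also have "\<dots> \<le> sqrt N" by (rule large)
      also have "\<dots> \<le> N * sqrt N" using N N0 by simp
      finally have "step_err * \<alpha> * \<rho> * (\<alpha> * \<rho>) \<le> N * sqrt N * (\<alpha> * \<rho>)"
        using pos \<rho>0 by (intro mult_right_mono) auto
      then show ?thesis using N0 by (simp add: field_simps power2_eq_square)
    qed
    moreover have "\<bar>g (Suc k) i - g k i - \<alpha> / N * (Y j - g k j) * ?K\<bar> \<le> step_err * \<alpha>\<^sup>2 * \<rho>\<^sup>2 / ((real N)\<^sup>2 * sqrt N)"
      by (rule network_step[OF N j c e])
    ultimately have "\<bar>g (Suc k) i - g k i\<bar> \<le> \<alpha> / N * \<rho> * kernel_bound + \<alpha> / N * \<rho>"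
      by linarith
    also have "\<dots> = growth / N * \<rho>" by (simp add: growth_def distrib_left distrib_right add_divide_distrib mult_ac)
    finally have "\<bar>g (Suc k) i\<bar> + D \<le> \<rho> + growth / N * \<rho>" using IHg[of i] by linarith
    also have "\<dots> = (1 + growth / N) * \<rho>" by (simp only: distrib_right mult_1_left)
    also have "\<dots> = (R + D) * (1 + growth / N) ^ Suc k" by (simp add: \<rho>_def mult_ac)
    finally show "\<bar>g (Suc k) i\<bar> + D \<le> (R + D) * (1 + growth / N) ^ Suc k" .
  qed
qed


lemma residual_le:
  assumes "real k \<le> N * T" shows "\<bar>Y j - g k j\<bar> \<le> residual_bound R"
proof -
  have "\<bar>g k j\<bar> + D \<le> (R + D) * (1 + growth / N) ^ k" using apriori[OF assms] by blast
  also have "\<dots> \<le> residual_bound R"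
    using power_one_plus_le_exp[OF const_nonneg(4) N assms] R pos
    by (auto simp: residual_bound_def intro!: mult_left_mono)
  finally show ?thesis using D(2)[of j] by linarith
qed

lemma parameter_shift:
  assumes k: "real k \<le> N * T" and i: "i \<in> {1..N}"
  shows "\<bar>fst (p k i) - fst (p\<^sub>0 i)\<bar> \<le> drift_bound R * T / sqrt N"
    "norm (snd (p k i) - snd (p\<^sub>0 i)) \<le> drift_bound R * T / sqrt N"
    "\<bar>fst (p k i)\<bar> \<le> 2 * B"
proof -
  have "real k * drift_bound R \<le> N * T * drift_bound R"
    using k drift_bound_pos[OF R] by (intro mult_right_mono) auto
  then have le: "k * (drift_bound R / (N * sqrt N)) \<le> drift_bound R * T / sqrt N"
    using N0 by (simp add: field_simps)
  show "\<bar>fst (p k i) - fst (p\<^sub>0 i)\<bar> \<le> drift_bound R * T / sqrt N"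
    "norm (snd (p k i) - snd (p\<^sub>0 i)) \<le> drift_bound R * T / sqrt N"
    using apriori[OF k] i le order_trans by blast+
  moreover have "drift_bound R * T / sqrt N \<le> B" using large(1) N0 by (simp add: field_simps)
  ultimately show "\<bar>fst (p k i)\<bar> \<le> 2 * B" using c0[OF i] by linarith
qed

text \<open>The kernel averaged over the current parameters is replaced by \<open>A\<close> in two
  stages: the parameter drift by the Lipschitz bound, then the initial average by
  \<open>\<eta>\<close>. The cruder second bound is the one that summation by parts needs.\<close>

lemma network_increment:
  assumes k: "real k \<le> N * T" and j: "z k = (X j, Y j)"
    and A: "\<bar>avg N (tangent_kernel \<sigma> (X i) (X j)) p\<^sub>0 - A\<bar> \<le> \<eta>"
  shows "\<bar>g (Suc k) i - g k i - 1 / N * (\<alpha> * (Y j - g k j) * A)\<bar> \<le>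
      (\<alpha> * residual_bound R * (kernel_lip * (drift_bound R * T / sqrt N) + \<eta>) + step_err * \<alpha>\<^sup>2 * (residual_bound R)\<^sup>2 / sqrt N) / N"
    "\<bar>g (Suc k) i - g k i\<bar> \<le> growth * residual_bound R / N"
proof -
  let ?R = "residual_bound R"
  let ?K = "avg N (tangent_kernel \<sigma> (X i) (X j)) (p k)"
  let ?L = "avg N (tangent_kernel \<sigma> (X i) (X j)) p\<^sub>0"
  have c0': "\<bar>fst (p\<^sub>0 l)\<bar> \<le> 2 * B" if "l \<in> {1..N}" for l using c0[OF that] pos by linarith
  have R0: "?R > 0" by (rule residual_bound_pos[OF R])
  have e: "\<bar>Y j - g k j\<bar> \<le> ?R" by (rule residual_le[OF k])
  have st: "\<bar>g (Suc k) i - g k i - \<alpha> / N * (Y j - g k j) * ?K\<bar> \<le> step_err * \<alpha>\<^sup>2 * ?R\<^sup>2 / ((real N)\<^sup>2 * sqrt N)"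
    by (rule network_step[where z = z and k = k, OF N j parameter_shift(3)[OF k] e])
  have "\<bar>\<Sum>l=1..N. tangent_kernel \<sigma> (X i) (X j) (p k l) - tangent_kernel \<sigma> (X i) (X j) (p\<^sub>0 l)\<bar>
      \<le> (\<Sum>l=1..N. kernel_lip * (drift_bound R * T / sqrt N))"
    by (intro order_trans[OF sum_abs] sum_mono tangent_kernel_lipschitz parameter_shift k c0')
  also have "\<dots> = N * (kernel_lip * (drift_bound R * T / sqrt N))" by simp
  finally have "1 / N * \<bar>\<Sum>l=1..N. tangent_kernel \<sigma> (X i) (X j) (p k l) - tangent_kernel \<sigma> (X i) (X j) (p\<^sub>0 l)\<bar>
      \<le> 1 / N * (N * (kernel_lip * (drift_bound R * T / sqrt N)))" by (intro mult_left_mono) auto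
  also have "1 / N * \<bar>\<Sum>l=1..N. tangent_kernel \<sigma> (X i) (X j) (p k l) - tangent_kernel \<sigma> (X i) (X j) (p\<^sub>0 l)\<bar>
      = \<bar>?K - ?L\<bar>"
    unfolding right_diff_distrib[symmetric] sum_subtractf[symmetric] abs_mult by simp
  finally have "\<bar>?K - ?L\<bar> \<le> kernel_lip * (drift_bound R * T / sqrt N)" using N0 by simp
  then have "\<bar>?K - A\<bar> \<le> kernel_lip * (drift_bound R * T / sqrt N) + \<eta>" using A by linarith
  then have "\<bar>\<alpha> / N * (Y j - g k j) * (?K - A)\<bar> \<le> \<alpha> / N * ?R * (kernel_lip * (drift_bound R * T / sqrt N) + \<eta>)"
    using pos by (intro abs_mult_le e) auto
  moreover have "\<alpha> / N * (Y j - g k j) * (?K - A) = \<alpha> / N * (Y j - g k j) * ?K - 1 / N * (\<alpha> * (Y j - g k j) * A)"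
    by (simp add: right_diff_distrib left_diff_distrib diff_divide_distrib)
  \<comment> \<open>One factor \<open>N\<close> is given away so that the whole error takes the form
    \<open>e / N\<close> required by \<open>sampled_recursion_close\<close>.\<close>
  moreover have "step_err * \<alpha>\<^sup>2 * ?R\<^sup>2 / ((real N)\<^sup>2 * sqrt N) \<le> step_err * \<alpha>\<^sup>2 * ?R\<^sup>2 / (N * sqrt N)"
  proof -
    have "real N * 1 \<le> real N * real N" using N by (intro mult_left_mono) auto
    then show ?thesis using N N0 const_nonneg(1) pos
      by (intro divide_left_mono mult_right_mono) (auto simp: power2_eq_square)
  qed
  moreover have "(\<alpha> * ?R * (kernel_lip * (drift_bound R * T / sqrt N) + \<eta>) + step_err * \<alpha>\<^sup>2 * ?R\<^sup>2 / sqrt N) / N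
     = \<alpha> / N * ?R * (kernel_lip * (drift_bound R * T / sqrt N) + \<eta>) + step_err * \<alpha>\<^sup>2 * ?R\<^sup>2 / (N * sqrt N)"
    by (simp add: add_divide_distrib mult.commute)
  ultimately show "\<bar>g (Suc k) i - g k i - 1 / N * (\<alpha> * (Y j - g k j) * A)\<bar> \<le>
      (\<alpha> * ?R * (kernel_lip * (drift_bound R * T / sqrt N) + \<eta>) + step_err * \<alpha>\<^sup>2 * ?R\<^sup>2 / sqrt N) / N"
    using st by linarith
  have "\<bar>\<Sum>l=1..N. tangent_kernel \<sigma> (X i) (X j) (p k l)\<bar> \<le> (\<Sum>l=1..N. kernel_bound)"
    by (intro order_trans[OF sum_abs] sum_mono tangent_kernel_bound parameter_shift(3) k)
  then have K: "\<bar>?K\<bar> \<le> kernel_bound" using N0 by (simp add: field_simps abs_mult)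
  have "\<bar>\<alpha> / N * (Y j - g k j) * ?K\<bar> \<le> \<alpha> / N * ?R * kernel_bound"
    using pos N0 by (intro abs_mult_le e K) auto
  moreover have "step_err * \<alpha>\<^sup>2 * ?R\<^sup>2 / ((real N)\<^sup>2 * sqrt N) \<le> \<alpha> / N * ?R"
  proof -
    have "step_err * \<alpha> * ?R \<le> sqrt N" by (rule large)
    also have "\<dots> \<le> N * sqrt N" using N N0 by simp
    finally have "step_err * \<alpha> * ?R * (\<alpha> * ?R) \<le> N * sqrt N * (\<alpha> * ?R)"
      using pos R0 by (intro mult_right_mono) auto
    then show ?thesis using N0 by (simp add: field_simps power2_eq_square)
  qed
  moreover have "growth * ?R / N = \<alpha> / N * ?R * kernel_bound + \<alpha> / N * ?R"
    by (simp add: growth_def distrib_left distrib_right add_divide_distrib mult_ac)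
  ultimately show "\<bar>g (Suc k) i - g k i\<bar> \<le> growth * ?R / N" using st by linarith
qed

end

text \<open>Rewrites a step driven by the sampled point as a weighted sum over all indices, the form
  in which the weights can be compared with their mean.\<close>

lemma sum_sample_weight:
  fixes \<phi> :: "'m::finite \<Rightarrow> 'v::real_vector"
  assumes "\<And>i. (X i, Y i) = (X j, Y j) \<Longrightarrow> \<phi> i = \<phi> j"
  shows "(\<Sum>i\<in>UNIV. sample_weight X Y i (X j, Y j) *\<^sub>R \<phi> i) = \<phi> j"
proof -
  define I where "I = {i. (X i, Y i) = (X j, Y j)}"
  have "j \<in> I" by (simp add: I_def)
  then have c: "card I > 0" by (metis card_gt_0_iff empty_iff finite)
  have "sample_weight X Y i (X j, Y j) *\<^sub>R \<phi> i = (if i \<in> I then (1 / card I) *\<^sub>R \<phi> j else 0)" for i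
  proof (cases "i \<in> I")
    case True
    then have "{l. (X l, Y l) = (X i, Y i)} = I" "\<phi> i = \<phi> j" using assms[of i] by (auto simp: I_def)
    then show ?thesis using True by (auto simp: sample_weight_def I_def)
  qed (auto simp: sample_weight_def I_def)
  then have "(\<Sum>i\<in>UNIV. sample_weight X Y i (X j, Y j) *\<^sub>R \<phi> i) = (\<Sum>i\<in>I. (1 / card I) *\<^sub>R \<phi> j)"
    by (simp add: sum.If_cases)
  also have "\<dots> = \<phi> j" using c \<open>j \<in> I\<close> by (auto simp: sum_constant_scaleR)
  finally show ?thesis .
qed

lemma norm_vec_le:
  fixes v :: "real^'m::finite" and b :: real
  assumes "\<And>i. \<bar>v $ i\<bar> \<le> b"
  shows "norm v \<le> CARD('m) * b"
  using order_trans[OF norm_le_l1_cart sum_mono[of UNIV "\<lambda>i. \<bar>v $ i\<bar>" "\<lambda>_. b"]] assms by simp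

context network_data
begin

text \<open>\<open>C\<close> and \<open>N0\<close> are chosen before the inputs, so the estimate is
  uniform over all good inputs. The condition on \<open>A\<close> for coinciding inputs lets the
  weighted sum over repeated data points collapse to the sampled one.\<close>

lemma sgd_close:
  fixes A :: "'m \<Rightarrow> 'm \<Rightarrow> real" and R :: real
  assumes A: "\<And>i j j'. X j = X j' \<Longrightarrow> A i j = A i j'" and R: "R \<ge> 0"
  defines "h \<equiv> relax (\<chi> i j. \<alpha> / CARD('m) * A i j) (\<chi> j. Y j)"
  shows "\<exists>C>0. \<exists>N0\<ge>1. \<forall>N\<ge>N0. \<forall>p\<^sub>0 z \<eta>. good_inputs N R \<eta> p\<^sub>0 z \<longrightarrow>
    (\<forall>i j. \<bar>avg N (tangent_kernel \<sigma> (X i) (X j)) p\<^sub>0 - A i j\<bar> \<le> \<eta>) \<longrightarrow>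
    (\<forall>n. real n \<le> N * T \<longrightarrow>
      norm ((\<chi> i. network \<sigma> N (sgd \<sigma> \<alpha> N p\<^sub>0 z n) (X i)) - h (\<chi> i. network \<sigma> N p\<^sub>0 (X i)) (n / N)) \<le> C * (\<eta> + 1 / sqrt N) \<and>
      (\<forall>i\<in>{1..N}. \<bar>fst (sgd \<sigma> \<alpha> N p\<^sub>0 z n i) - fst (p\<^sub>0 i)\<bar> \<le> C / sqrt N \<and>
        norm (snd (sgd \<sigma> \<alpha> N p\<^sub>0 z n i) - snd (p\<^sub>0 i)) \<le> C / sqrt N))"
proof -
  let ?M = "real CARD('m)" and ?R = "residual_bound R"
  \<comment> \<open>Drift caused by sampling index \<open>j\<close>; its average over
    \<open>j\<close> is the right-hand side of the relaxation equation.\<close>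
  define b where "b j v = (Y j - v $ j) *\<^sub>R (\<chi> i. \<alpha> * A i j)" for j and v :: "real^'m"
  define c where "c = (\<Sum>j\<in>UNIV. norm (\<chi> i. \<alpha> * A i j))"
  have c: "norm (\<chi> i. \<alpha> * A i j) \<le> c" for j
    unfolding c_def by (rule member_le_sum) auto
  have c_nonneg: "c \<ge> 0" unfolding c_def by (simp add: sum_nonneg)
  obtain \<kappa> where \<kappa>: "\<kappa> > 0"
    "\<And>g s t. norm g \<le> ?M * R \<Longrightarrow> s \<in> {0..T} \<Longrightarrow> t \<in> {0..T} \<Longrightarrow>
      norm (h g t - h g s - (t - s) *\<^sub>R ((\<chi> i j. \<alpha> / CARD('m) * A i j) *v ((\<chi> j. Y j) - h g s))) \<le> \<kappa> * (t - s)\<^sup>2"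
    unfolding h_def by (rule relax_taylor[of "?M * R" T "\<chi> i j. \<alpha> / CARD('m) * A i j" "\<chi> j. Y j"]) blast
  have avg: "(\<chi> i j. \<alpha> / CARD('m) * A i j) *v ((\<chi> j. Y j) - v) = (1 / CARD('m)) *\<^sub>R (\<Sum>j\<in>UNIV. b j v)" for v
    by (simp add: vec_eq_iff b_def matrix_vector_mult_def sum_divide_distrib mult_ac)
  define Ce where "Ce = ?M * (\<alpha> * ?R * (kernel_lip * (drift_bound R * T) + 1) + step_err * \<alpha>\<^sup>2 * ?R\<^sup>2)"
  define \<kappa>' where "\<kappa>' = ?M * (growth * ?R)"
  \<comment> \<open>The bound of \<open>sampled_recursion_close\<close> after every small quantity
    has been estimated by \<open>\<eta> + 1 / sqrt N\<close>.\<close>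
  define C1 where "C1 = (Ce * T + \<kappa> * T + ?M * (c * ?R + c * \<kappa>' * T)) * exp (c * T)"
  have R0: "?R > 0" by (rule residual_bound_pos[OF R])
  have Ce0: "Ce \<ge> 0" and \<kappa>'0: "\<kappa>' \<ge> 0" using R0 const_nonneg pos drift_bound_pos[OF R] by (auto simp: Ce_def \<kappa>'_def)
  \<comment> \<open>Large enough for both inequalities in \<open>large\<close>.\<close>
  obtain N0 :: nat where n0: "N0 \<ge> 1" "max (drift_bound R * T / B) (step_err * \<alpha> * ?R) \<le> sqrt N0"
  proof -
    obtain n :: nat where n: "(max (drift_bound R * T / B) (step_err * \<alpha> * ?R))\<^sup>2 \<le> n" using real_arch_simple by blast
    then have "max (drift_bound R * T / B) (step_err * \<alpha> * ?R) \<le> sqrt n" by (rule real_le_rsqrt)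
    also have "\<dots> \<le> sqrt (max n 1)" by (intro real_sqrt_le_mono) simp
    finally show ?thesis using that[of "max n 1"] by auto
  qed
  show ?thesis
  \<comment> \<open>The second entry covers the displacement of the parameters.\<close>
  proof (rule exI[of _ "max C1 (drift_bound R * T)"], intro conjI exI[of _ N0] allI impI)
    have "drift_bound R * T > 0" using drift_bound_pos[OF R] pos(2) by (rule mult_pos_pos)
    then show "max C1 (drift_bound R * T) > 0" by simp
    show "1 \<le> N0" by (rule n0)
    fix N p\<^sub>0 z and \<eta> :: real and n :: nat
    assume NN: "N0 \<le> N" and good: "good_inputs N R \<eta> p\<^sub>0 z" and n: "real n \<le> N * T"
      and kernel: "\<forall>i j. \<bar>avg N (tangent_kernel \<sigma> (X i) (X j)) p\<^sub>0 - A i j\<bar> \<le> \<eta>"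
    note asm = good[unfolded good_inputs_def] kernel
    have \<eta>: "\<eta> \<ge> 0" using kernel by (meson abs_ge_zero order_trans)
    have sq: "sqrt N0 \<le> sqrt N" using NN by simp
    interpret sgd_run \<sigma> \<alpha> T X Y S D B N p\<^sub>0 z R
    proof
      show "drift_bound R * T \<le> B * sqrt N"
      proof -
        have "drift_bound R * T / B \<le> sqrt N" using n0(2) sq by linarith
        then show ?thesis using pos by (simp add: field_simps)
      qed
      show "step_err * \<alpha> * ?R \<le> sqrt N" using n0(2) sq by linarith
    qed (use asm NN n0 R in auto)
    define G where "G k = (\<chi> i. g k i)" for k
    define V where "V k = h (G 0) (k / N)" for k :: nat
    \<comment> \<open>By \<open>sum_sample_weight\<close> the sum is the drift of the sampled index
      alone, so \<open>E\<close> is the local error estimated in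
      \<open>network_increment\<close>.\<close>
    define E where "E k = G (Suc k) - G k - (1 / N) *\<^sub>R (\<Sum>j\<in>UNIV. sample_weight X Y j (z k) *\<^sub>R b j (G k))" for k
    define e where "e = ?M * (\<alpha> * ?R * (kernel_lip * (drift_bound R * T / sqrt N) + \<eta>) + step_err * \<alpha>\<^sup>2 * ?R\<^sup>2 / sqrt N)"
    have kT: "real k \<le> N * T" if "k \<le> n" for k using that n by linarith
    have "\<bar>G 0 $ i\<bar> \<le> R" for i using g0[of i] by (simp add: G_def)
    then have G0: "norm (G 0) \<le> ?M * R" using norm_vec_le[of "G 0" R] by simp
    have bY: "norm (b j (G k)) \<le> c * ?R" if "k \<le> n" for j k
    proof -
      have "norm (b j (G k)) = \<bar>Y j - g k j\<bar> * norm (\<chi> i. \<alpha> * A i j)" by (simp add: b_def G_def)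
      also have "\<dots> \<le> ?R * c" using residual_le[OF kT[OF that]] c R0 by (intro mult_mono) auto
      finally show ?thesis by (simp add: mult.commute)
    qed
    have e0: "e \<ge> 0" using R0 const_nonneg pos drift_bound_pos[OF R] \<eta> by (auto simp: e_def)
    have eC: "e \<le> Ce * (\<eta> + 1 / sqrt N)"
    proof -
      have s: "1 / sqrt N > 0" using N0 by simp
      have "Ce * (\<eta> + 1 / sqrt N) = e + ?M * (\<alpha> * ?R * (kernel_lip * (drift_bound R * T) * \<eta> + 1 / sqrt N) + step_err * \<alpha>\<^sup>2 * ?R\<^sup>2 * \<eta>)"
        by (simp add: Ce_def e_def algebra_simps)
      moreover have "0 \<le> ?M * (\<alpha> * ?R * (kernel_lip * (drift_bound R * T) * \<eta> + 1 / sqrt N) + step_err * \<alpha>\<^sup>2 * ?R\<^sup>2 * \<eta>)"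
        using R0 const_nonneg pos drift_bound_pos[OF R] \<eta> s by auto
      ultimately show ?thesis by linarith
    qed
    have "norm (G n - V n) \<le> (e * T + \<kappa> * T / N + CARD('m) * (\<eta> * (c * ?R + c * \<kappa>' * T))) * exp (c * T)"
    proof (rule sampled_recursion_close[where w = "\<lambda>k j. sample_weight X Y j (z k)" and B = b and E = E])
      show "1 \<le> N" by (rule N)
      show "real n \<le> N * T" by (rule n)
      show "G 0 = V 0" by (simp add: V_def h_def relax_0)
      show "G (Suc k) = G k + (1 / N) *\<^sub>R (\<Sum>j\<in>UNIV. sample_weight X Y j (z k) *\<^sub>R b j (G k)) + E k" for k
        by (simp add: E_def)
      fix k
      show "\<bar>sampling_error N j k z\<bar> \<le> \<eta>" if "k \<le> n" for j
        using asm kT[OF that] by blast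
      show "norm (b j (G k)) \<le> c * ?R" if "k \<le> n" for j using bY[OF that] .
      assume k: "k < n"
      obtain j where j: "z k = (X j, Y j)" using z[of k] by auto
      have "(\<Sum>j\<in>UNIV. sample_weight X Y j (z k) *\<^sub>R b j (G k)) = b j (G k)"
        unfolding j
      proof (rule sum_sample_weight)
        fix i assume "(X i, Y i) = (X j, Y j)"
        then have "X i = X j" "Y i = Y j" by auto
        moreover have "A l i = A l j" for l using A \<open>X i = X j\<close> by blast
        ultimately show "b i (G k) = b j (G k)" by (simp add: b_def G_def)
      qed
      then have Ei: "E k $ i = g (Suc k) i - g k i - 1 / N * (\<alpha> * (Y j - g k j) * A i j)" for i
        by (simp add: E_def G_def b_def)
      have k': "real k \<le> N * T" using kT k by simp
      have A': "\<bar>avg N (tangent_kernel \<sigma> (X i) (X j)) p\<^sub>0 - A i j\<bar> \<le> \<eta>" for i using asm by blast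
      show "norm (E k) \<le> e / N"
        using norm_vec_le[of "E k"] network_increment(1)[OF k' j A'] unfolding Ei e_def
        by (simp only: times_divide_eq_right[symmetric])
      show "norm (G (Suc k) - G k) \<le> \<kappa>' / N"
        using norm_vec_le[of "G (Suc k) - G k"] network_increment(2)[OF k' j A'] unfolding \<kappa>'_def G_def
        by (simp only: times_divide_eq_right[symmetric] vector_minus_component vec_lambda_beta)
      have st: "real k / N \<in> {0..T}" "real (Suc k) / N \<in> {0..T}"
        using kT[of k] kT[of "Suc k"] k N0 by (auto simp: field_simps)
      have d: "real (Suc k) / N - real k / N = 1 / N" by (simp add: diff_divide_distrib[symmetric])
      show "norm (V (Suc k) - V k - (1 / N) *\<^sub>R ((1 / CARD('m)) *\<^sub>R (\<Sum>j\<in>UNIV. b j (V k)))) \<le> \<kappa> / (real N)\<^sup>2"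
        using \<kappa>(2)[OF G0 st] unfolding d avg V_def by (simp add: power_divide)
    next
      fix j v v'
      have "norm (b j v - b j v') = \<bar>v' $ j - v $ j\<bar> * norm (\<chi> i. \<alpha> * A i j)"
        unfolding b_def scaleR_diff_left[symmetric] norm_scaleR by simp
      also have "\<dots> \<le> norm (v' - v) * c"
        using component_le_norm_cart[of "v' - v" j] c by (intro mult_mono) auto
      finally show "norm (b j v - b j v') \<le> c * norm (v - v')" by (simp add: norm_minus_commute mult.commute)
    qed (use e0 \<kappa>(1) c_nonneg R0 \<kappa>'0 pos in auto)
    also have "\<dots> \<le> ((Ce * (\<eta> + 1 / sqrt N)) * T + \<kappa> * T * (\<eta> + 1 / sqrt N) + CARD('m) * ((\<eta> + 1 / sqrt N) * (c * ?R + c * \<kappa>' * T))) * exp (c * T)"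
    proof (intro mult_right_mono add_mono mult_left_mono)
      have "\<kappa> * T / N \<le> \<kappa> * T / sqrt N"
      proof -
        have "sqrt N * 1 \<le> sqrt N * sqrt N" using N0 by (intro mult_left_mono) auto
        then show ?thesis using N0 \<kappa>(1) pos by (intro divide_left_mono) auto
      qed
      also have "\<dots> \<le> \<kappa> * T * (\<eta> + 1 / sqrt N)"
        using \<eta> \<kappa>(1) pos by (simp add: distrib_left)
      finally show "\<kappa> * T / N \<le> \<kappa> * T * (\<eta> + 1 / sqrt N)" .
    qed (use eC c_nonneg R0 \<kappa>'0 pos in auto)
    also have "\<dots> = C1 * (\<eta> + 1 / sqrt N)"
      by (simp add: C1_def algebra_simps)
    also have "\<dots> \<le> max C1 (drift_bound R * T) * (\<eta> + 1 / sqrt N)"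
      using \<eta> by (intro mult_right_mono) auto
    finally show "norm ((\<chi> i. g n i) - h (\<chi> i. network \<sigma> N p\<^sub>0 (X i)) (n / N)) \<le> max C1 (drift_bound R * T) * (\<eta> + 1 / sqrt N)"
      by (simp add: G_def V_def)
    show "\<forall>i\<in>{1..N}. \<bar>fst (p n i) - fst (p\<^sub>0 i)\<bar> \<le> max C1 (drift_bound R * T) / sqrt N \<and>
        norm (snd (p n i) - snd (p\<^sub>0 i)) \<le> max C1 (drift_bound R * T) / sqrt N"
    proof (intro ballI conjI)
      fix i assume i: "i \<in> {1..N}"
      have "drift_bound R * T / sqrt N \<le> max C1 (drift_bound R * T) / sqrt N"
        using N0 by (intro divide_right_mono) auto
      then show "\<bar>fst (p n i) - fst (p\<^sub>0 i)\<bar> \<le> max C1 (drift_bound R * T) / sqrt N"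
        "norm (snd (p n i) - snd (p\<^sub>0 i)) \<le> max C1 (drift_bound R * T) / sqrt N"
        using parameter_shift[OF n i] by linarith+
    qed
  qed
qed

end

section \<open>Paths\<close>

lemma continuous_map_limitin:
  fixes f :: "'a::topological_space \<Rightarrow> 'e"
  assumes "continuous_map euclidean E f"
  shows "limitin E f (f t) (at t within S)"
  unfolding limitin_def
proof (intro conjI allI impI)
  show "f t \<in> topspace E" using continuous_map_image_subset_topspace[OF assms] by auto
  fix U assume U: "openin E U \<and> f t \<in> U"
  then have "open {x. f x \<in> U}" using openin_continuous_map_preimage[OF assms, of U] by simp
  then show "\<forall>\<^sub>F x in at t within S. f x \<in> U"
    unfolding eventually_at_topological using U by blast
qed

lemma cadlag_paths_continuous:
  fixes f :: "real \<Rightarrow> 'e"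
  assumes f: "continuous_map euclidean E f"
  shows "(\<lambda>t\<in>{0..T}. f t) \<in> cadlag_paths T E"
    "t \<in> {0..T} \<Longrightarrow> limitin E (\<lambda>t\<in>{0..T}. f t) ((\<lambda>t\<in>{0..T}. f t) t) (at t within {0..T})"
proof -
  have sp: "f t \<in> topspace E" for t using continuous_map_image_subset_topspace[OF f] by auto
  have ev: "limitin E (\<lambda>t\<in>{0..T}. f t) (f t) F"
    if "\<forall>\<^sub>F s in F. s \<in> {0..T}" "limitin E f (f t) F" for t F
    using that(2) by (rule limitin_transform_eventually[rotated]) (rule eventually_mono[OF that(1)], simp)
  show "(\<lambda>t\<in>{0..T}. f t) \<in> cadlag_paths T E"
    unfolding cadlag_paths_def
  proof (intro CollectI conjI ballI)
    fix t assume t: "t \<in> {0..<T}"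
    have "\<forall>\<^sub>F s in at_right t. s \<in> {0..T}"
      using t eventually_at_right_less[of t] eventually_at_rightI[of t T "\<lambda>s. s \<in> {0..T}"] by auto
    then show "limitin E (\<lambda>t\<in>{0..T}. f t) ((\<lambda>t\<in>{0..T}. f t) t) (at_right t)"
      using ev[OF _ continuous_map_limitin[OF f]] t by simp
  next
    fix t assume t: "t \<in> {0<..T}"
    have "\<forall>\<^sub>F s in at_left t. s \<in> {0..T}"
      using t eventually_at_leftI[of 0 t "\<lambda>s. s \<in> {0..T}"] by auto
    then show "\<exists>l. limitin E (\<lambda>t\<in>{0..T}. f t) l (at_left t)"
      using ev[OF _ continuous_map_limitin[OF f]] by blast
  qed (use sp in auto)
  assume t: "t \<in> {0..T}"
  have "\<forall>\<^sub>F s in at t within {0..T}. s \<in> {0..T}" by (simp add: eventually_at_filter)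
  then show "limitin E (\<lambda>t\<in>{0..T}. f t) ((\<lambda>t\<in>{0..T}. f t) t) (at t within {0..T})"
    using ev[OF _ continuous_map_limitin[OF f]] t by simp
qed

lemma floor_eventually_right: "\<forall>\<^sub>F s in at_right t. \<lfloor>real N * s\<rfloor> = \<lfloor>real N * t\<rfloor>" if "N \<ge> 1"
proof (rule eventually_at_rightI[of t "(\<lfloor>real N * t\<rfloor> + 1) / N"])
  have N: "real N > 0" using that by simp
  have le: "real N * t < \<lfloor>real N * t\<rfloor> + 1" by linarith
  then show "t < (\<lfloor>real N * t\<rfloor> + 1) / N" using N by (simp add: field_simps)
  fix s assume s: "s \<in> {t<..<(\<lfloor>real N * t\<rfloor> + 1) / N}"
  have "real N * t \<le> real N * s" using s N by (intro mult_left_mono) auto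
  moreover have "real N * s < \<lfloor>real N * t\<rfloor> + 1" using s N by (simp add: field_simps)
  ultimately show "\<lfloor>real N * s\<rfloor> = \<lfloor>real N * t\<rfloor>" by linarith
qed

text \<open>The ceiling covers both cases: at a grid point the left limit is one below
  \<open>N * t\<close>, elsewhere it is the floor.\<close>

lemma floor_eventually_left: "\<forall>\<^sub>F s in at_left t. \<lfloor>real N * s\<rfloor> = \<lceil>real N * t\<rceil> - 1" if "N \<ge> 1"
proof (rule eventually_at_leftI[of "(\<lceil>real N * t\<rceil> - 1) / N" t])
  have N: "real N > 0" using that by simp
  have "\<lceil>real N * t\<rceil> - 1 < real N * t" by linarith
  then show "(\<lceil>real N * t\<rceil> - 1) / N < t" using N by (simp add: field_simps)
  fix s assume s: "s \<in> {(\<lceil>real N * t\<rceil> - 1) / N<..<t}"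
  have "real N * s < real N * t" using s N by simp
  moreover have "\<lceil>real N * t\<rceil> - 1 < real N * s" using s N by (simp add: field_simps)
  ultimately show "\<lfloor>real N * s\<rfloor> = \<lceil>real N * t\<rceil> - 1" by linarith
qed

lemma cadlag_paths_step:
  assumes N: "N \<ge> 1" and f: "\<And>k. f k \<in> topspace E"
  shows "(\<lambda>t\<in>{0..T}. f (nat \<lfloor>real N * t\<rfloor>)) \<in> cadlag_paths T E"
  unfolding cadlag_paths_def
proof (intro CollectI conjI ballI)
  fix t assume t: "t \<in> {0..<T}"
  have 1: "\<forall>\<^sub>F s in at_right t. s \<in> {0..T}"
    using t eventually_at_rightI[of t T "\<lambda>s. s \<in> {0..T}"] by auto
  have "\<forall>\<^sub>F s in at_right t. (\<lambda>t\<in>{0..T}. f (nat \<lfloor>real N * t\<rfloor>)) s = f (nat \<lfloor>real N * t\<rfloor>)"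
    using 1 floor_eventually_right[OF N] by eventually_elim simp
  then show "limitin E (\<lambda>t\<in>{0..T}. f (nat \<lfloor>real N * t\<rfloor>)) ((\<lambda>t\<in>{0..T}. f (nat \<lfloor>real N * t\<rfloor>)) t) (at_right t)"
    using t f by (intro limitin_eventually) auto
next
  fix t assume t: "t \<in> {0<..T}"
  have 1: "\<forall>\<^sub>F s in at_left t. s \<in> {0..T}"
    using t eventually_at_leftI[of 0 t "\<lambda>s. s \<in> {0..T}"] by auto
  have "\<forall>\<^sub>F s in at_left t. (\<lambda>t\<in>{0..T}. f (nat \<lfloor>real N * t\<rfloor>)) s = f (nat (\<lceil>real N * t\<rceil> - 1))"
    using 1 floor_eventually_left[OF N] by eventually_elim simp
  then show "\<exists>l. limitin E (\<lambda>t\<in>{0..T}. f (nat \<lfloor>real N * t\<rfloor>)) l (at_left t)"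
    using f by (intro exI limitin_eventually) auto
qed (use f in auto)

section \<open>Empirical measures and continuity in the inputs\<close>

lemma empirical_in_space: "finite I \<Longrightarrow> I \<noteq> {} \<Longrightarrow> empirical I z \<in> space (prob_algebra borel)"
  unfolding space_prob_algebra empirical_def
  by (auto intro!: prob_space.prob_space_distr prob_space_uniform_count_measure simp: measurable_def space_uniform_count_measure)

lemma integral_empirical:
  fixes f :: "'a::topological_space \<Rightarrow> real"
  assumes "finite I" "I \<noteq> {}" "f \<in> borel_measurable borel"
  shows "(\<integral>x. f x \<partial>empirical I z) = 1 / card I * (\<Sum>i\<in>I. f (z i))"
proof -
  have "z \<in> uniform_count_measure I \<rightarrow>\<^sub>M borel" by (auto simp: measurable_def space_uniform_count_measure sets_uniform_count_measure)
  then have "(\<integral>x. f x \<partial>empirical I z) = (\<integral>i. f (z i) \<partial>uniform_count_measure I)"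
    unfolding empirical_def using assms(3) by (intro integral_distr) auto
  then show ?thesis using assms by (simp add: integral_uniform_count_measure)
qed

lemma integral_empirical_continuous:
  fixes f :: "'a::topological_space \<Rightarrow> real" and N :: nat
  assumes "N \<ge> 1" "continuous_on UNIV f"
  shows "(\<integral>x. f x \<partial>empirical {1..N} z) = 1 / N * (\<Sum>i=1..N. f (z i))"
  using integral_empirical[of "{1..N}" f z] assms borel_measurable_continuous_onI by auto

lemma empirical_cong:
  assumes "\<And>i. i \<in> I \<Longrightarrow> z i = z' i" shows "empirical I z = empirical I z'"
  unfolding empirical_def using assms by (intro distr_cong) (auto simp: space_uniform_count_measure)

lemma network_cong: "(\<And>i. i \<in> {1..N} \<Longrightarrow> p i = p' i) \<Longrightarrow> network \<sigma> N p x = network \<sigma> N p' x"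
  by (simp add: network_def)

lemma sgd_cong:
  assumes "\<And>i. i \<in> {1..N} \<Longrightarrow> p i = p' i" "i \<in> {1..N}"
  shows "sgd \<sigma> \<alpha> N p z k i = sgd \<sigma> \<alpha> N p' z k i"
  using assms(2)
proof (induction k arbitrary: i)
  case (Suc k)
  have "network \<sigma> N (sgd \<sigma> \<alpha> N p z k) x = network \<sigma> N (sgd \<sigma> \<alpha> N p' z k) x" for x
    using Suc.IH by (intro network_cong) blast
  then show ?case using Suc.IH[OF Suc.prems] by (simp only: sgd.simps Let_def)
qed (use assms in simp)

text \<open>Allows the parameters outside \<open>{1..N}\<close>, about which nothing is assumed, to
  be replaced by zero.\<close>

lemma sgd_path_cong:
  assumes "\<And>i. i \<in> {1..N} \<Longrightarrow> p i = p' i"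
  shows "sgd_path \<sigma> \<alpha> T X N p z = sgd_path \<sigma> \<alpha> T X N p' z"
proof -
  have *: "empirical {1..N} (sgd \<sigma> \<alpha> N p z k) = empirical {1..N} (sgd \<sigma> \<alpha> N p' z k)"
    "network \<sigma> N (sgd \<sigma> \<alpha> N p z k) x = network \<sigma> N (sgd \<sigma> \<alpha> N p' z k) x" for k x
    by (intro empirical_cong network_cong sgd_cong[OF assms]; assumption)+
  show ?thesis unfolding sgd_path_def Let_def * ..
qed

text \<open>The weak topology is generated by integrals of test functions, and for an empirical
  measure these are finite averages of continuous functions.\<close>

lemma continuous_map_empirical:
  fixes p :: "'x::topological_space \<Rightarrow> nat \<Rightarrow> 'a::topological_space"
  assumes N: "N \<ge> 1" and p: "\<And>i. i \<in> {1..N} \<Longrightarrow> continuous_on UNIV (\<lambda>x. p x i)"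
  shows "continuous_map euclidean weak_topology (\<lambda>x. empirical {1..N} (p x))"
  unfolding weak_topology_def
proof (rule continuous_on_generated_topo)
  fix W assume "W \<in> {{\<nu> \<in> space (prob_algebra borel). (\<integral>x. f x \<partial>\<nu>) \<in> U} | (f :: 'a \<Rightarrow> real) U.
        continuous_on UNIV f \<and> bounded (range f) \<and> open U}"
  then obtain f :: "'a \<Rightarrow> real" and U where W: "W = {\<nu> \<in> space (prob_algebra borel). (\<integral>x. f x \<partial>\<nu>) \<in> U}"
    and f: "continuous_on UNIV f" and U: "open U" by blast
  have mem: "empirical {1..N} z \<in> space (prob_algebra borel)" for z :: "nat \<Rightarrow> 'a"
    using N by (intro empirical_in_space) auto
  have "empirical {1..N} (p x) \<in> W \<longleftrightarrow> 1 / N * (\<Sum>i=1..N. f (p x i)) \<in> U" for x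
    unfolding W mem_Collect_eq integral_empirical_continuous[OF N f] using mem[of "p x"] by (simp only: simp_thms)
  then have "(\<lambda>x. empirical {1..N} (p x)) -` W = (\<lambda>x. 1 / N * (\<Sum>i=1..N. f (p x i))) -` U"
    by blast
  moreover have "continuous_on UNIV (\<lambda>x. f (p x i))" if "i \<in> {1..N}" for i
    using continuous_on_compose2[OF f p[OF that]] by simp
  then have "continuous_on UNIV (\<lambda>x. 1 / N * (\<Sum>i=1..N. f (p x i)))"
    by (intro continuous_intros) auto
  then have "open ((\<lambda>x. 1 / N * (\<Sum>i=1..N. f (p x i))) -` U)"
    using U by (simp add: continuous_on_open_vimage)
  ultimately show "openin euclidean ((\<lambda>x. empirical {1..N} (p x)) -` W \<inter> topspace euclidean)" by simp
next
  have "empirical {1..N} z \<in> topspace weak_topology" for z :: "nat \<Rightarrow> 'a"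
    using N empirical_in_space[of "{1..N}" z] by (simp add: topspace_weak_topology)
  then show "(\<lambda>x. empirical {1..N} (p x)) ` topspace euclidean \<subseteq> \<Union>{{\<nu> \<in> space (prob_algebra borel). (\<integral>x. f x \<partial>\<nu>) \<in> U} | (f :: 'a \<Rightarrow> real) U.
        continuous_on UNIV f \<and> bounded (range f) \<and> open U}"
    unfolding weak_topology_def by auto
qed

text \<open>Continuity refers to the product topology on sequences of parameters and samples, in
  which every coordinate is continuous.\<close>

lemma continuous_sgd:
  fixes \<sigma> :: "real \<Rightarrow> real"
  assumes \<sigma>: "continuous_on UNIV \<sigma>" "continuous_on UNIV (deriv \<sigma>)"
  shows "continuous_on UNIV (\<lambda>q. sgd \<sigma> \<alpha> N (fst q) (snd q) k i :: 'd::finite param)"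
proof (induction k arbitrary: i)
  case 0
  have "continuous_on UNIV (\<lambda>q. fst q i :: 'd param)" for q :: "(nat \<Rightarrow> 'd param) \<times> (nat \<Rightarrow> (real^'d) \<times> real)"
    by (rule continuous_on_compose2[OF continuous_on_product_coordinates[of i] continuous_on_fst[OF continuous_on_id]]) simp
  then show ?case by simp
next
  case (Suc k)
  let ?p = "\<lambda>q :: (nat \<Rightarrow> 'd param) \<times> (nat \<Rightarrow> (real^'d) \<times> real). sgd \<sigma> \<alpha> N (fst q) (snd q) k"
  note c = continuous_on_compose2[OF \<sigma>(1) _ subset_UNIV] continuous_on_compose2[OF \<sigma>(2) _ subset_UNIV]
  have z: "continuous_on UNIV (\<lambda>q. snd q k)" for q :: "(nat \<Rightarrow> 'd param) \<times> (nat \<Rightarrow> (real^'d) \<times> real)"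
    by (rule continuous_on_compose2[OF continuous_on_product_coordinates[of k] continuous_on_snd[OF continuous_on_id]]) simp
  have f: "continuous_on UNIV (\<lambda>q. network \<sigma> N (?p q) (fst (snd q k)))"
    unfolding network_def by (intro continuous_intros c Suc.IH z)
  define r where "r q = (\<alpha> / N) / sqrt N * (snd (snd q k) - network \<sigma> N (?p q) (fst (snd q k)))" for q
  have r: "continuous_on UNIV r" unfolding r_def by (intro continuous_intros f z)
  have "(\<lambda>q. sgd \<sigma> \<alpha> N (fst q) (snd q) (Suc k) i) = (\<lambda>q. (fst (?p q i) + r q * \<sigma> (snd (?p q i) \<bullet> fst (snd q k)),
     snd (?p q i) + (r q * fst (?p q i) * deriv \<sigma> (snd (?p q i) \<bullet> fst (snd q k))) *\<^sub>R fst (snd q k)))"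
    by (auto simp: r_def Let_def split: prod.split)
  moreover have "continuous_on UNIV \<dots>" by (intro continuous_intros c Suc.IH z r)
  ultimately show ?case by (simp only:)
qed

lemma continuous_network:
  assumes "continuous_on UNIV \<sigma>" "\<And>i. i \<in> {1..N} \<Longrightarrow> continuous_on UNIV (\<lambda>q. p q i)"
  shows "continuous_on UNIV (\<lambda>q. network \<sigma> N (p q) x)"
  unfolding network_def
  by (intro continuous_intros continuous_on_compose2[OF assms(1) _ subset_UNIV] assms(2))

text \<open>The grid of jump times is the same for all inputs, so no time change is involved and
  only the finitely many states up to \<open>N * T\<close> have to vary continuously. Measurability
  into the Skorokhod space follows from this continuity.\<close>

lemma continuous_map_sgd_path:
  fixes X :: "'m::finite \<Rightarrow> real^'d::finite" and \<sigma> :: "real \<Rightarrow> real"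
  assumes \<sigma>: "continuous_on UNIV \<sigma>" "continuous_on UNIV (deriv \<sigma>)" and N: "N \<ge> 1"
  shows "continuous_map euclidean (skorokhod_topology T (state_topology :: ('d param measure \<times> (real^'m)) topology))
    (\<lambda>q. sgd_path \<sigma> \<alpha> T X N (fst q) (snd q))"
proof -
  let ?E = "state_topology :: ('d param measure \<times> (real^'m)) topology"
  obtain m where m: "mtopology_of m = ?E" using metrizable_state_topology by blast
  define f where "f q k = (let p = sgd \<sigma> \<alpha> N (fst q) (snd q) k in
     (empirical {1..N} p, \<chi> i. network \<sigma> N p (X i)))" for q k
  have f: "continuous_map euclidean ?E (\<lambda>q. f q k)" for k
    unfolding f_def Let_def
  proof (rule continuous_map_pairedI)
    show "continuous_map euclidean weak_topology (\<lambda>q. empirical {1..N} (sgd \<sigma> \<alpha> N (fst q) (snd q) k :: nat \<Rightarrow> 'd param))"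
      by (intro continuous_map_empirical N continuous_sgd \<sigma>)
    show "continuous_map euclidean euclidean (\<lambda>q. \<chi> i. network \<sigma> N (sgd \<sigma> \<alpha> N (fst q) (snd q) k) (X i))"
      unfolding continuous_map_iff_continuous2
      by (intro continuous_on_vec_lambda continuous_network continuous_sgd \<sigma>)
  qed
  have sp: "f q k \<in> mspace m" for q k
    using continuous_map_image_subset_topspace[OF f[of k]] m by (metis image_subset_iff topspace_euclidean UNIV_I topspace_mtopology_of)
  have path: "sgd_path \<sigma> \<alpha> T X N (fst q) (snd q) = (\<lambda>t\<in>{0..T}. f q (nat \<lfloor>real N * t\<rfloor>))" for q
    by (simp add: sgd_path_def f_def)
  show ?thesis unfolding path
  proof (rule continuous_map_into_skorokhod[OF m])
    show "(\<lambda>t\<in>{0..T}. f q (nat \<lfloor>real N * t\<rfloor>)) \<in> cadlag_paths T ?E" for q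
      using sp[of q] m by (intro cadlag_paths_step N) (metis topspace_mtopology_of)
    fix q and r :: real assume r: "r > 0"
    let ?V = "\<Inter>k\<in>{..nat \<lfloor>real N * T\<rfloor>}. {q'. f q' k \<in> {y \<in> mspace m. mdist m (f q k) y < r}}"
    have "open {q'. f q' k \<in> {y \<in> mspace m. mdist m (f q k) y < r}}" for k
      using openin_continuous_map_preimage[OF f[of k], of "{y \<in> mspace m. mdist m (f q k) y < r}"] openin_mball[OF sp[of q k]] m
      by simp
    then have "open ?V" by (intro open_INT) auto
    moreover have "q \<in> ?V" using sp r by (auto simp: mdist_self)
    moreover have "\<forall>q'\<in>?V. \<forall>t\<in>{0..T}. mdist m ((\<lambda>t\<in>{0..T}. f q (nat \<lfloor>real N * t\<rfloor>)) t) ((\<lambda>t\<in>{0..T}. f q' (nat \<lfloor>real N * t\<rfloor>)) t) < r"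
    proof (intro ballI)
      fix q' t assume q': "q' \<in> ?V" and t: "t \<in> {0..T}"
      have "nat \<lfloor>real N * t\<rfloor> \<le> nat \<lfloor>real N * T\<rfloor>" using t by (intro nat_mono floor_mono mult_left_mono) auto
      then have "nat \<lfloor>real N * t\<rfloor> \<in> {..nat \<lfloor>real N * T\<rfloor>}" by simp
      with q' have "mdist m (f q (nat \<lfloor>real N * t\<rfloor>)) (f q' (nat \<lfloor>real N * t\<rfloor>)) < r" by blast
      then show "mdist m ((\<lambda>t\<in>{0..T}. f q (nat \<lfloor>real N * t\<rfloor>)) t) ((\<lambda>t\<in>{0..T}. f q' (nat \<lfloor>real N * t\<rfloor>)) t) < r"
        using t by simp
    qed
    ultimately show "\<exists>V. open V \<and> q \<in> V \<and> (\<forall>q'\<in>V. \<forall>t\<in>{0..T}. mdist m ((\<lambda>t\<in>{0..T}. f q (nat \<lfloor>real N * t\<rfloor>)) t) ((\<lambda>t\<in>{0..T}. f q' (nat \<lfloor>real N * t\<rfloor>)) t) < r)"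
      by blast
  qed
qed

section \<open>Borel measurability for abstract topologies\<close>

lemma sets_borel_of: "sets (borel_of S) = sigma_sets (topspace S) {U. openin S U}"
  unfolding borel_of_def by (intro sets_measure_of) (auto dest: openin_subset)

lemma space_borel_of: "space (borel_of S) = topspace S"
  unfolding borel_of_def by (intro space_measure_of) (auto dest: openin_subset)

lemma openin_in_borel_of: "openin S U \<Longrightarrow> U \<in> sets (borel_of S)"
  unfolding sets_borel_of by (intro sigma_sets.Basic) simp

lemma measurable_into_borel_of:
  assumes "f \<in> space M \<rightarrow> topspace S" "\<And>U. openin S U \<Longrightarrow> f -` U \<inter> space M \<in> sets M"
  shows "f \<in> M \<rightarrow>\<^sub>M borel_of S"
  unfolding borel_of_def using assms
  by (intro measurable_measure_of) (auto dest: openin_subset)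

lemma continuous_map_measurable_borel_of:
  fixes f :: "'a::topological_space \<Rightarrow> 'b"
  assumes "continuous_map euclidean S f"
  shows "f \<in> borel \<rightarrow>\<^sub>M borel_of S"
proof (rule measurable_into_borel_of)
  show "f \<in> space borel \<rightarrow> topspace S" using continuous_map_image_subset_topspace[OF assms] by auto
  fix U assume "openin S U"
  then have "open {x. f x \<in> U}" using openin_continuous_map_preimage[OF assms, of U] by simp
  then show "f -` U \<inter> space borel \<in> sets borel" by (simp add: vimage_def)
qed

lemma continuous_map_borel_measurable:
  fixes f :: "'b \<Rightarrow> 'a::topological_space"
  assumes "continuous_map S euclidean f"
  shows "f \<in> borel_measurable (borel_of S)"
proof (rule borel_measurableI)
  fix U :: "'a set" assume "open U"
  then have "openin S {x \<in> topspace S. f x \<in> U}" using openin_continuous_map_preimage[OF assms, of U] by simp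
  then show "f -` U \<inter> space (borel_of S) \<in> sets (borel_of S)"
    by (intro openin_in_borel_of) (simp add: space_borel_of vimage_def Int_def conj_commute)
qed

section \<open>The limit path as a function of its starting value\<close>

definition limit_path :: "real \<Rightarrow> 'd::finite param measure \<Rightarrow> real^'m^'m::finite \<Rightarrow> real^'m \<Rightarrow> real^'m \<Rightarrow>
    real \<Rightarrow> 'd param measure \<times> (real^'m)" where
  "limit_path T \<mu> A y g = (\<lambda>t\<in>{0..T}. (\<mu>, relax A y g t))"

context
  fixes \<mu> :: "'d::finite param measure" and A :: "real^'m^'m::finite" and y :: "real^'m" and T :: real
  assumes \<mu>: "\<mu> \<in> space (prob_algebra borel)" and T: "T > 0"
begin

lemma limit_path_continuous: "continuous_map euclidean state_topology (\<lambda>t. (\<mu>, relax A y g t))"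
proof (rule continuous_map_pairedI)
  show "continuous_map euclidean weak_topology (\<lambda>t :: real. \<mu>)"
    using \<mu> by (simp add: topspace_weak_topology)
  show "continuous_map euclidean euclidean (relax A y g)"
    unfolding continuous_map_iff_continuous2 by (rule relax_continuous)
qed

lemma limit_path_cadlag: "limit_path T \<mu> A y g \<in> cadlag_paths T state_topology"
  unfolding limit_path_def by (rule cadlag_paths_continuous(1)[OF limit_path_continuous])

text \<open>The outputs along one limit path form a compact set, so
  \<open>state_uniform_nbhd\<close> turns the Lipschitz bound in the starting value into closeness
  for an arbitrary metric \<open>m\<close>.\<close>

lemma limit_path_uniform:
  fixes g :: "real^'m"
  assumes m: "mtopology_of m = (state_topology :: ('d param measure \<times> (real^'m)) topology)" and r: "r > 0"
  shows "\<exists>d>0. \<forall>g'. dist g' g < d \<longrightarrow> (\<forall>t\<in>{0..T}. mdist m (limit_path T \<mu> A y g t) (limit_path T \<mu> A y g' t) < r)"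
proof -
  obtain c where c: "c > 0" "\<And>g g' t. t \<in> {0..T} \<Longrightarrow> norm (relax A y g t - relax A y g' t) \<le> c * norm (g - g')"
    by (rule relax_lipschitz_initial[of T A y]) blast
  have "compact (relax A y g ` {0..T})" by (intro compact_continuous_image relax_continuous) simp
  from state_uniform_nbhd[OF m \<mu> this r] obtain Fs e where e: "test_family Fs" "e > 0"
    "\<And>\<nu> h h'. \<nu> \<in> weak_ball \<mu> Fs e \<Longrightarrow> h \<in> relax A y g ` {0..T} \<Longrightarrow> dist h' h < e \<Longrightarrow> mdist m (\<mu>, h) (\<nu>, h') < r"
    by blast
  have "\<mu> \<in> weak_ball \<mu> Fs e" using \<mu> e(2) by (simp add: weak_ball_def)
  note e3 = e(3)[OF this]
  show ?thesis
  proof (intro exI[of _ "e / c"] conjI allI impI ballI)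
    show "e / c > 0" using e c by simp
    fix g' t assume g': "dist g' g < e / c" and t: "t \<in> {0..T}"
    have "dist (relax A y g' t) (relax A y g t) \<le> c * norm (g' - g)" using c(2)[OF t, of g' g] by (simp add: dist_norm)
    also have "\<dots> < e" using g' c by (simp add: dist_norm field_simps)
    finally show "mdist m (limit_path T \<mu> A y g t) (limit_path T \<mu> A y g' t) < r"
      using e3[of "relax A y g t" "relax A y g' t"] t by (simp add: limit_path_def)
  qed
qed

lemma limit_path_continuous_map: "continuous_map euclidean (skorokhod_topology T state_topology) (limit_path T \<mu> A y)"
proof -
  obtain m where m: "mtopology_of m = (state_topology :: ('d param measure \<times> (real^'m)) topology)"
    using metrizable_state_topology by blast
  show ?thesis
  proof (rule continuous_map_into_skorokhod[OF m])
    fix g and r :: real assume "r > 0"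
    from limit_path_uniform[OF m this, of g] obtain d where
      "d > 0" "\<forall>g'. dist g' g < d \<longrightarrow> (\<forall>t\<in>{0..T}. mdist m (limit_path T \<mu> A y g t) (limit_path T \<mu> A y g' t) < r)" by blast
    then show "\<exists>V. open V \<and> g \<in> V \<and> (\<forall>g'\<in>V. \<forall>t\<in>{0..T}. mdist m (limit_path T \<mu> A y g t) (limit_path T \<mu> A y g' t) < r)"
      by (intro exI[of _ "ball g d"]) (auto simp: dist_commute)
  qed (rule limit_path_cadlag)
qed

lemma limit_path_at_0: "limit_path T \<mu> A y g 0 = (\<mu>, g)"
  using T by (simp add: limit_path_def relax_0)

text \<open>Makes the range of the limit map closed and thus Borel, so that properties of its
  members can be asserted almost surely. The starting value is recovered by \<open>snd\<close> at
  time 0.\<close>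

lemma openin_compl_limit_path:
  "openin (skorokhod_topology T state_topology) (cadlag_paths T state_topology - range (limit_path T \<mu> A y))"
proof (rule openin_skorokhod_compl_range[where e = snd])
  show "limitin state_topology (limit_path T \<mu> A y g) (limit_path T \<mu> A y g t) (at t within {0..T})"
    if "t \<in> {0..T}" for g t
    unfolding limit_path_def by (rule cadlag_paths_continuous(2)[OF limit_path_continuous that])
qed (use T limit_path_cadlag limit_path_uniform in \<open>auto simp: limit_path_at_0 continuous_map_snd\<close>)

text \<open>Compactness of \<open>K\<close> replaces the missing uniform continuity of \<open>F\<close>.\<close>

lemma limit_path_compact_uniform:
  fixes K :: "(real^'m) set"
  assumes m: "mtopology_of m = (state_topology :: ('d param measure \<times> (real^'m)) topology)"
    and F: "continuous_map (skorokhod_topology T state_topology) euclideanreal F" and K: "compact K" and e: "e > 0"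
  shows "\<exists>d>0. \<forall>g\<in>K. \<forall>\<omega>\<in>cadlag_paths T state_topology.
    (\<forall>t\<in>{0..T}. mdist m (limit_path T \<mu> A y g t) (\<omega> t) < d) \<longrightarrow> \<bar>F (limit_path T \<mu> A y g) - F \<omega>\<bar> < e"
proof -
  let ?H = "limit_path T \<mu> A y" and ?D = "skorokhod_topology T (state_topology :: ('d param measure \<times> (real^'m)) topology)"
  have sp: "\<omega> t \<in> mspace m" if "t \<in> {0..T}" "\<omega> \<in> cadlag_paths T state_topology" for t \<omega>
    using cadlag_paths_in_space[OF that(2,1)] m by (metis topspace_mtopology_of)
  have "\<exists>r>0. \<forall>\<omega>\<in>cadlag_paths T state_topology. (\<forall>t\<in>{0..T}. mdist m (?H g t) (\<omega> t) < r) \<longrightarrow> \<bar>F (?H g) - F \<omega>\<bar> < e / 2" for g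
  proof -
    have op: "openin ?D {\<omega> \<in> topspace ?D. F \<omega> \<in> ball (F (?H g)) (e / 2)}"
      using F by (intro openin_continuous_map_preimage) auto
    have mem: "?H g \<in> {\<omega> \<in> topspace ?D. F \<omega> \<in> ball (F (?H g)) (e / 2)}"
      using e limit_path_cadlag by (simp add: topspace_skorokhod_topology)
    obtain r where r: "r > 0" "\<And>\<omega>'. \<omega>' \<in> cadlag_paths T state_topology \<Longrightarrow>
        (\<And>t. t \<in> {0..T} \<Longrightarrow> mdist m (?H g t) (\<omega>' t) < r) \<Longrightarrow> \<omega>' \<in> {\<omega> \<in> topspace ?D. F \<omega> \<in> ball (F (?H g)) (e / 2)}"
      by (rule openin_skorokhod_uniform_ball[OF op m mem]) blast
    show ?thesis
    proof (intro exI[of _ r] conjI ballI impI r(1))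
      fix \<omega> assume "\<omega> \<in> cadlag_paths T state_topology" "\<forall>t\<in>{0..T}. mdist m (?H g t) (\<omega> t) < r"
      then have "\<omega> \<in> {\<omega> \<in> topspace ?D. F \<omega> \<in> ball (F (?H g)) (e / 2)}" by (intro r(2)) auto
      then show "\<bar>F (?H g) - F \<omega>\<bar> < e / 2" by (simp add: dist_real_def)
    qed
  qed
  then have "\<forall>g. \<exists>r. r > 0 \<and> (\<forall>\<omega>\<in>cadlag_paths T state_topology. (\<forall>t\<in>{0..T}. mdist m (?H g t) (\<omega> t) < r) \<longrightarrow> \<bar>F (?H g) - F \<omega>\<bar> < e / 2)"
    by blast
  from choice[OF this] obtain r where r': "\<forall>g. r g > 0 \<and> (\<forall>\<omega>\<in>cadlag_paths T state_topology. (\<forall>t\<in>{0..T}. mdist m (?H g t) (\<omega> t) < r g) \<longrightarrow> \<bar>F (?H g) - F \<omega>\<bar> < e / 2)"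
    by blast
  have r: "r g > 0" "\<omega> \<in> cadlag_paths T state_topology \<Longrightarrow>
      (\<forall>t\<in>{0..T}. mdist m (?H g t) (\<omega> t) < r g) \<Longrightarrow> \<bar>F (?H g) - F \<omega>\<bar> < e / 2" for g \<omega>
    using r' by blast+
  have "\<exists>d>0. \<forall>g'. dist g' g < d \<longrightarrow> (\<forall>t\<in>{0..T}. mdist m (?H g t) (?H g' t) < r g / 2)" for g
    using limit_path_uniform[OF m, of "r g / 2" g] r(1)[of g] by simp
  then have "\<forall>g. \<exists>d. d > 0 \<and> (\<forall>g'. dist g' g < d \<longrightarrow> (\<forall>t\<in>{0..T}. mdist m (?H g t) (?H g' t) < r g / 2))"
    by blast
  from choice[OF this] obtain d where d': "\<forall>g. d g > 0 \<and> (\<forall>g'. dist g' g < d g \<longrightarrow> (\<forall>t\<in>{0..T}. mdist m (?H g t) (?H g' t) < r g / 2))"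
    by blast
  have d: "d g > 0" "dist g' g < d g \<Longrightarrow> t \<in> {0..T} \<Longrightarrow> mdist m (?H g t) (?H g' t) < r g / 2" for g g' t
    using d' by blast+
  obtain C where C: "C \<subseteq> K" "finite C" "K \<subseteq> (\<Union>g\<in>C. ball g (d g))"
  proof (rule compactE_image[OF K, of K "\<lambda>g. ball g (d g)"])
    show "K \<subseteq> (\<Union>g\<in>K. ball g (d g))" using d(1) by auto
  qed auto
  \<comment> \<open>Half of \<open>r g\<close>, since the other half is spent on moving from a
    centre of the cover to the given point of \<open>K\<close>.\<close>
  define \<delta> where "\<delta> = Min (insert 1 ((\<lambda>g. r g / 2) ` C))"
  have \<delta>: "\<delta> > 0" "\<And>g. g \<in> C \<Longrightarrow> \<delta> \<le> r g / 2"
  proof -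
    show "\<delta> > 0" using C(2) r(1) by (simp add: \<delta>_def)
    show "\<delta> \<le> r g / 2" if "g \<in> C" for g
      unfolding \<delta>_def by (rule Min_le) (use C(2) that in auto)
  qed
  show ?thesis
  proof (intro exI[of _ \<delta>] conjI ballI impI \<delta>(1))
    fix g \<omega> assume g: "g \<in> K" and w: "\<omega> \<in> cadlag_paths T state_topology"
      and close: "\<forall>t\<in>{0..T}. mdist m (?H g t) (\<omega> t) < \<delta>"
    obtain c where c: "c \<in> C" "dist g c < d c" using C(3) g by (auto simp: dist_commute)
    have rc: "mdist m (?H c t) (?H g t) < r c / 2" if "t \<in> {0..T}" for t using d(2)[OF c(2) that] .
    have "mdist m (?H c t) (\<omega> t) < r c" if t: "t \<in> {0..T}" for t
    proof -
      have "mdist m (?H c t) (\<omega> t) \<le> mdist m (?H c t) (?H g t) + mdist m (?H g t) (\<omega> t)"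
        using limit_path_cadlag w t by (intro mdist_triangle sp)
      then show ?thesis using rc[OF t] close t \<delta>(2)[OF c(1)] by force
    qed
    then have 1: "\<bar>F (?H c) - F \<omega>\<bar> < e / 2" using w by (intro r(2)) auto
    have "mdist m (?H c t) (?H g t) < r c" if t: "t \<in> {0..T}" for t
      using rc[OF t] r(1)[of c] by linarith
    then have 2: "\<bar>F (?H c) - F (?H g)\<bar> < e / 2" using limit_path_cadlag by (intro r(2)) auto
    from 1 2 show "\<bar>F (?H g) - F \<omega>\<bar> < e" by linarith
  qed
qed

end

section \<open>The good event has high probability\<close>

text \<open>Hoeffding's inequality for summands in \<open>[-b, b]\<close>, an interval of length
  \<open>2 * b\<close>.\<close>

lemma (in prob_space) iid_sum_deviation:
  fixes \<phi> :: "'b::topological_space \<Rightarrow> real" and b s :: real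
  assumes I: "finite I" "I \<noteq> {}" and indep: "indep_vars (\<lambda>_. borel) X I"
    and law: "\<And>i. i \<in> I \<Longrightarrow> distr M borel (X i) = \<mu>"
    and \<phi>: "\<phi> \<in> borel_measurable borel" "AE x in \<mu>. \<bar>\<phi> x\<bar> \<le> b" and b: "b > 0" and s: "s \<ge> 0"
  shows "prob {\<omega> \<in> space M. s \<le> \<bar>(\<Sum>i\<in>I. \<phi> (X i \<omega>)) - card I * (\<integral>x. \<phi> x \<partial>\<mu>)\<bar>} \<le> 2 * exp (- (s\<^sup>2 / (2 * card I * b\<^sup>2)))"
proof -
  have X: "X i \<in> borel_measurable M" if "i \<in> I" for i using indep that unfolding indep_vars_def by blast
  have ind: "indep_vars (\<lambda>_. borel) (\<lambda>i \<omega>. \<phi> (X i \<omega>)) I"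
    using indep_vars_compose2[OF indep, of "\<lambda>_. \<phi>" "\<lambda>_. borel"] \<phi> by simp
  have ae: "AE \<omega> in M. \<phi> (X i \<omega>) \<in> {- b..b}" if i: "i \<in> I" for i
  proof -
    have "AE x in distr M borel (X i). \<bar>\<phi> x\<bar> \<le> b" unfolding law[OF i] by (rule \<phi>(2))
    then have "AE \<omega> in M. \<bar>\<phi> (X i \<omega>)\<bar> \<le> b" by (rule AE_distrD[OF X[OF i]])
    then show ?thesis by eventually_elim (auto simp: abs_le_iff)
  qed
  interpret Hoeffding_ineq M I "\<lambda>i \<omega>. \<phi> (X i \<omega>)" "\<lambda>_. - b" "\<lambda>_. b" "\<Sum>i\<in>I. expectation (\<lambda>\<omega>. \<phi> (X i \<omega>))"
    by unfold_locales (use I ind ae in auto)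
  have "expectation (\<lambda>\<omega>. \<phi> (X i \<omega>)) = (\<integral>x. \<phi> x \<partial>\<mu>)" if "i \<in> I" for i
    using integral_distr[OF X[OF that] \<phi>(1)] law[OF that] by simp
  then have mean: "(\<Sum>i\<in>I. expectation (\<lambda>\<omega>. \<phi> (X i \<omega>))) = card I * (\<integral>x. \<phi> x \<partial>\<mu>)" by simp
  have "card I > 0" using I by (simp add: card_gt_0_iff)
  then have "prob {\<omega> \<in> space M. s \<le> \<bar>(\<Sum>i\<in>I. \<phi> (X i \<omega>)) - (\<Sum>i\<in>I. expectation (\<lambda>\<omega>. \<phi> (X i \<omega>)))\<bar>}
      \<le> 2 * exp (- 2 * s\<^sup>2 / (\<Sum>i\<in>I. (b - - b)\<^sup>2))"
    using b s by (intro Hoeffding_ineq_abs_ge) auto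
  also have "- 2 * s\<^sup>2 / (\<Sum>i\<in>I. (b - - b)\<^sup>2) = - (s\<^sup>2 / (2 * card I * b\<^sup>2))"
    using b \<open>card I > 0\<close> by (simp add: power2_eq_square field_simps)
  finally show ?thesis unfolding mean .
qed

text \<open>The linear factor accommodates a union bound over the times up to
  \<open>N * T\<close>.\<close>

lemma linear_times_exp_tendsto_0:
  fixes c d T :: real assumes "c > 0"
  shows "(\<lambda>N. (real N * T + d) * exp (- (c * real N))) \<longlonglongrightarrow> 0"
proof -
  have 1: "filterlim (\<lambda>N. c * real N) at_top sequentially"
    by (rule filterlim_tendsto_pos_mult_at_top[OF tendsto_const assms filterlim_real_sequentially])
  have "((\<lambda>x :: real. x ^ k / exp x) \<longlongrightarrow> 0) at_top" for k :: nat by (rule tendsto_power_div_exp_0)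
  from filterlim_compose[OF this 1] have 2: "(\<lambda>N. (c * real N) ^ k / exp (c * real N)) \<longlonglongrightarrow> 0" for k .
  have "(\<lambda>N. T / c * ((c * real N) ^ 1 / exp (c * real N)) + d * ((c * real N) ^ 0 / exp (c * real N))) \<longlonglongrightarrow> T / c * 0 + d * 0"
    by (intro tendsto_intros 2)
  moreover have "T / c * ((c * real N) ^ 1 / exp (c * real N)) + d * ((c * real N) ^ 0 / exp (c * real N)) = (real N * T + d) * exp (- (c * real N))" for N
    using assms by (simp add: exp_minus field_simps)
  ultimately show ?thesis by simp
qed

lemma AE_empirical_range:
  fixes f :: "'i::finite \<Rightarrow> 'a::t1_space"
  shows "AE q in empirical UNIV f. q \<in> range f"
proof -
  have "range f \<in> sets borel" by (intro borel_closed finite_imp_closed) simp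
  then have "{q \<in> space borel. q \<in> range f} \<in> sets borel" by simp
  moreover have "f \<in> uniform_count_measure UNIV \<rightarrow>\<^sub>M borel" by (auto simp: measurable_def space_uniform_count_measure sets_uniform_count_measure)
  ultimately show ?thesis unfolding empirical_def by (subst AE_distr_iff) auto
qed

lemma sample_weight_measurable:
  fixes X :: "'m::finite \<Rightarrow> 'a::t1_space" and Y :: "'m \<Rightarrow> 'b::t1_space"
  shows "sample_weight X Y j \<in> borel_measurable borel"
proof -
  have "{(X j, Y j)} \<in> sets borel" by (intro borel_closed) simp
  then have "{q \<in> space borel. q = (X j, Y j)} \<in> sets borel" by simp
  then show ?thesis unfolding sample_weight_def[abs_def] by (intro measurable_If) auto
qed

lemma sample_weight_bounds: "0 \<le> sample_weight X Y j q" "sample_weight X Y j q \<le> 1"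
  by (auto simp: sample_weight_def divide_le_eq_1 Suc_le_eq)

text \<open>A data point that occurs \<open>n\<close> times among \<open>M\<close> has mass
  \<open>n / M\<close>, which cancels against its weight \<open>1 / n\<close>.\<close>

lemma integral_sample_weight:
  fixes X :: "'m::finite \<Rightarrow> 'a::t1_space" and Y :: "'m \<Rightarrow> 'b::t1_space"
  shows "(\<integral>q. sample_weight X Y j q \<partial>empirical UNIV (\<lambda>j. (X j, Y j))) = 1 / CARD('m)"
proof -
  define I where "I = {i. (X i, Y i) = (X j, Y j)}"
  have "j \<in> I" by (simp add: I_def)
  then have c: "card I > 0" by (metis card_gt_0_iff empty_iff finite)
  have "sample_weight X Y j (X i, Y i) = (if i \<in> I then 1 / card I else 0)" for i
    by (auto simp: sample_weight_def I_def)
  then have "(\<Sum>i\<in>UNIV. sample_weight X Y j (X i, Y i)) = (\<Sum>i\<in>I. 1 / card I)"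
    by (simp add: sum.If_cases)
  also have "\<dots> = 1" using c \<open>j \<in> I\<close> by auto
  finally show ?thesis by (subst integral_empirical[OF _ _ sample_weight_measurable]) auto
qed

text \<open>Outside a large ball \<open>f\<close> need not be uniformly continuous, but few parameters lie there.\<close>

lemma test_function_shift:
  fixes f :: "'a::euclidean_space \<Rightarrow> real"
  assumes f: "continuous_on UNIV f" "bounded (range f)" and e: "e > 0"
    and \<mu>: "prob_space \<mu>" "sets \<mu> = sets borel"
  obtains \<rho> \<delta> \<eta> where "\<delta> > 0" "\<eta> > 0"
    "\<And>N p p'. N \<ge> (1::nat) \<Longrightarrow> (\<And>i. i \<in> {1..N} \<Longrightarrow> dist (p i) (p' i) < \<delta>) \<Longrightarrow>
      \<bar>avg N (indicator {x. norm x > \<rho>}) p - (\<integral>x. indicator {x. norm x > \<rho>} x \<partial>\<mu>)\<bar> < \<eta> \<Longrightarrow>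
      \<bar>avg N f p - (\<integral>x. f x \<partial>\<mu>)\<bar> < \<eta> \<Longrightarrow>
      \<bar>avg N f p' - (\<integral>x. f x \<partial>\<mu>)\<bar> < e"
proof -
  interpret prob_space \<mu> by fact
  obtain b0 where b0: "\<And>x. \<bar>f x\<bar> \<le> b0" using f(2) unfolding bounded_iff by auto
  define b where "b = max 1 b0"
  have b: "b \<ge> 1" "\<bar>f x\<bar> \<le> b" for x using b0[of x] by (auto simp: b_def)
  have eb: "e / (16 * b) > 0" using e b by simp
  obtain \<rho> where \<rho>: "\<rho> > 0" "prob {x. norm x > \<rho>} \<le> e / (16 * b)"
    using prob_space_tight[OF \<mu> eb] by blast
  define ind :: "'a \<Rightarrow> real" where "ind = indicator {x. norm x > \<rho>}"
  have ind: "(\<integral>x. ind x \<partial>\<mu>) \<le> e / (16 * b)"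
  proof -
    have "{x :: 'a. norm x > \<rho>} \<in> sets \<mu>" using \<mu>(2) by simp
    then have "(\<integral>x. ind x \<partial>\<mu>) = prob {x. norm x > \<rho>}" by (simp add: ind_def)
    then show ?thesis using \<rho> by simp
  qed
  \<comment> \<open>The radius is \<open>\<rho> + 1\<close> because a parameter in the ball of
    radius \<open>\<rho>\<close> moves by less than 1.\<close>
  have "uniformly_continuous_on (cball 0 (\<rho> + 1)) f"
    by (intro compact_uniformly_continuous continuous_on_subset[OF f(1)]) auto
  moreover have "e / 4 > 0" using e by simp
  ultimately obtain d where d: "d > 0" "\<And>x x'. x \<in> cball 0 (\<rho> + 1) \<Longrightarrow> x' \<in> cball 0 (\<rho> + 1) \<Longrightarrow> dist x' x < d \<Longrightarrow> dist (f x') (f x) < e / 4"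
    by (rule uniformly_continuous_onE) blast
  show ?thesis
  \<comment> \<open>Parameters inside the ball change the average by at most \<open>e / 4\<close>.
    The fraction outside is at most twice \<open>e / (16 * b)\<close>, each costing
    \<open>2 * b\<close>, which is another \<open>e / 4\<close>. With the initial error below
    \<open>e / 4\<close> the total stays below \<open>e\<close>.\<close>
  proof (rule that[of "min d 1" "min (e / 4) (e / (16 * b))" \<rho>], goal_cases)
    case (3 N p p')
    have N: "real N > 0" using 3(1) by simp
    have pt: "\<bar>f (p' i) - f (p i)\<bar> \<le> e / 4 + 2 * b * ind (p i)" if i: "i \<in> {1..N}" for i
    proof (cases "norm (p i) > \<rho>")
      case True
      then show ?thesis using b(2)[of "p i"] b(2)[of "p' i"] e by (simp add: ind_def)
    next
      case False
      have "norm (p' i) \<le> norm (p i) + dist (p i) (p' i)"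
        by (metis dist_commute dist_norm norm_triangle_sub)
      then have "p' i \<in> cball 0 (\<rho> + 1)" "p i \<in> cball 0 (\<rho> + 1)" using 3(2)[OF i] False by auto
      then have "dist (f (p' i)) (f (p i)) < e / 4" using 3(2)[OF i] by (intro d) (auto simp: dist_commute)
      then show ?thesis using False by (simp add: ind_def dist_real_def)
    qed
    have "\<bar>\<Sum>i=1..N. f (p' i) - f (p i)\<bar> \<le> (\<Sum>i=1..N. e / 4 + 2 * b * ind (p i))"
      by (intro order_trans[OF sum_abs] sum_mono pt)
    also have "\<dots> = N * (e / 4) + 2 * b * (\<Sum>i=1..N. ind (p i))" by (simp add: sum.distrib sum_distrib_left)
    finally have "1 / N * \<bar>\<Sum>i=1..N. f (p' i) - f (p i)\<bar> \<le> 1 / N * (N * (e / 4) + 2 * b * (\<Sum>i=1..N. ind (p i)))"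
      by (intro mult_left_mono) auto
    also have "\<dots> = e / 4 + 2 * b * (avg N ind p)" using N by (simp add: field_simps)
    also have "avg N ind p \<le> e / (16 * b) + e / (16 * b)"
      using 3(3) ind unfolding ind_def by linarith
    also have "e / 4 + 2 * b * (e / (16 * b) + e / (16 * b)) = e / 2" using b(1) by (simp add: field_simps)
    finally have "1 / N * \<bar>\<Sum>i=1..N. f (p' i) - f (p i)\<bar> \<le> e / 2" using b(1) by (simp add: mult_left_mono)
    moreover have "1 / N * \<bar>\<Sum>i=1..N. f (p' i) - f (p i)\<bar> = \<bar>avg N f p' - avg N f p\<bar>"
      unfolding right_diff_distrib[symmetric] sum_subtractf[symmetric] abs_mult by simp
    ultimately show ?case using 3(4) e by linarith
  qed (use d e eb in auto)
qed

text \<open>\<open>mean_0\<close> is the form in which the centering of \<open>c\<close> and its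
  independence of \<open>w\<close> are used. It centers the initial output, which the factor
  \<open>1 / sqrt N\<close> alone would not keep bounded.\<close>

locale sgd_convergence = network_data \<sigma> \<alpha> T X Y S D B
  for \<sigma> \<alpha> T and X :: "'m::finite \<Rightarrow> real^'d::finite" and Y S D B +
  fixes \<mu>\<^sub>0 :: "'d param measure" and P :: "nat \<Rightarrow> 'a measure"
    and p\<^sub>0 :: "nat \<Rightarrow> nat \<Rightarrow> 'a \<Rightarrow> 'd param" and z :: "nat \<Rightarrow> nat \<Rightarrow> 'a \<Rightarrow> (real^'d) \<times> real"
  assumes \<mu>0: "prob_space \<mu>\<^sub>0" "sets \<mu>\<^sub>0 = sets borel"
    and \<sigma>_cont: "continuous_on UNIV \<sigma>" "continuous_on UNIV (deriv \<sigma>)"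
    and bounded_c: "AE q in \<mu>\<^sub>0. \<bar>fst q\<bar> \<le> B"
    and mean_0: "\<And>x. (\<integral>q. fst q * \<sigma> (snd q \<bullet> x) \<partial>\<mu>\<^sub>0) = 0"
    and inputs: "\<And>N. N \<ge> 1 \<Longrightarrow> sgd_inputs (P N) N \<mu>\<^sub>0 (empirical UNIV (\<lambda>j. (X j, Y j))) (p\<^sub>0 N) (z N)"
begin

sublocale M0: prob_space \<mu>\<^sub>0 by (rule \<mu>0)

abbreviation "p0_at N \<omega> \<equiv> \<lambda>i. p\<^sub>0 N i \<omega>"
abbreviation "z_at N \<omega> \<equiv> \<lambda>k. z N k \<omega>"

section \<open>Laws of large numbers and tightness of the initial output\<close>

lemma input:
  assumes "N \<ge> 1"
  shows "prob_space (P N)" "prob_space.indep_vars (P N) (\<lambda>_. borel) (p\<^sub>0 N) {1..N}"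
    "\<And>i. i \<in> {1..N} \<Longrightarrow> distr (P N) borel (p\<^sub>0 N i) = \<mu>\<^sub>0"
    "prob_space.indep_vars (P N) (\<lambda>_. borel) (z N) UNIV"
    "\<And>k. distr (P N) borel (z N k) = empirical UNIV (\<lambda>j. (X j, Y j))"
  using inputs[OF assms] unfolding sgd_inputs_def by auto

lemma p0_measurable:
  assumes "N \<ge> 1" "i \<in> {1..N}" shows "p\<^sub>0 N i \<in> borel_measurable (P N)"
  using input(2)[OF assms(1)] assms(2) unfolding prob_space.indep_vars_def[OF input(1)[OF assms(1)]] by blast

lemma z_measurable:
  assumes "N \<ge> 1" shows "z N k \<in> borel_measurable (P N)"
  using input(4)[OF assms] unfolding prob_space.indep_vars_def[OF input(1)[OF assms]] by blast

lemma average_measurable: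
  fixes \<phi> :: "'d param \<Rightarrow> real"
  assumes "N \<ge> 1" "\<phi> \<in> borel_measurable borel"
  shows "(\<lambda>\<omega>. \<Sum>i=1..N. \<phi> (p\<^sub>0 N i \<omega>)) \<in> borel_measurable (P N)"
  using p0_measurable[OF assms(1)] assms(2) by (intro borel_measurable_sum measurable_compose[OF _ assms(2)]) auto

lemma activation_measurable: "(\<lambda>q :: 'd param. \<sigma> (snd q \<bullet> x)) \<in> borel_measurable borel"
  "(\<lambda>q :: 'd param. deriv \<sigma> (snd q \<bullet> x)) \<in> borel_measurable borel"
  by (auto intro!: borel_measurable_continuous_onI continuous_on_compose2[OF \<sigma>_cont(1)] continuous_on_compose2[OF \<sigma>_cont(2)] continuous_intros)

lemma neuron_measurable: "(\<lambda>q :: 'd param. fst q * \<sigma> (snd q \<bullet> x)) \<in> borel_measurable borel"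
  by (intro borel_measurable_times activation_measurable borel_measurable_continuous_onI continuous_intros)

lemma tangent_kernel_measurable:
  fixes x x' :: "real^'d"
  shows "tangent_kernel \<sigma> x x' \<in> borel_measurable borel"
proof -
  have "(\<lambda>q :: 'd param. (fst q)\<^sup>2) \<in> borel_measurable borel"
    by (intro borel_measurable_continuous_onI continuous_intros)
  then show ?thesis unfolding tangent_kernel_def[abs_def]
    by (intro borel_measurable_add borel_measurable_times activation_measurable borel_measurable_const)
qed

lemma neuron_bound: "AE q in \<mu>\<^sub>0. \<bar>fst q * \<sigma> (snd q \<bullet> x)\<bar> \<le> B * S"
  using bounded_c by eventually_elim (intro abs_mult_le S)

lemma tangent_kernel_AE_bound: "AE q in \<mu>\<^sub>0. \<bar>tangent_kernel \<sigma> (X i) (X j) q\<bar> \<le> kernel_bound"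
  using bounded_c by eventually_elim (intro tangent_kernel_bound, use pos in linarith)

lemma average_lln:
  fixes \<phi> :: "'d param \<Rightarrow> real"
  assumes \<phi>: "\<phi> \<in> borel_measurable borel" "AE q in \<mu>\<^sub>0. \<bar>\<phi> q\<bar> \<le> b" and \<eta>: "\<eta> > 0"
  shows "(\<lambda>N. measure (P N) {\<omega> \<in> space (P N). \<eta> \<le> \<bar>avg N \<phi> (p0_at N \<omega>) - (\<integral>q. \<phi> q \<partial>\<mu>\<^sub>0)\<bar>}) \<longlonglongrightarrow> 0"
proof -
  define c where "c = max 1 b"
  have c: "c > 0" "AE q in \<mu>\<^sub>0. \<bar>\<phi> q\<bar> \<le> c" using \<phi>(2) by (auto simp: c_def elim: eventually_mono)
  \<comment> \<open>The vanishing linear coefficient brings the bound into the form of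
    \<open>linear_times_exp_tendsto_0\<close>.\<close>
  have le: "measure (P N) {\<omega> \<in> space (P N). \<eta> \<le> \<bar>avg N \<phi> (p0_at N \<omega>) - (\<integral>q. \<phi> q \<partial>\<mu>\<^sub>0)\<bar>}
      \<le> (real N * 0 + 2) * exp (- (\<eta>\<^sup>2 / (2 * c\<^sup>2) * real N))" if N: "N \<ge> 1" for N
  proof -
    interpret prob_space "P N" by (rule input[OF N])
    have N0: "real N > 0" using N by simp
    have "prob {\<omega> \<in> space (P N). \<eta> * N \<le> \<bar>(\<Sum>i=1..N. \<phi> (p\<^sub>0 N i \<omega>)) - card {1..N} * (\<integral>q. \<phi> q \<partial>\<mu>\<^sub>0)\<bar>}
      \<le> 2 * exp (- ((\<eta> * N)\<^sup>2 / (2 * card {1..N} * c\<^sup>2)))"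
      using N \<eta> by (intro iid_sum_deviation input \<phi>(1) c) auto
    also have "\<dots> = (real N * 0 + 2) * exp (- (\<eta>\<^sup>2 / (2 * c\<^sup>2) * real N))"
      using N0 c(1) by (simp add: power2_eq_square field_simps)
    also have "{\<omega> \<in> space (P N). \<eta> * N \<le> \<bar>(\<Sum>i=1..N. \<phi> (p\<^sub>0 N i \<omega>)) - card {1..N} * (\<integral>q. \<phi> q \<partial>\<mu>\<^sub>0)\<bar>}
        = {\<omega> \<in> space (P N). \<eta> \<le> \<bar>avg N \<phi> (p0_at N \<omega>) - (\<integral>q. \<phi> q \<partial>\<mu>\<^sub>0)\<bar>}"
    proof -
      have "\<eta> * N \<le> \<bar>x - N * y\<bar> \<longleftrightarrow> \<eta> \<le> \<bar>1 / N * x - y\<bar>" for x y :: real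
      proof -
        have "x - N * y = (1 / N * x - y) * N" using N0 by (simp add: left_diff_distrib)
        then have "\<bar>x - N * y\<bar> = \<bar>1 / N * x - y\<bar> * N" by (simp add: abs_mult)
        then show ?thesis using N0 by simp
      qed
      then show ?thesis by simp
    qed
    finally show ?thesis .
  qed
  have "\<eta>\<^sup>2 / (2 * c\<^sup>2) > 0" using \<eta> c(1) by simp
  note lim = linear_times_exp_tendsto_0[OF this, of 0 2]
  show ?thesis
    by (rule tendsto_sandwich[OF _ _ tendsto_const lim], simp, rule eventually_sequentiallyI[of 1], erule le)
qed

text \<open>The error at time \<open>k\<close> is normalized by \<open>N\<close>, not by
  \<open>k\<close>, so Hoeffding applies with deviation \<open>\<eta> * N\<close> to
  \<open>k \<le> N * T\<close> summands and gives one exponential rate for all times. The union over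
  times and indices costs a factor linear in \<open>N\<close>.\<close>

lemma sample_lln:
  assumes \<eta>: "\<eta> > 0"
  defines "Bad \<equiv> \<lambda>N. {\<omega> \<in> space (P N). \<exists>k j. real k \<le> N * T \<and>
    \<eta> \<le> \<bar>sampling_error N j k (z_at N \<omega>)\<bar>}"
  shows "\<And>N. N \<ge> 1 \<Longrightarrow> Bad N \<in> sets (P N)" "(\<lambda>N. measure (P N) (Bad N)) \<longlonglongrightarrow> 0"
proof -
  define C where "C N k j = {\<omega> \<in> space (P N). \<eta> \<le> \<bar>sampling_error N j k (z_at N \<omega>)\<bar>}" for N k j
  have C: "C N k j \<in> sets (P N)" if N: "N \<ge> 1" for N k j
  proof -
    have "(\<lambda>\<omega>. sample_weight X Y j (z N l \<omega>)) \<in> borel_measurable (P N)" for l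
      by (rule measurable_compose[OF z_measurable[OF N] sample_weight_measurable])
    then have "(\<lambda>\<omega>. \<bar>sampling_error N j k (z_at N \<omega>)\<bar>) \<in> borel_measurable (P N)"
      by (intro borel_measurable_abs borel_measurable_times borel_measurable_sum borel_measurable_diff) auto
    then show ?thesis unfolding C_def by measurable
  qed
  have Bad: "Bad N = (\<Union>k\<in>{1..nat \<lfloor>N * T\<rfloor>}. \<Union>j\<in>UNIV. C N k j)" for N
  proof -
    have "real k \<le> N * T \<longleftrightarrow> k \<le> nat \<lfloor>N * T\<rfloor>" for k using pos(2) by (simp add: le_nat_floor le_nat_iff le_floor_iff)
    \<comment> \<open>At \<open>k = 0\<close> the sum is empty and the error vanishes; the deviation
      bound is applied to nonempty sums only.\<close>
    moreover have "\<omega> \<notin> C N 0 j" for \<omega> j using \<eta> by (simp add: C_def)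
    then have "\<omega> \<in> C N k j \<Longrightarrow> k \<noteq> 0" for \<omega> k j by metis
    ultimately show ?thesis unfolding Bad_def C_def by (fastforce simp: Suc_le_eq)
  qed
  then show "Bad N \<in> sets (P N)" if "N \<ge> 1" for N
    unfolding Bad using C[OF that] by auto
  have le: "measure (P N) (Bad N) \<le> (real N * (T * (CARD('m) * 2)) + 0) * exp (- (\<eta>\<^sup>2 / (2 * T) * real N))" if N: "N \<ge> 1" for N
  proof -
    interpret prob_space "P N" by (rule input[OF N])
    have N0: "real N > 0" using N by simp
    have "prob (C N k j) \<le> 2 * exp (- (\<eta>\<^sup>2 / (2 * T) * real N))" if k: "k \<in> {1..nat \<lfloor>N * T\<rfloor>}" for k j
    proof -
      have kT: "real k \<le> N * T" using k pos(2) by (simp add: le_nat_floor le_nat_iff le_floor_iff)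
      have k0: "real k > 0" using k by simp
      have "prob {\<omega> \<in> space (P N). \<eta> * N \<le> \<bar>(\<Sum>l<k. sample_weight X Y j (z N l \<omega>)) - card {..<k} * (\<integral>q. sample_weight X Y j q \<partial>empirical UNIV (\<lambda>j. (X j, Y j)))\<bar>}
        \<le> 2 * exp (- ((\<eta> * N)\<^sup>2 / (2 * card {..<k} * (1::real)\<^sup>2)))"
      proof (rule iid_sum_deviation)
        show "indep_vars (\<lambda>_. borel) (z N) {..<k}" by (rule indep_vars_subset[OF input(4)[OF N]]) simp
        show "AE q in empirical UNIV (\<lambda>j. (X j, Y j)). \<bar>sample_weight X Y j q\<bar> \<le> 1"
          using sample_weight_bounds[of X Y j] by (auto simp: abs_le_iff intro: order_trans[OF _ sample_weight_bounds(1)])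
      qed (use k \<eta> input(5)[OF N] in \<open>auto simp: sample_weight_measurable lessThan_empty_iff\<close>)
      also have "\<dots> \<le> 2 * exp (- (\<eta>\<^sup>2 / (2 * T) * real N))"
      proof -
        have "\<eta>\<^sup>2 / (2 * T) * real N = (\<eta> * N)\<^sup>2 / (2 * (N * T))" using N0 pos by (simp add: power2_eq_square)
        also have "\<dots> \<le> (\<eta> * N)\<^sup>2 / (2 * real k)" using kT k0 N0 pos by (intro divide_left_mono) auto
        finally show ?thesis by simp
      qed
      also have "{\<omega> \<in> space (P N). \<eta> * N \<le> \<bar>(\<Sum>l<k. sample_weight X Y j (z N l \<omega>)) - card {..<k} * (\<integral>q. sample_weight X Y j q \<partial>empirical UNIV (\<lambda>j. (X j, Y j)))\<bar>}
          = C N k j"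
      proof -
        have "\<eta> * N \<le> \<bar>x\<bar> \<longleftrightarrow> \<eta> \<le> \<bar>1 / N * x\<bar>" for x using N0 by (simp add: abs_mult field_simps)
        then show ?thesis unfolding C_def integral_sample_weight by (simp add: sum_subtractf)
      qed
      finally show ?thesis .
    qed
    then have "(\<Sum>k\<in>{1..nat \<lfloor>N * T\<rfloor>}. \<Sum>j\<in>UNIV. prob (C N k j)) \<le> (\<Sum>k\<in>{1..nat \<lfloor>N * T\<rfloor>}. \<Sum>j\<in>(UNIV :: 'm set). 2 * exp (- (\<eta>\<^sup>2 / (2 * T) * real N)))"
      by (intro sum_mono)
    also have "\<dots> = real (nat \<lfloor>N * T\<rfloor>) * ((CARD('m) * 2) * exp (- (\<eta>\<^sup>2 / (2 * T) * real N)))" by simp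
    also have "\<dots> \<le> (N * T) * ((CARD('m) * 2) * exp (- (\<eta>\<^sup>2 / (2 * T) * real N)))"
      using pos(2) by (intro mult_right_mono) (auto simp: of_nat_floor)
    also have "\<dots> = (real N * (T * (CARD('m) * 2)) + 0) * exp (- (\<eta>\<^sup>2 / (2 * T) * real N))" by simp
    finally have s: "(\<Sum>k\<in>{1..nat \<lfloor>N * T\<rfloor>}. \<Sum>j\<in>UNIV. prob (C N k j)) \<le> (real N * (T * (CARD('m) * 2)) + 0) * exp (- (\<eta>\<^sup>2 / (2 * T) * real N))" .
    have "prob (Bad N) \<le> (\<Sum>k\<in>{1..nat \<lfloor>N * T\<rfloor>}. prob (\<Union>j\<in>UNIV. C N k j))"
      unfolding Bad using C[OF N] by (intro measure_UNION_le) auto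
    also have "\<dots> \<le> (\<Sum>k\<in>{1..nat \<lfloor>N * T\<rfloor>}. \<Sum>j\<in>UNIV. prob (C N k j))"
      using C[OF N] by (intro sum_mono measure_UNION_le) auto
    finally show ?thesis using s by linarith
  qed
  have "\<eta>\<^sup>2 / (2 * T) > 0" using \<eta> pos by simp
  note lim = linear_times_exp_tendsto_0[OF this, of "T * (CARD('m) * 2)" 0]
  show "(\<lambda>N. measure (P N) (Bad N)) \<longlonglongrightarrow> 0"
    by (rule tendsto_sandwich[OF _ _ tendsto_const lim], simp, rule eventually_sequentiallyI[of 1], erule le)
qed

lemma network_measurable:
  assumes "N \<ge> 1" shows "(\<lambda>\<omega>. network \<sigma> N (p0_at N \<omega>) x) \<in> borel_measurable (P N)"
  unfolding network_def using average_measurable[OF assms neuron_measurable[of x]] by measurable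

text \<open>Hoeffding at scale \<open>sqrt N\<close>: the probability that a centered sum exceeds
  \<open>R * sqrt N\<close> is bounded independently of \<open>N\<close>, so one \<open>R\<close>
  serves every \<open>N\<close>.\<close>

lemma initial_network_tight:
  assumes e: "e > 0"
  obtains R where "R > 0" "\<And>N. N \<ge> 1 \<Longrightarrow> measure (P N) {\<omega> \<in> space (P N). \<exists>j. R < \<bar>network \<sigma> N (p0_at N \<omega>) (X j)\<bar>} \<le> e"
proof -
  let ?b = "B * S" and ?M = "real CARD('m)"
  have b: "?b > 0" using pos by auto
  have "(\<lambda>n. (real n * 0 + ?M * 2) * exp (- (1 / (2 * ?b\<^sup>2) * real n))) \<longlonglongrightarrow> 0"
    using b pos by (intro linear_times_exp_tendsto_0) auto
  then have "\<forall>\<^sub>F n in sequentially. (real n * 0 + ?M * 2) * exp (- (1 / (2 * ?b\<^sup>2) * real n)) < e"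
    using e by (rule order_tendstoD)
  then obtain n where n: "n \<ge> 1" "(real n * 0 + ?M * 2) * exp (- (1 / (2 * ?b\<^sup>2) * real n)) < e"
    using eventually_happens'[OF _ eventually_conj[OF eventually_ge_at_top[of 1]]] by fastforce
  \<comment> \<open>\<open>R\<close> enters the exponent of Hoeffding's bound through its square,
    which becomes \<open>n\<close>.\<close>
  define R where "R = sqrt n"
  have R: "R > 0" "R\<^sup>2 = n" using n(1) by (auto simp: R_def)
  show ?thesis
  proof (rule that[OF R(1)])
    fix N :: nat assume N: "N \<ge> 1"
    interpret prob_space "P N" by (rule input[OF N])
    have N0: "real N > 0" "sqrt N > 0" using N by auto
    define C where "C j = {\<omega> \<in> space (P N). R * sqrt N \<le> \<bar>(\<Sum>i=1..N. fst (p\<^sub>0 N i \<omega>) * \<sigma> (snd (p\<^sub>0 N i \<omega>) \<bullet> X j)) - card {1..N} * (\<integral>q. fst q * \<sigma> (snd q \<bullet> X j) \<partial>\<mu>\<^sub>0)\<bar>}" for j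
    have C: "C j \<in> sets (P N)" for j
      unfolding C_def using average_measurable[OF N neuron_measurable[of "X j"]] by measurable
    have "prob (C j) \<le> 2 * exp (- ((R * sqrt N)\<^sup>2 / (2 * card {1..N} * ?b\<^sup>2)))" for j
      unfolding C_def using N R(1) b
      by (intro iid_sum_deviation[of _ "p\<^sub>0 N" \<mu>\<^sub>0 "\<lambda>q. fst q * \<sigma> (snd q \<bullet> X j)"] input neuron_measurable neuron_bound) auto
    also have "(R * sqrt N)\<^sup>2 / (2 * card {1..N} * ?b\<^sup>2) = 1 / (2 * ?b\<^sup>2) * real n"
      using N0 R(2) b by (simp add: power_mult_distrib field_simps)
    finally have Cp: "prob (C j) \<le> 2 * exp (- (1 / (2 * ?b\<^sup>2) * real n))" for j .
    have "{\<omega> \<in> space (P N). \<exists>j. R < \<bar>network \<sigma> N (p0_at N \<omega>) (X j)\<bar>} \<subseteq> (\<Union>j. C j)"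
    proof
      fix \<omega> assume "\<omega> \<in> {\<omega> \<in> space (P N). \<exists>j. R < \<bar>network \<sigma> N (p0_at N \<omega>) (X j)\<bar>}"
      then obtain j where w: "\<omega> \<in> space (P N)" "R < \<bar>network \<sigma> N (p0_at N \<omega>) (X j)\<bar>" by blast
      then have "R * sqrt N \<le> \<bar>\<Sum>i=1..N. fst (p\<^sub>0 N i \<omega>) * \<sigma> (snd (p\<^sub>0 N i \<omega>) \<bullet> X j)\<bar>"
        using N0 by (simp add: network_def abs_mult field_simps)
      then have "\<omega> \<in> C j" using w(1) by (simp add: C_def mean_0)
      then show "\<omega> \<in> (\<Union>j. C j)" by blast
    qed
    then have "prob {\<omega> \<in> space (P N). \<exists>j. R < \<bar>network \<sigma> N (p0_at N \<omega>) (X j)\<bar>} \<le> prob (\<Union>j. C j)"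
      using C by (intro finite_measure_mono) auto
    also have "\<dots> \<le> (\<Sum>j\<in>UNIV. prob (C j))" using C by (intro measure_UNION_le) auto
    also have "\<dots> \<le> (\<Sum>j\<in>(UNIV :: 'm set). 2 * exp (- (1 / (2 * ?b\<^sup>2) * real n)))" by (intro sum_mono Cp)
    also have "\<dots> \<le> e" using n(2) by (simp add: mult.assoc)
    finally show "prob {\<omega> \<in> space (P N). \<exists>j. R < \<bar>network \<sigma> N (p0_at N \<omega>) (X j)\<bar>} \<le> e" .
  qed
qed

lemma AE_inputs:
  assumes N: "N \<ge> 1"
  shows "AE \<omega> in P N. (\<forall>i\<in>{1..N}. \<bar>fst (p\<^sub>0 N i \<omega>)\<bar> \<le> B) \<and> (\<forall>k. z N k \<omega> \<in> range (\<lambda>j. (X j, Y j)))"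
proof -
  have "AE \<omega> in P N. \<bar>fst (p\<^sub>0 N i \<omega>)\<bar> \<le> B" if i: "i \<in> {1..N}" for i
  proof -
    have "AE q in distr (P N) borel (p\<^sub>0 N i). \<bar>fst q\<bar> \<le> B" unfolding input(3)[OF N i] by (rule bounded_c)
    then show ?thesis by (rule AE_distrD[OF p0_measurable[OF N i]])
  qed
  then have "AE \<omega> in P N. \<forall>i\<in>{1..N}. \<bar>fst (p\<^sub>0 N i \<omega>)\<bar> \<le> B" by (intro AE_finite_allI) auto
  moreover have "AE \<omega> in P N. z N k \<omega> \<in> range (\<lambda>j. (X j, Y j))" for k
  proof -
    have "AE q in distr (P N) borel (z N k). q \<in> range (\<lambda>j. (X j, Y j))" unfolding input(5)[OF N] by (rule AE_empirical_range)
    then show ?thesis by (rule AE_distrD[OF z_measurable[OF N]])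
  qed
  then have "AE \<omega> in P N. \<forall>k. z N k \<omega> \<in> range (\<lambda>j. (X j, Y j))" by (simp add: AE_all_countable)
  ultimately show ?thesis by eventually_elim simp
qed

end

context sgd_convergence
begin

definition limit_kernel :: "'m \<Rightarrow> 'm \<Rightarrow> real" where
  "limit_kernel i j = (\<integral>q. tangent_kernel \<sigma> (X i) (X j) q \<partial>\<mu>\<^sub>0)"

definition limit_matrix :: "real^'m^'m" where
  "limit_matrix = (\<chi> i j. \<alpha> / CARD('m) * limit_kernel i j)"

abbreviation "limit_h \<equiv> relax limit_matrix (\<chi> j. Y j)"

abbreviation "initial_output N \<omega> \<equiv> \<chi> i. network \<sigma> N (p0_at N \<omega>) (X i)"

text \<open>Closeness is expressed by test functions and the Euclidean distance, so that no metric
  of the state space enters.\<close>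

definition stays_close :: "('d param \<Rightarrow> real) set \<Rightarrow> real \<Rightarrow> nat \<Rightarrow> (nat \<Rightarrow> 'd param) \<Rightarrow> (nat \<Rightarrow> (real^'d) \<times> real) \<Rightarrow> bool" where
  "stays_close Fs e N p zs \<longleftrightarrow> (\<forall>t\<in>{0..T}.
    fst (sgd_path \<sigma> \<alpha> T X N p zs t) \<in> weak_ball \<mu>\<^sub>0 Fs e \<and>
    dist (snd (sgd_path \<sigma> \<alpha> T X N p zs t)) (limit_h (\<chi> i. network \<sigma> N p (X i)) t) < e)"

text \<open>\<open>\<Phi>\<close> lists what has to average well: the kernels, which drive the
  output, the test functions themselves, and tail indicators, which limit the share of parameters
  far out, where a test function may vary fast.\<close>

lemma good_event_closeness:
  assumes R: "R > 0" and e: "e > 0" and Fs: "test_family Fs"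
  obtains \<Phi> \<eta> N1 where "finite \<Phi>" "\<And>\<phi>. \<phi> \<in> \<Phi> \<Longrightarrow> \<phi> \<in> borel_measurable borel"
    "\<And>\<phi>. \<phi> \<in> \<Phi> \<Longrightarrow> \<exists>b. AE q in \<mu>\<^sub>0. \<bar>\<phi> q\<bar> \<le> b" "\<eta> > 0" "N1 \<ge> 1"
    "\<And>N p z. N \<ge> N1 \<Longrightarrow> good_inputs N R \<eta> p z \<Longrightarrow>
      (\<And>\<phi>. \<phi> \<in> \<Phi> \<Longrightarrow> \<bar>avg N \<phi> p - (\<integral>q. \<phi> q \<partial>\<mu>\<^sub>0)\<bar> < \<eta>) \<Longrightarrow> stays_close Fs e N p z"
proof -
  let ?M = "real CARD('m)"
  have sym: "X j = X j' \<Longrightarrow> limit_kernel i j = limit_kernel i j'" for i j j' by (simp add: limit_kernel_def)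
  obtain C N0 where C: "C > 0" "N0 \<ge> 1" and close: "\<forall>N\<ge>N0. \<forall>p z \<eta>. good_inputs N R \<eta> p z \<longrightarrow>
    (\<forall>i j. \<bar>avg N (tangent_kernel \<sigma> (X i) (X j)) p - limit_kernel i j\<bar> \<le> \<eta>) \<longrightarrow>
    (\<forall>n. real n \<le> N * T \<longrightarrow>
      norm ((\<chi> i. network \<sigma> N (sgd \<sigma> \<alpha> N p z n) (X i)) - limit_h (\<chi> i. network \<sigma> N p (X i)) (n / N)) \<le> C * (\<eta> + 1 / sqrt N) \<and>
      (\<forall>i\<in>{1..N}. \<bar>fst (sgd \<sigma> \<alpha> N p z n i) - fst (p i)\<bar> \<le> C / sqrt N \<and>
        norm (snd (sgd \<sigma> \<alpha> N p z n i) - snd (p i)) \<le> C / sqrt N))"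
    using sgd_close[where A = limit_kernel and R = R, OF sym less_imp_le[OF R]] unfolding limit_matrix_def by blast
  obtain \<kappa> where \<kappa>: "\<kappa> > 0"
    "\<And>g s t. norm g \<le> ?M * R \<Longrightarrow> s \<in> {0..T} \<Longrightarrow> t \<in> {0..T} \<Longrightarrow> norm (limit_h g t - limit_h g s) \<le> \<kappa> * \<bar>t - s\<bar>"
    by (rule relax_taylor[of "?M * R" T limit_matrix "\<chi> j. Y j"]) blast
  have "\<forall>f\<in>Fs. \<exists>\<rho> \<delta> \<eta>. \<delta> > 0 \<and> \<eta> > 0 \<and>
    (\<forall>N p p'. N \<ge> (1::nat) \<longrightarrow> (\<forall>i\<in>{1..N}. dist (p i) (p' i) < \<delta>) \<longrightarrow>
      \<bar>avg N (indicator {x. norm x > \<rho>}) p - (\<integral>x. indicator {x. norm x > \<rho>} x \<partial>\<mu>\<^sub>0)\<bar> < \<eta> \<longrightarrow>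
      \<bar>avg N f p - (\<integral>x. f x \<partial>\<mu>\<^sub>0)\<bar> < \<eta> \<longrightarrow>
      \<bar>avg N f p' - (\<integral>x. f x \<partial>\<mu>\<^sub>0)\<bar> < e)"
  proof
    fix f assume f: "f \<in> Fs"
    then have "continuous_on UNIV f" "bounded (range f)" using Fs by (auto simp: test_family_def)
    from test_function_shift[OF this e \<mu>0] show "\<exists>\<rho> \<delta> \<eta>. \<delta> > 0 \<and> \<eta> > 0 \<and>
    (\<forall>N p p'. N \<ge> (1::nat) \<longrightarrow> (\<forall>i\<in>{1..N}. dist (p i) (p' i) < \<delta>) \<longrightarrow>
      \<bar>avg N (indicator {x. norm x > \<rho>}) p - (\<integral>x. indicator {x. norm x > \<rho>} x \<partial>\<mu>\<^sub>0)\<bar> < \<eta> \<longrightarrow>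
      \<bar>avg N f p - (\<integral>x. f x \<partial>\<mu>\<^sub>0)\<bar> < \<eta> \<longrightarrow>
      \<bar>avg N f p' - (\<integral>x. f x \<partial>\<mu>\<^sub>0)\<bar> < e)" by metis
  qed
  then obtain \<rho> \<delta> \<eta>' where shift: "\<And>f. f \<in> Fs \<Longrightarrow> \<delta> f > 0" "\<And>f. f \<in> Fs \<Longrightarrow> \<eta>' f > 0"
    "\<And>f N p p'. f \<in> Fs \<Longrightarrow> N \<ge> (1::nat) \<Longrightarrow> (\<forall>i\<in>{1..N}. dist (p i) (p' i) < \<delta> f) \<Longrightarrow>
      \<bar>avg N (indicator {x. norm x > \<rho> f}) p - (\<integral>x. indicator {x. norm x > \<rho> f} x \<partial>\<mu>\<^sub>0)\<bar> < \<eta>' f \<Longrightarrow>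
      \<bar>avg N f p - (\<integral>x. f x \<partial>\<mu>\<^sub>0)\<bar> < \<eta>' f \<Longrightarrow>
      \<bar>avg N f p' - (\<integral>x. f x \<partial>\<mu>\<^sub>0)\<bar> < e"
    by metis
  have finF: "finite Fs" using Fs by (simp add: test_family_def)
  \<comment> \<open>Ensures \<open>C * \<eta> \<le> e / 4\<close> for the output and meets the
    tolerance of \<open>test_function_shift\<close> for each test function.\<close>
  define \<eta> where "\<eta> = Min (insert (e / (4 * C)) (\<eta>' ` Fs))"
  have \<eta>: "\<eta> > 0" "\<eta> \<le> e / (4 * C)" "\<And>f. f \<in> Fs \<Longrightarrow> \<eta> \<le> \<eta>' f"
    using finF shift(2) e C by (auto simp: \<eta>_def)
  define d where "d = Min (insert 1 (\<delta> ` Fs))"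
  have d: "d > 0" "\<And>f. f \<in> Fs \<Longrightarrow> d \<le> \<delta> f" using finF shift(1) by (auto simp: d_def)
  define \<Phi> where "\<Phi> = range (\<lambda>(i, j). tangent_kernel \<sigma> (X i) (X j)) \<union> Fs \<union> (\<lambda>f. indicator {x. norm x > \<rho> f}) ` Fs"
  \<comment> \<open>The bound \<open>q \<le> sqrt N\<close> yields \<open>C / sqrt N < e / 4\<close>
    for the descent error, \<open>\<kappa> / sqrt N < e / 4\<close> for the time gap
    \<open>t - n / N\<close>, and \<open>2 * C / sqrt N < d\<close> for the displacement of both
    components of a parameter.\<close>
  define q where "q = 1 + max (4 * C / e) (max (4 * \<kappa> / e) (2 * C / d))"
  obtain N2 :: nat where N2: "q\<^sup>2 \<le> N2" using real_arch_simple by blast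
  show ?thesis
  proof (rule that[of \<Phi> \<eta> "max N0 N2"])
    show "finite \<Phi>" using finF by (simp add: \<Phi>_def)
    have f: "f \<in> borel_measurable borel" "\<exists>b. \<forall>q. \<bar>f q\<bar> \<le> b" if "f \<in> Fs" for f
      using that Fs borel_measurable_continuous_onI[of f] unfolding test_family_def bounded_iff by auto
    have ind: "(indicator {x :: 'd param. norm x > r} :: _ \<Rightarrow> real) \<in> borel_measurable borel" for r
      by (intro borel_measurable_indicator) simp
    show "\<phi> \<in> borel_measurable borel" if "\<phi> \<in> \<Phi>" for \<phi>
      using that f(1) ind tangent_kernel_measurable by (auto simp: \<Phi>_def)
    show "\<exists>b. AE q in \<mu>\<^sub>0. \<bar>\<phi> q\<bar> \<le> b" if \<phi>: "\<phi> \<in> \<Phi>" for \<phi>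
    proof -
      consider i j where "\<phi> = tangent_kernel \<sigma> (X i) (X j)" | "\<phi> \<in> Fs" | f where "\<phi> = indicator {x. norm x > \<rho> f}"
        using \<phi> by (auto simp: \<Phi>_def)
      then show ?thesis
      proof cases
        case 1 then show ?thesis using tangent_kernel_AE_bound by blast
      next
        case 2 then show ?thesis using f(2) by (meson AE_I2)
      next
        case 3 then show ?thesis by (intro exI[of _ 1]) (auto simp: indicator_def)
      qed
    qed
    show "\<eta> > 0" by (fact \<eta>)
    show "max N0 N2 \<ge> 1" using C by simp
    fix N p z
    assume N: "max N0 N2 \<le> N" and good: "good_inputs N R \<eta> p z"
      and \<Phi>: "\<And>\<phi>. \<phi> \<in> \<Phi> \<Longrightarrow> \<bar>avg N \<phi> p - (\<integral>q. \<phi> q \<partial>\<mu>\<^sub>0)\<bar> < \<eta>"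
    have g: "\<bar>network \<sigma> N p (X j)\<bar> \<le> R" for j using good by (simp add: good_inputs_def)
    show "stays_close Fs e N p z"
      unfolding stays_close_def
    proof
      fix t assume t: "t \<in> {0..T}"
      have N1: "N \<ge> 1" "N0 \<le> N" using N C by auto
      have Np: "real N > 0" using N1 by simp
      have sq: "q \<le> sqrt N" using N2 N by (intro real_le_rsqrt) linarith
      have sp: "sqrt N > 0" using Np by simp
      have sN: "sqrt N * 1 \<le> sqrt N * sqrt N" using N1 by (intro mult_left_mono) auto
      have b1: "C / sqrt N < e / 4" and b2: "\<kappa> / sqrt N < e / 4" and b3: "2 * C / sqrt N < d"
      proof -
        have "4 * C / e < sqrt N" "4 * \<kappa> / e < sqrt N" "2 * C / d < sqrt N" using sq by (auto simp: q_def)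
        then show "C / sqrt N < e / 4" "\<kappa> / sqrt N < e / 4" "2 * C / sqrt N < d"
          using e d(1) sp by (auto simp: field_simps)
      qed
      define n where "n = nat \<lfloor>real N * t\<rfloor>"
      have t0: "0 \<le> t" "t \<le> T" using t by auto
      have nt: "real n \<le> N * t" "N * t < real n + 1"
        using t0 unfolding n_def by (auto simp: of_nat_nat)
      have "N * t \<le> N * T" using t0 by (intro mult_left_mono) auto
      then have nT: "real n \<le> N * T" using nt by linarith
      have tk: "\<bar>avg N (tangent_kernel \<sigma> (X i) (X j)) p - limit_kernel i j\<bar> \<le> \<eta>" for i j
      proof -
        have "tangent_kernel \<sigma> (X i) (X j) \<in> \<Phi>" by (auto simp: \<Phi>_def)
        from \<Phi>[OF this] show ?thesis by (simp add: limit_kernel_def)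
      qed
      have cl: "norm ((\<chi> i. network \<sigma> N (sgd \<sigma> \<alpha> N p z n) (X i)) - limit_h (\<chi> i. network \<sigma> N p (X i)) (n / N)) \<le> C * (\<eta> + 1 / sqrt N)"
        "\<And>i. i \<in> {1..N} \<Longrightarrow> \<bar>fst (sgd \<sigma> \<alpha> N p z n i) - fst (p i)\<bar> \<le> C / sqrt N \<and> norm (snd (sgd \<sigma> \<alpha> N p z n i) - snd (p i)) \<le> C / sqrt N"
        using close[rule_format, OF N1(2) good tk nT] by blast+
      have path: "sgd_path \<sigma> \<alpha> T X N p z t = (empirical {1..N} (sgd \<sigma> \<alpha> N p z n), \<chi> i. network \<sigma> N (sgd \<sigma> \<alpha> N p z n) (X i))"
        using t by (simp add: sgd_path_def n_def Let_def)
      have "fst (sgd_path \<sigma> \<alpha> T X N p z t) \<in> weak_ball \<mu>\<^sub>0 Fs e"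
        unfolding weak_ball_def path fst_conv
      proof (intro CollectI conjI ballI)
        show "empirical {1..N} (sgd \<sigma> \<alpha> N p z n) \<in> space (prob_algebra borel)"
          using N1 by (intro empirical_in_space) auto
        fix f assume f: "f \<in> Fs"
        have fc: "continuous_on UNIV f" using f Fs by (simp add: test_family_def)
        have "\<bar>avg N f (sgd \<sigma> \<alpha> N p z n) - (\<integral>x. f x \<partial>\<mu>\<^sub>0)\<bar> < e"
        proof (rule shift(3)[OF f N1(1)])
          show "\<forall>i\<in>{1..N}. dist (p i) (sgd \<sigma> \<alpha> N p z n i) < \<delta> f"
          proof
            fix i assume i: "i \<in> {1..N}"
            have "dist (p i) (sgd \<sigma> \<alpha> N p z n i) \<le> dist (fst (p i)) (fst (sgd \<sigma> \<alpha> N p z n i)) + dist (snd (p i)) (snd (sgd \<sigma> \<alpha> N p z n i))"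
              unfolding dist_prod_def by (rule sqrt_sum_squares_le_sum) auto
            also have "\<dots> \<le> C / sqrt N + C / sqrt N"
              using cl(2)[OF i] by (intro add_mono) (auto simp: dist_norm norm_minus_commute abs_minus_commute)
            also have "\<dots> < \<delta> f" using b3 d(2)[OF f] by simp
            finally show "dist (p i) (sgd \<sigma> \<alpha> N p z n i) < \<delta> f" .
          qed
          have "(indicator {x. norm x > \<rho> f} :: _ \<Rightarrow> real) \<in> \<Phi>" "f \<in> \<Phi>" using f by (auto simp: \<Phi>_def)
          from \<Phi>[OF this(1)] \<Phi>[OF this(2)] \<eta>(3)[OF f]
          show "\<bar>avg N (indicator {x. norm x > \<rho> f}) p - (\<integral>x. indicator {x. norm x > \<rho> f} x \<partial>\<mu>\<^sub>0)\<bar> < \<eta>' f"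
            "\<bar>avg N f p - (\<integral>x. f x \<partial>\<mu>\<^sub>0)\<bar> < \<eta>' f" by linarith+
        qed
        then show "\<bar>(\<integral>x. f x \<partial>empirical {1..N} (sgd \<sigma> \<alpha> N p z n)) - (\<integral>x. f x \<partial>\<mu>\<^sub>0)\<bar> < e"
          unfolding integral_empirical_continuous[OF N1(1) fc] .
      qed
      moreover have "dist (snd (sgd_path \<sigma> \<alpha> T X N p z t)) (limit_h (\<chi> i. network \<sigma> N p (X i)) t) < e"
      proof -
        let ?g = "\<chi> i. network \<sigma> N p (X i)"
        have gn: "norm ?g \<le> ?M * R" by (rule norm_vec_le) (use g in simp)
        have "n / N \<in> {0..T}" using nT Np by (auto simp: field_simps)
        from \<kappa>(2)[OF gn this t] have "norm (limit_h ?g t - limit_h ?g (n / N)) \<le> \<kappa> * \<bar>t - n / N\<bar>" .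
        also have "\<bar>t - n / N\<bar> \<le> 1 / N"
        proof -
          have "t - n / N = (N * t - n) / N" using Np by (simp add: diff_divide_distrib)
          then show ?thesis using nt Np by (simp add: divide_right_mono)
        qed
        also have "1 / real N \<le> 1 / sqrt N" using sN Np by (intro divide_left_mono) auto
        finally have "norm (limit_h ?g t - limit_h ?g (n / N)) \<le> \<kappa> * (1 / sqrt N)" using \<kappa>(1) by (simp add: mult_left_mono)
        also have "\<dots> = \<kappa> / sqrt N" by simp
        finally have 1: "norm (limit_h ?g t - limit_h ?g (n / N)) < e / 4" using b2 by (rule order.strict_trans1)
        have "C * (\<eta> + 1 / sqrt N) = C * \<eta> + C / sqrt N" by (simp add: distrib_left)
        moreover have "C * \<eta> \<le> e / 4" using \<eta>(2) C(1) by (simp add: field_simps)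
        ultimately have 2: "norm ((\<chi> i. network \<sigma> N (sgd \<sigma> \<alpha> N p z n) (X i)) - limit_h ?g (n / N)) < e / 2"
          using cl(1) b1 by linarith
        have "dist (\<chi> i. network \<sigma> N (sgd \<sigma> \<alpha> N p z n) (X i)) (limit_h ?g t) \<le>
          dist (\<chi> i. network \<sigma> N (sgd \<sigma> \<alpha> N p z n) (X i)) (limit_h ?g (n / N)) + dist (limit_h ?g t) (limit_h ?g (n / N))"
          by (rule dist_triangle2)
        then show ?thesis using 1 2 e unfolding path snd_conv dist_norm by linarith
      qed
      ultimately show "fst (sgd_path \<sigma> \<alpha> T X N p z t) \<in> weak_ball \<mu>\<^sub>0 Fs e \<and>
        dist (snd (sgd_path \<sigma> \<alpha> T X N p z t)) (limit_h (\<chi> i. network \<sigma> N p (X i)) t) < e" ..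
    qed
  qed
qed

section \<open>Comparison of the process with the limit path\<close>

abbreviation "state_space \<equiv> (state_topology :: ('d param measure \<times> (real^'m)) topology)"
abbreviation "path_space \<equiv> skorokhod_topology T state_space"
abbreviation "sgd_process N \<omega> \<equiv> sgd_path \<sigma> \<alpha> T X N (p0_at N \<omega>) (z_at N \<omega>)"
abbreviation "limit_process \<equiv> limit_path T \<mu>\<^sub>0 limit_matrix (\<chi> j. Y j)"

lemma \<mu>0_space: "\<mu>\<^sub>0 \<in> space (prob_algebra borel)"
  using \<mu>0 by (simp add: space_prob_algebra)

lemma sgd_process_measurable:
  assumes N: "N \<ge> 1" shows "sgd_process N \<in> P N \<rightarrow>\<^sub>M borel_of path_space"
proof -
  \<comment> \<open>Measurability is known for indices in \<open>{1..N}\<close>, while the path is a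
    continuous function on the space of all sequences.\<close>
  define p' where "p' \<omega> i = (if i \<in> {1..N} then p\<^sub>0 N i \<omega> else 0)" for \<omega> i
  have "p' \<in> borel_measurable (P N)"
  proof (rule measurable_coordinatewise_then_product)
    fix i show "(\<lambda>\<omega>. p' \<omega> i) \<in> borel_measurable (P N)"
    proof (cases "i \<in> {1..N}")
      case True
      then have "(\<lambda>\<omega>. p' \<omega> i) = p\<^sub>0 N i" by (simp add: p'_def fun_eq_iff)
      then show ?thesis using p0_measurable[OF N True] by simp
    next
      case False
      then have "(\<lambda>\<omega>. p' \<omega> i) = (\<lambda>\<omega>. 0)" by (simp only: p'_def False if_False)
      then show ?thesis by simp
    qed
  qed
  moreover have "(\<lambda>\<omega> k. z N k \<omega>) \<in> borel_measurable (P N)"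
    by (intro measurable_coordinatewise_then_product z_measurable N)
  ultimately have "(\<lambda>\<omega>. (p' \<omega>, \<lambda>k. z N k \<omega>)) \<in> borel_measurable (P N)" by (rule borel_measurable_Pair)
  from measurable_compose[OF this continuous_map_measurable_borel_of[OF continuous_map_sgd_path[OF \<sigma>_cont N]]]
  have "(\<lambda>\<omega>. sgd_path \<sigma> \<alpha> T X N (p' \<omega>) (z_at N \<omega>)) \<in> P N \<rightarrow>\<^sub>M borel_of path_space" by simp
  moreover have "sgd_path \<sigma> \<alpha> T X N (p' \<omega>) (z_at N \<omega>) = sgd_process N \<omega>" for \<omega>
    by (rule sgd_path_cong) (simp add: p'_def)
  ultimately show ?thesis by simp
qed

lemma sgd_process_cadlag:
  assumes "N \<ge> 1" shows "sgd_process N \<omega> \<in> cadlag_paths T state_space"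
  using continuous_map_image_subset_topspace[OF continuous_map_sgd_path[OF \<sigma>_cont assms, of T \<alpha> X]]
  unfolding topspace_skorokhod_topology image_subset_iff by (metis UNIV_I fst_conv snd_conv topspace_euclidean)

lemma initial_output_measurable:
  assumes "N \<ge> 1" shows "initial_output N \<in> borel_measurable (P N)"
  by (intro borel_measurable_vec_lambda network_measurable assms)

lemma limit_process_map: "continuous_map euclidean path_space limit_process"
  by (rule limit_path_continuous_map[OF \<mu>0_space pos(2)])

text \<open>A coupling: on the same probability space the process is compared with the limit path
  started from its own initial output, and off an event of small probability the two are uniformly
  close.\<close>

lemma process_close_to_limit:
  assumes F: "continuous_map path_space euclideanreal F" "bounded (F ` topspace path_space)"
  shows "(\<lambda>N. (\<integral>\<omega>. F (sgd_process N \<omega>) \<partial>P N) - (\<integral>\<omega>. F (limit_process (initial_output N \<omega>)) \<partial>P N)) \<longlonglongrightarrow> 0"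
proof (rule LIMSEQ_I)
  fix r :: real assume r: "r > 0"
  obtain b0 where b0: "\<And>\<omega>. \<omega> \<in> cadlag_paths T state_space \<Longrightarrow> \<bar>F \<omega>\<bar> \<le> b0"
    using F(2) unfolding bounded_iff topspace_skorokhod_topology by auto
  define b where "b = max 1 b0"
  have b: "b \<ge> 1" "\<And>\<omega>. \<omega> \<in> cadlag_paths T state_space \<Longrightarrow> \<bar>F \<omega>\<bar> \<le> b" using b0 by (force simp: b_def)+
  \<comment> \<open>The bad event has probability at most \<open>2 * e\<close> and both integrands
    are bounded by \<open>b\<close>, so it contributes at most
    \<open>2 * b * (2 * e) = r / 2\<close>.\<close>
  define e where "e = r / (8 * b)"
  have e: "e > 0" using r b by (simp add: e_def)
  \<comment> \<open>The order of choices matters: \<open>R\<close> works for all \<open>N\<close>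
    and fixes a compact set of starting values; \<open>d\<close>, the test functions and
    \<open>\<eta>\<close> depend on it, and the bound on \<open>N\<close> comes last.\<close>
  obtain R where R: "R > 0" "\<And>N. N \<ge> 1 \<Longrightarrow> measure (P N) {\<omega> \<in> space (P N). \<exists>j. R < \<bar>network \<sigma> N (p0_at N \<omega>) (X j)\<bar>} \<le> e"
    using initial_network_tight[OF e] by blast
  let ?K = "cball 0 (CARD('m) * R) :: (real^'m) set"
  obtain m where m: "mtopology_of m = state_space" using metrizable_state_topology by blast
  have r4: "r / 4 > 0" using r by simp
  obtain d where d: "d > 0" "\<And>g \<omega>. g \<in> ?K \<Longrightarrow> \<omega> \<in> cadlag_paths T state_space \<Longrightarrow>
    (\<forall>t\<in>{0..T}. mdist m (limit_process g t) (\<omega> t) < d) \<Longrightarrow> \<bar>F (limit_process g) - F \<omega>\<bar> < r / 4"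
    using limit_path_compact_uniform[OF \<mu>0_space pos(2) m F(1) compact_cball r4, where A = limit_matrix and y = "\<chi> j. Y j"] by blast
  obtain K3 where K3: "\<And>g t. norm g \<le> CARD('m) * R \<Longrightarrow> t \<in> {0..T} \<Longrightarrow> norm (limit_h g t) \<le> K3"
    by (rule relax_bound[of "CARD('m) * R" T limit_matrix "\<chi> j. Y j"]) blast
  obtain Fs e2 where Fs: "test_family Fs" "e2 > 0"
    "\<And>\<nu> h h'. \<nu> \<in> weak_ball \<mu>\<^sub>0 Fs e2 \<Longrightarrow> h \<in> cball 0 K3 \<Longrightarrow> dist h' h < e2 \<Longrightarrow> mdist m (\<mu>\<^sub>0, h) (\<nu>, h') < d"
    by (rule state_uniform_nbhd[OF m \<mu>0_space compact_cball[of 0 K3] d(1)]) blast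
  obtain \<Phi> \<eta> N1 where \<Phi>: "finite \<Phi>" "\<And>\<phi>. \<phi> \<in> \<Phi> \<Longrightarrow> \<phi> \<in> borel_measurable borel"
    "\<And>\<phi>. \<phi> \<in> \<Phi> \<Longrightarrow> \<exists>b. AE q in \<mu>\<^sub>0. \<bar>\<phi> q\<bar> \<le> b" "\<eta> > 0" "N1 \<ge> 1"
    and close: "\<And>N p z. N \<ge> N1 \<Longrightarrow> good_inputs N R \<eta> p z \<Longrightarrow>
      (\<And>\<phi>. \<phi> \<in> \<Phi> \<Longrightarrow> \<bar>avg N \<phi> p - (\<integral>q. \<phi> q \<partial>\<mu>\<^sub>0)\<bar> < \<eta>) \<Longrightarrow> stays_close Fs e2 N p z"
    by (rule good_event_closeness[OF R(1) Fs(2,1)]) blast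
  define B1 where "B1 N = {\<omega> \<in> space (P N). \<exists>j. R < \<bar>network \<sigma> N (p0_at N \<omega>) (X j)\<bar>}" for N
  define B2 where "B2 \<phi> N = {\<omega> \<in> space (P N). \<eta> \<le> \<bar>avg N \<phi> (p0_at N \<omega>) - (\<integral>q. \<phi> q \<partial>\<mu>\<^sub>0)\<bar>}" for \<phi> N
  define B3 where "B3 N = {\<omega> \<in> space (P N). \<exists>k j. real k \<le> N * T \<and> \<eta> \<le> \<bar>sampling_error N j k (z_at N \<omega>)\<bar>}" for N
  define Bad where "Bad N = B1 N \<union> (\<Union>\<phi>\<in>\<Phi>. B2 \<phi> N) \<union> B3 N" for N
  have "(\<lambda>N. (\<Sum>\<phi>\<in>\<Phi>. measure (P N) (B2 \<phi> N)) + measure (P N) (B3 N)) \<longlonglongrightarrow> (\<Sum>\<phi>\<in>\<Phi>. 0) + 0"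
  proof (intro tendsto_add tendsto_sum)
    fix \<phi> assume "\<phi> \<in> \<Phi>"
    then show "(\<lambda>N. measure (P N) (B2 \<phi> N)) \<longlonglongrightarrow> 0"
      unfolding B2_def using \<Phi>(2,3) \<Phi>(4) average_lln by blast
  next
    show "(\<lambda>N. measure (P N) (B3 N)) \<longlonglongrightarrow> 0" unfolding B3_def by (rule sample_lln(2)[OF \<Phi>(4)])
  qed
  then have "\<forall>\<^sub>F N in sequentially. (\<Sum>\<phi>\<in>\<Phi>. measure (P N) (B2 \<phi> N)) + measure (P N) (B3 N) < e"
    using e by (intro order_tendstoD) simp_all
  then obtain N2 where N2: "\<And>N. N \<ge> N2 \<Longrightarrow> (\<Sum>\<phi>\<in>\<Phi>. measure (P N) (B2 \<phi> N)) + measure (P N) (B3 N) < e"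
    unfolding eventually_sequentially by blast
  have "norm ((\<integral>\<omega>. F (sgd_process N \<omega>) \<partial>P N) - (\<integral>\<omega>. F (limit_process (initial_output N \<omega>)) \<partial>P N) - 0) < r"
    if N: "N \<ge> max N1 N2" for N
  proof -
    have N': "N \<ge> 1" "N \<ge> N1" "N \<ge> N2" using N \<Phi>(5) by auto
    interpret prob_space "P N" by (rule input[OF N'(1)])
    have Fm: "F \<in> borel_measurable (borel_of path_space)" by (rule continuous_map_borel_measurable[OF F(1)])
    have m1: "(\<lambda>\<omega>. F (sgd_process N \<omega>)) \<in> borel_measurable (P N)"
      by (rule measurable_compose[OF sgd_process_measurable[OF N'(1)] Fm])
    have m2: "(\<lambda>\<omega>. F (limit_process (initial_output N \<omega>))) \<in> borel_measurable (P N)"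
      by (rule measurable_compose[OF initial_output_measurable[OF N'(1)] measurable_compose[OF continuous_map_measurable_borel_of[OF limit_process_map] Fm]])
    have B1: "B1 N \<in> sets (P N)"
    proof -
      have "B1 N = (\<Union>j. {\<omega> \<in> space (P N). R < \<bar>network \<sigma> N (p0_at N \<omega>) (X j)\<bar>})" by (auto simp: B1_def)
      moreover have "{\<omega> \<in> space (P N). R < \<bar>network \<sigma> N (p0_at N \<omega>) (X j)\<bar>} \<in> sets (P N)" for j
        using network_measurable[OF N'(1), of "X j"] by measurable
      ultimately show ?thesis by auto
    qed
    have B2: "B2 \<phi> N \<in> sets (P N)" if "\<phi> \<in> \<Phi>" for \<phi>
      unfolding B2_def using average_measurable[OF N'(1) \<Phi>(2)[OF that]] by measurable
    have B3: "B3 N \<in> sets (P N)" unfolding B3_def by (rule sample_lln(1)[OF \<Phi>(4) N'(1)])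
    have Bad: "Bad N \<in> sets (P N)" unfolding Bad_def by (intro sets.Un sets.finite_UN B1 B2 B3 \<Phi>(1))
    have lc: "limit_process g \<in> cadlag_paths T state_space" for g by (rule limit_path_cadlag[OF \<mu>0_space pos(2)])
    have sc: "sgd_process N \<omega> \<in> cadlag_paths T state_space" for \<omega> by (rule sgd_process_cadlag[OF N'(1)])
    have "\<bar>(\<integral>\<omega>. F (sgd_process N \<omega>) \<partial>P N) - (\<integral>\<omega>. F (limit_process (initial_output N \<omega>)) \<partial>P N)\<bar> \<le> r / 4 + (b + b) * prob (Bad N)"
    proof (rule integral_close[OF m1 m2 Bad])
      show "AE \<omega> in P N. \<omega> \<notin> Bad N \<longrightarrow> \<bar>F (sgd_process N \<omega>) - F (limit_process (initial_output N \<omega>))\<bar> \<le> r / 4"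
        using AE_inputs[OF N'(1)] AE_space
      proof eventually_elim
        case (elim \<omega>)
        show ?case
        proof
          assume nb: "\<omega> \<notin> Bad N"
          let ?g = "initial_output N \<omega>"
          have nw: "\<bar>network \<sigma> N (p0_at N \<omega>) (X j)\<bar> \<le> R" for j
            using nb elim(2) by (auto simp: Bad_def B1_def not_less)
          have g: "norm ?g \<le> CARD('m) * R" by (rule norm_vec_le) (use nw in simp)
          have se: "\<bar>sampling_error N j k (z_at N \<omega>)\<bar> \<le> \<eta>" if k: "real k \<le> N * T" for k j
          proof (rule ccontr)
            assume "\<not> ?thesis"
            then have "\<omega> \<in> B3 N" unfolding B3_def not_le
              using elim(2) k by (intro CollectI conjI exI[of _ k] exI[of _ j]) simp_all
            then show False using nb by (simp add: Bad_def)
          qed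
          have "\<bar>avg N \<phi> (p0_at N \<omega>) - (\<integral>q. \<phi> q \<partial>\<mu>\<^sub>0)\<bar> < \<eta>" if "\<phi> \<in> \<Phi>" for \<phi>
            using nb elim(2) that by (auto simp: Bad_def B2_def not_le)
          moreover have "good_inputs N R \<eta> (p0_at N \<omega>) (z_at N \<omega>)"
            unfolding good_inputs_def using elim(1) nw se by blast
          ultimately have "stays_close Fs e2 N (p0_at N \<omega>) (z_at N \<omega>)" by (intro close N'(2))
          then have cl: "fst (sgd_process N \<omega> t) \<in> weak_ball \<mu>\<^sub>0 Fs e2 \<and> dist (snd (sgd_process N \<omega> t)) (limit_h ?g t) < e2"
            if "t \<in> {0..T}" for t using that by (simp add: stays_close_def)
          have "\<bar>F (limit_process ?g) - F (sgd_process N \<omega>)\<bar> < r / 4"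
          proof (rule d(2)[OF _ sc])
            show "?g \<in> ?K" using g by simp
            show "\<forall>t\<in>{0..T}. mdist m (limit_process ?g t) (sgd_process N \<omega> t) < d"
            proof
              fix t assume t: "t \<in> {0..T}"
              have "mdist m (\<mu>\<^sub>0, limit_h ?g t) (fst (sgd_process N \<omega> t), snd (sgd_process N \<omega> t)) < d"
                using cl[OF t] K3[OF g t] by (intro Fs(3)) auto
              then show "mdist m (limit_process ?g t) (sgd_process N \<omega> t) < d"
                using t by (simp only: prod.collapse) (simp add: limit_path_def)
            qed
          qed
          then show "\<bar>F (sgd_process N \<omega>) - F (limit_process ?g)\<bar> \<le> r / 4" by linarith
        qed
      qed
    qed (use b(2) sc lc r4 in auto)
    also have "prob (Bad N) \<le> e + e"
    proof -
      have "prob (Bad N) \<le> prob (B1 N \<union> (\<Union>\<phi>\<in>\<Phi>. B2 \<phi> N)) + prob (B3 N)"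
        unfolding Bad_def using B1 B2 B3 \<Phi>(1) by (intro measure_Un_le) auto
      also have "prob (B1 N \<union> (\<Union>\<phi>\<in>\<Phi>. B2 \<phi> N)) \<le> prob (B1 N) + prob (\<Union>\<phi>\<in>\<Phi>. B2 \<phi> N)"
        using B1 B2 \<Phi>(1) by (intro measure_Un_le) auto
      also have "prob (\<Union>\<phi>\<in>\<Phi>. B2 \<phi> N) \<le> (\<Sum>\<phi>\<in>\<Phi>. prob (B2 \<phi> N))"
        using B2 \<Phi>(1) by (intro measure_UNION_le) auto
      also have "prob (B1 N) \<le> e" unfolding B1_def by (rule R(2)[OF N'(1)])
      finally show ?thesis using N2[OF N'(3)] by linarith
    qed
    also have "r / 4 + (b + b) * (e + e) = r / 4 + r / 2" using b(1) by (simp add: e_def)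
    finally show ?thesis using r b(1) by (simp add: mult_left_mono)
  qed
  then show "\<exists>n0. \<forall>N\<ge>n0. norm ((\<integral>\<omega>. F (sgd_process N \<omega>) \<partial>P N) - (\<integral>\<omega>. F (limit_process (initial_output N \<omega>)) \<partial>P N) - 0) < r"
    by blast
qed

section \<open>The Gaussian limit of the initial output\<close>

definition initial_covariance :: "'m \<Rightarrow> 'm \<Rightarrow> real" where
  "initial_covariance i j = (\<integral>q. (fst q)\<^sup>2 * \<sigma> (snd q \<bullet> X i) * \<sigma> (snd q \<bullet> X j) \<partial>\<mu>\<^sub>0)"

lemma measurable_\<mu>0: "f \<in> borel_measurable borel \<Longrightarrow> f \<in> borel_measurable \<mu>\<^sub>0"
  using measurable_cong_sets[OF \<mu>0(2) refl] by blast

lemmas neuron_measurable' = measurable_\<mu>0[OF neuron_measurable]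

lemma covariance_integrable: "integrable \<mu>\<^sub>0 (\<lambda>q. (fst q)\<^sup>2 * \<sigma> (snd q \<bullet> X i) * \<sigma> (snd q \<bullet> X j))"
proof (rule M0.integrable_const_bound[where B = "(B * S) * (B * S)"])
  show "AE q in \<mu>\<^sub>0. norm ((fst q)\<^sup>2 * \<sigma> (snd q \<bullet> X i) * \<sigma> (snd q \<bullet> X j)) \<le> (B * S) * (B * S)"
    using neuron_bound[of "X i"] neuron_bound[of "X j"]
  proof eventually_elim
    case (elim q)
    from abs_mult_le[OF this] show ?case by (simp add: power2_eq_square mult_ac)
  qed
  have "(\<lambda>q. (fst q * \<sigma> (snd q \<bullet> X i)) * (fst q * \<sigma> (snd q \<bullet> X j))) \<in> borel_measurable \<mu>\<^sub>0"
    by (rule borel_measurable_times[OF neuron_measurable' neuron_measurable'])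
  then show "(\<lambda>q. (fst q)\<^sup>2 * \<sigma> (snd q \<bullet> X i) * \<sigma> (snd q \<bullet> X j)) \<in> borel_measurable \<mu>\<^sub>0"
    by (simp add: power2_eq_square mult_ac)
qed

text \<open>Serves twice: it shows that the covariance is positive semidefinite, and it identifies
  the variance of the output projected onto a direction \<open>u\<close>.\<close>

lemma covariance_quadratic:
  "(\<Sum>i\<in>UNIV. \<Sum>j\<in>UNIV. u i * u j * initial_covariance i j) = (\<integral>q. (\<Sum>j\<in>UNIV. u j * (fst q * \<sigma> (snd q \<bullet> X j)))\<^sup>2 \<partial>\<mu>\<^sub>0)"
proof -
  have "(\<integral>q. (\<Sum>j\<in>UNIV. u j * (fst q * \<sigma> (snd q \<bullet> X j)))\<^sup>2 \<partial>\<mu>\<^sub>0) =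
    (\<integral>q. (\<Sum>i\<in>UNIV. \<Sum>j\<in>UNIV. u i * u j * ((fst q)\<^sup>2 * \<sigma> (snd q \<bullet> X i) * \<sigma> (snd q \<bullet> X j))) \<partial>\<mu>\<^sub>0)"
    by (simp add: power2_eq_square sum_product mult_ac)
  also have "\<dots> = (\<Sum>i\<in>UNIV. \<Sum>j\<in>UNIV. u i * u j * initial_covariance i j)"
    by (simp add: covariance_integrable initial_covariance_def)
  finally show ?thesis by simp
qed

text \<open>Reduction to one dimension (Cramer-Wold): for each direction \<open>u\<close> the
  projected output is a normalized sum of i.i.d. bounded centered variables, whose characteristic
  functions converge. Tightness comes from the coordinates.\<close>

lemma initial_output_weak_convergence:
  fixes F :: "real^'m \<Rightarrow> real"
  assumes \<nu>: "centered_gaussian \<nu> (\<chi> i j. initial_covariance i j)"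
    and F: "continuous_on UNIV F" "bounded (range F)"
  shows "(\<lambda>N. \<integral>\<omega>. F (initial_output N \<omega>) \<partial>P N) \<longlonglongrightarrow> (\<integral>x. F x \<partial>\<nu>)"
proof -
  define \<nu>N where "\<nu>N N = distr (P N) borel (initial_output N)" for N
  have p: "prob_space \<nu>" "sets \<nu> = sets borel" using \<nu> by (auto simp: centered_gaussian_def)
  have "(\<lambda>N. \<integral>x. F x \<partial>\<nu>N N) \<longlonglongrightarrow> (\<integral>x. F x \<partial>\<nu>)"
  proof (rule weak_convergence_from_char[OF _ _ p _ _ F])
    show "prob_space (\<nu>N N)" if "N \<ge> 1" for N
      unfolding \<nu>N_def by (rule prob_space.prob_space_distr[OF input(1)[OF that] initial_output_measurable[OF that]])
    show "sets (\<nu>N N) = sets borel" for N by (simp add: \<nu>N_def)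
    show "\<exists>L>0. \<forall>N\<ge>1. measure (\<nu>N N) {x. norm x > L} \<le> e" if e: "e > 0" for e
    proof -
      obtain R where R: "R > 0" "\<And>N. N \<ge> 1 \<Longrightarrow> measure (P N) {\<omega> \<in> space (P N). \<exists>j. R < \<bar>network \<sigma> N (p0_at N \<omega>) (X j)\<bar>} \<le> e"
        using initial_network_tight[OF e] by blast
      have "measure (\<nu>N N) {x. norm x > CARD('m) * R} \<le> e" if N: "N \<ge> 1" for N
      proof -
        interpret prob_space "P N" by (rule input[OF N])
        have "measure (\<nu>N N) {x. norm x > CARD('m) * R} = prob (initial_output N -` {x. norm x > CARD('m) * R} \<inter> space (P N))"
          unfolding \<nu>N_def by (rule measure_distr[OF initial_output_measurable[OF N]]) simp
        also have "\<dots> \<le> prob {\<omega> \<in> space (P N). \<exists>j. R < \<bar>network \<sigma> N (p0_at N \<omega>) (X j)\<bar>}"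
        proof (rule finite_measure_mono)
          show "initial_output N -` {x. norm x > CARD('m) * R} \<inter> space (P N) \<subseteq> {\<omega> \<in> space (P N). \<exists>j. R < \<bar>network \<sigma> N (p0_at N \<omega>) (X j)\<bar>}"
          proof
            fix \<omega> assume w: "\<omega> \<in> initial_output N -` {x. norm x > CARD('m) * R} \<inter> space (P N)"
            have "\<exists>j. R < \<bar>network \<sigma> N (p0_at N \<omega>) (X j)\<bar>"
            proof (rule ccontr)
              assume "\<not> ?thesis"
              then have "norm (initial_output N \<omega>) \<le> CARD('m) * R" by (intro norm_vec_le) (simp add: not_less)
              then show False using w by auto
            qed
            then show "\<omega> \<in> {\<omega> \<in> space (P N). \<exists>j. R < \<bar>network \<sigma> N (p0_at N \<omega>) (X j)\<bar>}" using w by auto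
          qed
          have "{\<omega> \<in> space (P N). R < \<bar>network \<sigma> N (p0_at N \<omega>) (X j)\<bar>} \<in> events" for j
            using network_measurable[OF N, of "X j"] by measurable
          then have "(\<Union>j. {\<omega> \<in> space (P N). R < \<bar>network \<sigma> N (p0_at N \<omega>) (X j)\<bar>}) \<in> events" by auto
          then show "{\<omega> \<in> space (P N). \<exists>j. R < \<bar>network \<sigma> N (p0_at N \<omega>) (X j)\<bar>} \<in> events"
            by (rule back_subst[where P = "\<lambda>A. A \<in> events"]) auto
        qed
        also have "\<dots> \<le> e" by (rule R(2)[OF N])
        finally show ?thesis .
      qed
      then show ?thesis using R(1) by (intro exI[of _ "CARD('m) * R"]) auto
    qed
    fix u :: "real^'m"
    define \<phi> where "\<phi> q = (\<Sum>j\<in>UNIV. u $ j * (fst q * \<sigma> (snd q \<bullet> X j)))" for q :: "'d param"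
    define v where "v = u \<bullet> ((\<chi> i j. initial_covariance i j) *v u)"
    have \<phi>m: "\<phi> \<in> borel_measurable borel"
      unfolding \<phi>_def by (intro borel_measurable_sum borel_measurable_times neuron_measurable borel_measurable_const)
    then have \<phi>m': "\<phi> \<in> borel_measurable \<mu>\<^sub>0" by (rule measurable_\<mu>0)
    have v: "v = (\<integral>q. (\<phi> q)\<^sup>2 \<partial>\<mu>\<^sub>0)"
    proof -
      have "v = (\<Sum>i\<in>UNIV. \<Sum>j\<in>UNIV. u $ i * u $ j * initial_covariance i j)"
        by (simp add: v_def inner_vec_def matrix_vector_mult_def sum_distrib_left mult_ac)
      then show ?thesis unfolding covariance_quadratic \<phi>_def .
    qed
    have v0: "v \<ge> 0" unfolding v by simp
    define \<rho> where "\<rho> = distr \<mu>\<^sub>0 borel \<phi>"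
    have \<rho>: "real_distribution \<rho>" unfolding \<rho>_def by (rule M0.real_distribution_distr[OF \<phi>m'])
    have neuron_int: "integrable \<mu>\<^sub>0 (\<lambda>q. fst q * \<sigma> (snd q \<bullet> X j))" for j
      using neuron_bound[of "X j"] neuron_measurable'[of "X j"]
      by (intro M0.integrable_const_bound[where B = "B * S"]) simp_all
    have char: "(\<lambda>N. char (distr (P N) borel (\<lambda>\<omega>. 1 / sqrt N * (\<Sum>i=1..N. \<phi> (p\<^sub>0 N i \<omega>)))) 1) \<longlonglongrightarrow> exp (- v / 2)"
    proof (rule char_normalized_sum_tendsto[OF input(1) _ _ \<rho>])
      fix N :: nat assume N: "1 \<le> N"
      interpret prob_space "P N" by (rule input[OF N])
      show "indep_vars (\<lambda>_. borel) (\<lambda>i \<omega>. \<phi> (p\<^sub>0 N i \<omega>)) {1..N}"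
        using indep_vars_compose2[OF input(2)[OF N], of "\<lambda>_. \<phi>" "\<lambda>_. borel"] \<phi>m by simp
      fix i assume i: "i \<in> {1..N}"
      have "distr (P N) borel (\<lambda>\<omega>. \<phi> (p\<^sub>0 N i \<omega>)) = distr (distr (P N) borel (p\<^sub>0 N i)) borel \<phi>"
        using p0_measurable[OF N i] \<phi>m by (simp add: distr_distr comp_def)
      then show "distr (P N) borel (\<lambda>\<omega>. \<phi> (p\<^sub>0 N i \<omega>)) = \<rho>" unfolding input(3)[OF N i] \<rho>_def .
    next
      define b where "b = (\<Sum>j\<in>UNIV. \<bar>u $ j\<bar> * (B * S))"
      have "AE q in \<mu>\<^sub>0. \<forall>j\<in>UNIV. \<bar>fst q * \<sigma> (snd q \<bullet> X j)\<bar> \<le> B * S"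
        by (intro AE_finite_allI neuron_bound) simp
      then have "AE q in \<mu>\<^sub>0. \<bar>\<phi> q\<bar> \<le> b"
      proof eventually_elim
        case (elim q)
        then show ?case unfolding \<phi>_def b_def
          by (intro order_trans[OF sum_abs] sum_mono) (simp add: abs_mult mult_left_mono)
      qed
      moreover have "{x \<in> space borel. \<bar>x\<bar> \<le> b} \<in> sets borel" for b :: real by simp
      ultimately show "AE x in \<rho>. \<bar>x\<bar> \<le> b" unfolding \<rho>_def by (subst AE_distr_iff[OF \<phi>m'])
      show "(\<integral>x. x \<partial>\<rho>) = 0"
      proof -
        have "(\<integral>q. \<phi> q \<partial>\<mu>\<^sub>0) = 0" unfolding \<phi>_def by (simp add: neuron_int mean_0)
        then show ?thesis unfolding \<rho>_def by (subst integral_distr[OF \<phi>m']) simp_all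
      qed
      show "(\<integral>x. x\<^sup>2 \<partial>\<rho>) = v"
        unfolding \<rho>_def v by (subst integral_distr[OF \<phi>m']) simp_all
    qed
    have "distr \<nu> borel (\<lambda>x. u \<bullet> x) = centered_normal v" using \<nu> by (simp add: centered_gaussian_def v_def)
    then have lim: "char (distr \<nu> borel (\<lambda>x. u \<bullet> x)) 1 = exp (- v / 2)"
      by (simp add: char_centered_normal[OF v0])
    have "char (distr (\<nu>N N) borel (\<lambda>x. u \<bullet> x)) 1 = char (distr (P N) borel (\<lambda>\<omega>. 1 / sqrt N * (\<Sum>i=1..N. \<phi> (p\<^sub>0 N i \<omega>)))) 1"
      if N: "N \<ge> 1" for N
    proof -
      have "u \<bullet> initial_output N \<omega> = 1 / sqrt N * (\<Sum>i=1..N. \<phi> (p\<^sub>0 N i \<omega>))" for \<omega>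
      proof -
        have "u \<bullet> initial_output N \<omega> = 1 / sqrt N * (\<Sum>j\<in>UNIV. \<Sum>i=1..N. u $ j * (fst (p\<^sub>0 N i \<omega>) * \<sigma> (snd (p\<^sub>0 N i \<omega>) \<bullet> X j)))"
          by (simp add: inner_vec_def network_def sum_distrib_left sum_divide_distrib mult_ac)
        also have "(\<Sum>j\<in>UNIV. \<Sum>i=1..N. u $ j * (fst (p\<^sub>0 N i \<omega>) * \<sigma> (snd (p\<^sub>0 N i \<omega>) \<bullet> X j))) = (\<Sum>i=1..N. \<phi> (p\<^sub>0 N i \<omega>))"
          unfolding \<phi>_def by (rule sum.swap)
        finally show ?thesis .
      qed
      then show ?thesis unfolding \<nu>N_def using initial_output_measurable[OF N]
        by (subst distr_distr) (auto simp: comp_def)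
    qed
    then show "(\<lambda>N. char (distr (\<nu>N N) borel (\<lambda>x. u \<bullet> x)) 1) \<longlonglongrightarrow> char (distr \<nu> borel (\<lambda>x. u \<bullet> x)) 1"
      unfolding lim by (intro Lim_transform_eventually[OF char] eventually_sequentiallyI[of 1]) simp
  qed
  then show ?thesis
  proof (rule Lim_transform_eventually, intro eventually_sequentiallyI[of 1])
    fix N :: nat assume N: "1 \<le> N"
    show "(\<integral>x. F x \<partial>\<nu>N N) = (\<integral>\<omega>. F (initial_output N \<omega>) \<partial>P N)"
      unfolding \<nu>N_def using F(1) by (intro integral_distr[OF initial_output_measurable[OF N]] borel_measurable_continuous_onI)
  qed
qed

text \<open>The limit map is continuous, so weak convergence of the initial output carries over to
  the limit paths started from it, and the coupling error vanishes.\<close>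

lemma process_converges:
  assumes \<nu>: "centered_gaussian \<nu> (\<chi> i j. initial_covariance i j)"
    and F: "continuous_map path_space euclideanreal F" "bounded (F ` topspace path_space)"
  shows "(\<lambda>N. \<integral>\<omega>. F (sgd_process N \<omega>) \<partial>P N) \<longlonglongrightarrow> (\<integral>g. F (limit_process g) \<partial>\<nu>)"
proof -
  have "continuous_map euclidean euclideanreal (F \<circ> limit_process)"
    by (rule continuous_map_compose[OF limit_process_map F(1)])
  then have "continuous_on UNIV (\<lambda>g. F (limit_process g))" by (simp add: comp_def)
  moreover have "range (\<lambda>g. F (limit_process g)) \<subseteq> F ` topspace path_space"
    using limit_path_cadlag[OF \<mu>0_space pos(2)] by (auto simp: topspace_skorokhod_topology)
  then have "bounded (range (\<lambda>g. F (limit_process g)))" using F(2) bounded_subset by blast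
  ultimately have "(\<lambda>N. \<integral>\<omega>. F (limit_process (initial_output N \<omega>)) \<partial>P N) \<longlonglongrightarrow> (\<integral>g. F (limit_process g) \<partial>\<nu>)"
    by (rule initial_output_weak_convergence[OF \<nu>])
  from tendsto_add[OF process_close_to_limit[OF F] this] show ?thesis by simp
qed

end

section \<open>The limit theorem\<close>

lemma relax_integral_equation:
  assumes t: "t \<ge> 0"
  shows "relax A y g t $ i = g $ i + (\<integral>s\<in>{0..t}. (A *v (y - relax A y g s)) $ i \<partial>lborel)"
proof -
  have cont: "continuous_on UNIV (\<lambda>s. (A *v (y - relax A y g s)) $ i)"
    by (intro continuous_intros continuous_on_component
        bounded_linear.continuous_on[OF matrix_vector_mul_bounded_linear] relax_continuous)
  have "(\<integral>s. (A *v (y - relax A y g s)) $ i * indicator {0..t} s \<partial>lborel) = relax A y g t $ i - relax A y g 0 $ i"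
    using t relax_component_derivative[of A y g i] cont
    by (intro integral_FTC_Icc_real) (auto simp: continuous_on_eq_continuous_at)
  then show ?thesis by (simp add: set_lebesgue_integral_def relax_0 mult.commute)
qed

text \<open>Composed with real functions, both variables take values in one type and the product
  rule for \<open>indep_var\<close> applies. Every event of a composition is already an event of the
  variable itself.\<close>

lemma indep_rvs_integral_product:
  fixes f :: "'b \<Rightarrow> real" and g :: "'c \<Rightarrow> real"
  assumes "prob_space M" and indep: "indep_rvs M SU U SV V"
    and f: "f \<in> borel_measurable SU" and g: "g \<in> borel_measurable SV"
    and int: "integrable M (\<lambda>x. f (U x))" "integrable M (\<lambda>x. g (V x))"
  shows "(\<integral>x. f (U x) * g (V x) \<partial>M) = (\<integral>x. f (U x) \<partial>M) * (\<integral>x. g (V x) \<partial>M)"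
proof -
  interpret prob_space M by fact
  have U: "U \<in> M \<rightarrow>\<^sub>M SU" and V: "V \<in> M \<rightarrow>\<^sub>M SV"
    and ind: "indep_set {U -` A \<inter> space M | A. A \<in> sets SU} {V -` B \<inter> space M | B. B \<in> sets SV}"
    using indep by (auto simp: indep_rvs_def)
  let ?F = "{(\<lambda>x. f (U x)) -` A \<inter> space M | A. A \<in> sets borel}" and ?G = "{(\<lambda>x. g (V x)) -` A \<inter> space M | A. A \<in> sets borel}"
  have F: "?F \<subseteq> {U -` A \<inter> space M | A. A \<in> sets SU}"
  proof
    fix C assume "C \<in> ?F"
    then obtain A where A: "A \<in> sets borel" "C = (\<lambda>x. f (U x)) -` A \<inter> space M" by blast
    have "C = U -` (f -` A \<inter> space SU) \<inter> space M" using A(2) measurable_space[OF U] by auto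
    moreover have "f -` A \<inter> space SU \<in> sets SU" using f A(1) by (rule measurable_sets)
    ultimately show "C \<in> {U -` A \<inter> space M | A. A \<in> sets SU}" by blast
  qed
  have G: "?G \<subseteq> {V -` A \<inter> space M | A. A \<in> sets SV}"
  proof
    fix C assume "C \<in> ?G"
    then obtain A where A: "A \<in> sets borel" "C = (\<lambda>x. g (V x)) -` A \<inter> space M" by blast
    have "C = V -` (g -` A \<inter> space SV) \<inter> space M" using A(2) measurable_space[OF V] by auto
    moreover have "g -` A \<inter> space SV \<in> sets SV" using g A(1) by (rule measurable_sets)
    ultimately show "C \<in> {V -` A \<inter> space M | A. A \<in> sets SV}" by blast
  qed
  have "indep_set ?F ?G"
    using ind F G unfolding indep_sets2_eq by (meson subset_iff subset_trans)
  moreover have "Int_stable {h -` A \<inter> space M | A. A \<in> sets borel}" for h :: "_ \<Rightarrow> real"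
  proof (rule Int_stableI)
    fix C C' assume "C \<in> {h -` A \<inter> space M | A. A \<in> sets borel}" "C' \<in> {h -` A \<inter> space M | A. A \<in> sets borel}"
    then obtain A A' where "A \<in> sets borel" "A' \<in> sets borel" "C = h -` A \<inter> space M" "C' = h -` A' \<inter> space M" by blast
    then show "C \<inter> C' \<in> {h -` A \<inter> space M | A. A \<in> sets borel}"
      by (intro CollectI exI[of _ "A \<inter> A'"]) auto
  qed
  ultimately have "indep_set (sigma_sets (space M) ?F) (sigma_sets (space M) ?G)"
    by (intro indep_set_sigma_sets)
  then have "indep_var borel (\<lambda>x. f (U x)) borel (\<lambda>x. g (V x))"
    unfolding indep_var_eq using measurable_compose[OF U f] measurable_compose[OF V g] by blast
  then show ?thesis using int by (rule indep_var_lebesgue_integral)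
qed

theorem theorem1p2:
  fixes X :: "'m::finite \<Rightarrow> real^'d::finite" and Y :: "'m \<Rightarrow> real"
    and \<sigma> :: "real \<Rightarrow> real" and \<alpha> T :: real
    and \<mu>\<^sub>0 :: "'d param measure"
    and P :: "nat \<Rightarrow> 'a measure"
    and p\<^sub>0 :: "nat \<Rightarrow> nat \<Rightarrow> 'a \<Rightarrow> 'd param"
    and z :: "nat \<Rightarrow> nat \<Rightarrow> 'a \<Rightarrow> (real^'d) \<times> real"
  defines "\<pi> \<equiv> empirical UNIV (\<lambda>j. (X j, Y j))"
    and "D \<equiv> skorokhod_topology T (state_topology :: ('d param measure \<times> (real^'m)) topology)"
  assumes "T > 0" and "\<alpha> > 0" and "C2_b \<sigma>"
    and "prob_space \<mu>\<^sub>0" and "sets \<mu>\<^sub>0 = sets borel"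
    and "indep_rvs \<mu>\<^sub>0 borel fst borel snd"
    and "\<exists>K. compact K \<and> (AE (c, w) in \<mu>\<^sub>0. c \<in> K)"
    and "integrable \<mu>\<^sub>0 (\<lambda>(c, w). norm w)"
    and "(\<integral>(c, w). c \<partial>\<mu>\<^sub>0) = 0" and "(\<integral>(c, w). w \<partial>\<mu>\<^sub>0) = 0"
    and "\<And>N. N \<ge> 1 \<Longrightarrow> sgd_inputs (P N) N \<mu>\<^sub>0 \<pi> (p\<^sub>0 N) (z N)"
  shows "\<exists>Q. prob_space Q \<and> sets Q = sets (borel_of D) \<and>
    converges_in_distribution D P
      (\<lambda>N \<omega>. sgd_path \<sigma> \<alpha> T X N (\<lambda>i. p\<^sub>0 N i \<omega>) (\<lambda>k. z N k \<omega>)) Q (\<lambda>\<omega>. \<omega>) \<and>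
    centered_gaussian (distr Q borel (\<lambda>\<omega>. snd (\<omega> 0)))
      (\<chi> i j. \<integral>(c, w). c\<^sup>2 * \<sigma> (w \<bullet> X i) * \<sigma> (w \<bullet> X j) \<partial>\<mu>\<^sub>0) \<and>
    (AE \<omega> in Q. let \<mu> = (\<lambda>t. fst (\<omega> t)); h = (\<lambda>t. snd (\<omega> t)) in
       \<forall>t\<in>{0..T}.
         (\<forall>i. h t $ i = h 0 $ i
           + \<alpha> * (\<integral>s\<in>{0..t}. (1 / CARD('m) * (\<Sum>j\<in>UNIV. (Y j - h s $ j) *
               (\<integral>(c, w). \<sigma> (w \<bullet> X i) * \<sigma> (w \<bullet> X j) \<partial>\<mu> s))) \<partial>lborel)
           + \<alpha> * (\<integral>s\<in>{0..t}. (1 / CARD('m) * (\<Sum>j\<in>UNIV. (Y j - h s $ j) *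
               (\<integral>(c, w). c\<^sup>2 * deriv \<sigma> (w \<bullet> X j) * deriv \<sigma> (w \<bullet> X i) * (X i \<bullet> X j) \<partial>\<mu> s))) \<partial>lborel)) \<and>
         (\<forall>f :: 'd param \<Rightarrow> real. C2_b f \<longrightarrow> (\<integral>q. f q \<partial>\<mu> t) = (\<integral>q. f q \<partial>\<mu>\<^sub>0)))"
proof -
  interpret \<mu>0: prob_space \<mu>\<^sub>0 by fact
  obtain S where S: "S \<ge> 1" "\<And>x. \<bar>\<sigma> x\<bar> \<le> S" "\<And>x. \<bar>deriv \<sigma> x\<bar> \<le> S"
    "\<And>x y. \<bar>\<sigma> x - \<sigma> y\<bar> \<le> S * \<bar>x - y\<bar>" "\<And>x y. \<bar>deriv \<sigma> x - deriv \<sigma> y\<bar> \<le> S * \<bar>x - y\<bar>"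
    "\<And>x y. \<bar>\<sigma> y - \<sigma> x - deriv \<sigma> x * (y - x)\<bar> \<le> S * (y - x)\<^sup>2"
    using C2_b_bounds[OF \<open>C2_b \<sigma>\<close>] by blast
  obtain d where d: "\<And>x. (\<sigma> has_real_derivative deriv \<sigma> x) (at x)" "\<And>x. (deriv \<sigma> has_real_derivative d x) (at x)"
    using C2_b_derivatives[OF \<open>C2_b \<sigma>\<close>] by blast
  have \<sigma>_cont: "continuous_on UNIV \<sigma>" "continuous_on UNIV (deriv \<sigma>)"
    using DERIV_isCont[OF d(1)] DERIV_isCont[OF d(2)] by (auto simp: continuous_on_eq_continuous_at)
  obtain K where K: "compact K" "AE (c, w) in \<mu>\<^sub>0. c \<in> K" using assms(9) by blast
  obtain B0 where B0: "\<And>c. c \<in> K \<Longrightarrow> norm c \<le> B0" using compact_imp_bounded[OF K(1)] unfolding bounded_iff by blast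
  define B where "B = max 1 B0"
  have B: "AE q in \<mu>\<^sub>0. \<bar>fst q\<bar> \<le> B"
    using K(2)
  proof eventually_elim
    case (elim q)
    then have "fst q \<in> K" by (simp add: case_prod_beta)
    then show ?case using B0[of "fst q"] by (simp add: B_def)
  qed
  \<comment> \<open>Sums in place of maxima make \<open>D' \<ge> 1\<close> and the bound on each
    data point immediate.\<close>
  define D' where "D' = 1 + (\<Sum>j\<in>UNIV. norm (X j)) + (\<Sum>j\<in>UNIV. \<bar>Y j\<bar>)"
  have "0 \<le> (\<Sum>j\<in>UNIV. norm (X j))" "0 \<le> (\<Sum>j\<in>UNIV. \<bar>Y j\<bar>)" by (simp_all add: sum_nonneg)
  moreover have "norm (X j) \<le> (\<Sum>j\<in>UNIV. norm (X j))" for j by (rule member_le_sum) auto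
  moreover have "\<bar>Y j\<bar> \<le> (\<Sum>j\<in>UNIV. \<bar>Y j\<bar>)" for j by (rule member_le_sum) auto
  ultimately have D': "D' \<ge> 1" "\<And>j. norm (X j) \<le> D'" "\<And>j. \<bar>Y j\<bar> \<le> D'"
    unfolding D'_def by (simp_all add: add.assoc add_increasing add_increasing2)
  have meas: "f \<in> borel_measurable borel \<Longrightarrow> f \<in> borel_measurable \<mu>\<^sub>0" for f :: "'d param \<Rightarrow> real"
    using measurable_cong_sets[OF \<open>sets \<mu>\<^sub>0 = sets borel\<close> refl] by blast
  have act: "(\<lambda>w :: real^'d. \<sigma> (w \<bullet> x)) \<in> borel_measurable borel" for x
    by (intro borel_measurable_continuous_onI continuous_on_compose2[OF \<sigma>_cont(1)] continuous_intros) auto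
  \<comment> \<open>Independence factors the integral, and the factor of \<open>c\<close>
    vanishes.\<close>
  have mean: "(\<integral>q. fst q * \<sigma> (snd q \<bullet> x) \<partial>\<mu>\<^sub>0) = 0" for x
  proof -
    have "integrable \<mu>\<^sub>0 fst"
      using B by (intro \<mu>0.integrable_const_bound[where B = B] meas borel_measurable_continuous_onI continuous_intros) auto
    moreover have "(\<lambda>q :: 'd param. \<sigma> (snd q \<bullet> x)) \<in> borel_measurable borel"
      by (intro measurable_compose[OF _ act] borel_measurable_continuous_onI continuous_intros)
    then have "integrable \<mu>\<^sub>0 (\<lambda>q. \<sigma> (snd q \<bullet> x))"
      using S(2) by (intro \<mu>0.integrable_const_bound[where B = S] meas) auto
    ultimately have "(\<integral>q. fst q * \<sigma> (snd q \<bullet> x) \<partial>\<mu>\<^sub>0) = (\<integral>q. fst q \<partial>\<mu>\<^sub>0) * (\<integral>q. \<sigma> (snd q \<bullet> x) \<partial>\<mu>\<^sub>0)"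
      using indep_rvs_integral_product[OF \<open>prob_space \<mu>\<^sub>0\<close> \<open>indep_rvs \<mu>\<^sub>0 borel fst borel snd\<close>, of "\<lambda>c. c" "\<lambda>w. \<sigma> (w \<bullet> x)"] act
      by simp
    moreover have "(\<integral>q. fst q \<partial>\<mu>\<^sub>0) = 0" using assms(11) by (simp add: case_prod_beta')
    ultimately show ?thesis by simp
  qed
  interpret sgd_convergence \<sigma> \<alpha> T X Y S D' B \<mu>\<^sub>0 P p\<^sub>0 z
    by unfold_locales (use S D' B mean \<sigma>_cont assms(3,4,6,7,13) in \<open>auto simp: B_def \<pi>_def\<close>)
  have D: "D = path_space" by (simp add: D_def)
  have "0 \<le> (\<Sum>i\<in>UNIV. \<Sum>j\<in>UNIV. u i * u j * initial_covariance i j)" for u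
    unfolding covariance_quadratic by simp
  moreover have "initial_covariance i j = initial_covariance j i" for i j
    by (simp add: initial_covariance_def mult_ac)
  ultimately obtain \<nu> where \<nu>: "centered_gaussian \<nu> (\<chi> i j. initial_covariance i j)"
    using centered_gaussian_exists[of initial_covariance] by blast
  have p\<nu>: "prob_space \<nu>" "sets \<nu> = sets borel" using \<nu> by (auto simp: centered_gaussian_def)
  interpret \<nu>: prob_space \<nu> by fact
  have H: "limit_process \<in> \<nu> \<rightarrow>\<^sub>M borel_of D"
    using continuous_map_measurable_borel_of[OF limit_process_map] measurable_cong_sets[OF p\<nu>(2) refl] unfolding D by blast
  \<comment> \<open>The law of the limit path with Gaussian starting value; the limit process is
    then the identity on path space.\<close>
  define Q where "Q = distr \<nu> (borel_of D) limit_process"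
  have sQ: "sets Q = sets (borel_of D)" by (simp add: Q_def)
  show ?thesis
  proof (intro exI[of _ Q] conjI)
    show "prob_space Q" unfolding Q_def by (rule \<nu>.prob_space_distr[OF H])
    show "sets Q = sets (borel_of D)" by (fact sQ)
    show "converges_in_distribution D P (\<lambda>N \<omega>. sgd_path \<sigma> \<alpha> T X N (\<lambda>i. p\<^sub>0 N i \<omega>) (\<lambda>k. z N k \<omega>)) Q (\<lambda>\<omega>. \<omega>)"
      unfolding converges_in_distribution_def
    proof (intro conjI allI impI)
      show "sgd_process N \<in> P N \<rightarrow>\<^sub>M borel_of D" if "1 \<le> N" for N
        unfolding D by (rule sgd_process_measurable[OF that])
      show "(\<lambda>\<omega>. \<omega>) \<in> Q \<rightarrow>\<^sub>M borel_of D" by (simp add: measurable_cong_sets[OF sQ refl])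
      fix F assume F: "continuous_map D euclideanreal F \<and> bounded (F ` topspace D)"
      have "F \<in> borel_measurable (borel_of D)" using F by (intro continuous_map_borel_measurable) blast
      then have "(\<integral>\<omega>. F \<omega> \<partial>Q) = (\<integral>g. F (limit_process g) \<partial>\<nu>)" unfolding Q_def by (rule integral_distr[OF H])
      then show "(\<lambda>N. \<integral>\<omega>. F (sgd_process N \<omega>) \<partial>P N) \<longlonglongrightarrow> (\<integral>\<omega>. F \<omega> \<partial>Q)"
        using process_converges[OF \<nu>, of F] F unfolding D by simp
    qed
    have "continuous_map D euclidean (snd \<circ> (\<lambda>\<omega>. \<omega> 0))"
      unfolding D by (rule continuous_map_compose[OF continuous_map_skorokhod_eval_0[OF pos(2)] continuous_map_snd])
    then have ev: "(\<lambda>\<omega>. snd (\<omega> 0)) \<in> borel_measurable (borel_of D)"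
      using continuous_map_borel_measurable by (fastforce simp: comp_def)
    have "distr Q borel (\<lambda>\<omega>. snd (\<omega> 0)) = distr \<nu> borel (\<lambda>g. g)"
      unfolding Q_def by (subst distr_distr[OF ev H]) (simp add: comp_def limit_path_at_0[OF \<mu>0_space pos(2)])
    also have "\<dots> = \<nu>" by (rule distr_id2) (simp add: p\<nu>)
    finally show "centered_gaussian (distr Q borel (\<lambda>\<omega>. snd (\<omega> 0)))
      (\<chi> i j. \<integral>(c, w). c\<^sup>2 * \<sigma> (w \<bullet> X i) * \<sigma> (w \<bullet> X j) \<partial>\<mu>\<^sub>0)"
      using \<nu> by (simp add: initial_covariance_def case_prod_beta')
    \<comment> \<open>The equation is verified for members of the range of
      \<open>limit_process\<close>. The complement is open, hence measurable, and its preimage under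
      \<open>limit_process\<close> is empty.\<close>
    have "cadlag_paths T state_space - range limit_process \<in> null_sets Q"
    proof (rule null_setsI)
      show "cadlag_paths T state_space - range limit_process \<in> sets Q"
        unfolding sQ D by (rule openin_in_borel_of[OF openin_compl_limit_path[OF \<mu>0_space pos(2)]])
      then have m: "cadlag_paths T state_space - range limit_process \<in> sets (borel_of D)" unfolding sQ .
      have "limit_process -` (cadlag_paths T state_space - range limit_process) \<inter> space \<nu> = {}" by auto
      then show "emeasure Q (cadlag_paths T state_space - range limit_process) = 0"
        unfolding Q_def by (subst emeasure_distr[OF H m]) simp
    qed
    moreover have "space Q = cadlag_paths T state_space"
      by (simp add: Q_def space_borel_of D topspace_skorokhod_topology)
    ultimately have range: "AE \<omega> in Q. \<omega> \<in> range limit_process"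
      by (intro AE_I'[of "cadlag_paths T state_space - range limit_process"]) auto
    define A1 where "A1 i j = (\<integral>(c, w). \<sigma> (w \<bullet> X i) * \<sigma> (w \<bullet> X j) \<partial>\<mu>\<^sub>0)" for i j
    define A2 where "A2 i j = (\<integral>(c, w). c\<^sup>2 * deriv \<sigma> (w \<bullet> X j) * deriv \<sigma> (w \<bullet> X i) * (X i \<bullet> X j) \<partial>\<mu>\<^sub>0)" for i j
    \<comment> \<open>Separates the two integrals of the equation. The second is obtained as the
      difference of the whole kernel and the first, whose integrability is known from the
      bounds.\<close>
    have A: "limit_kernel i j = A1 i j + A2 i j" for i j
    proof -
      have m1: "(\<lambda>q :: 'd param. \<sigma> (snd q \<bullet> X i) * \<sigma> (snd q \<bullet> X j)) \<in> borel_measurable \<mu>\<^sub>0"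
        by (intro meas borel_measurable_times activation_measurable)
      have "AE q in \<mu>\<^sub>0. norm (\<sigma> (snd q \<bullet> X i) * \<sigma> (snd q \<bullet> X j)) \<le> S * S"
        unfolding real_norm_def by (intro AE_I2 abs_mult_le S)
      with m1 have i1: "integrable \<mu>\<^sub>0 (\<lambda>q. \<sigma> (snd q \<bullet> X i) * \<sigma> (snd q \<bullet> X j))"
        by (intro \<mu>0.integrable_const_bound)
      have "AE q in \<mu>\<^sub>0. norm (tangent_kernel \<sigma> (X i) (X j) q) \<le> kernel_bound"
        unfolding real_norm_def by (rule tangent_kernel_AE_bound)
      then have "integrable \<mu>\<^sub>0 (tangent_kernel \<sigma> (X i) (X j))"
        by (rule \<mu>0.integrable_const_bound) (rule meas[OF tangent_kernel_measurable])
      from Bochner_Integration.integral_diff[OF this i1]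
      have "(\<integral>q. tangent_kernel \<sigma> (X i) (X j) q - \<sigma> (snd q \<bullet> X i) * \<sigma> (snd q \<bullet> X j) \<partial>\<mu>\<^sub>0) = limit_kernel i j - A1 i j"
        by (simp add: limit_kernel_def A1_def case_prod_beta')
      moreover have "(\<integral>q. tangent_kernel \<sigma> (X i) (X j) q - \<sigma> (snd q \<bullet> X i) * \<sigma> (snd q \<bullet> X j) \<partial>\<mu>\<^sub>0) = A2 i j"
        by (simp add: tangent_kernel_def A2_def case_prod_beta')
      ultimately show ?thesis by simp
    qed
    have ode: "limit_h g t $ i = g $ i
        + \<alpha> * (\<integral>s\<in>{0..t}. (1 / CARD('m) * (\<Sum>j\<in>UNIV. (Y j - limit_h g s $ j) * A1 i j)) \<partial>lborel)
        + \<alpha> * (\<integral>s\<in>{0..t}. (1 / CARD('m) * (\<Sum>j\<in>UNIV. (Y j - limit_h g s $ j) * A2 i j)) \<partial>lborel)"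
      if t: "t \<ge> 0" for g t i
    proof -
      have int: "set_integrable lborel {0..t} (\<lambda>s. \<alpha> * (1 / CARD('m) * (\<Sum>j\<in>UNIV. (Y j - limit_h g s $ j) * A' j)))" for A'
        by (intro borel_integrable_atLeastAtMost' continuous_intros continuous_on_component relax_continuous)
      have "(limit_matrix *v ((\<chi> j. Y j) - limit_h g s)) $ i =
          \<alpha> * (1 / CARD('m) * (\<Sum>j\<in>UNIV. (Y j - limit_h g s $ j) * A1 i j)) + \<alpha> * (1 / CARD('m) * (\<Sum>j\<in>UNIV. (Y j - limit_h g s $ j) * A2 i j))" for s
        by (simp add: limit_matrix_def matrix_vector_mult_def A sum_distrib_left sum.distrib[symmetric] algebra_simps add_divide_distrib diff_divide_distrib)
      then show ?thesis
        unfolding relax_integral_equation[OF t, of limit_matrix] by (simp only: set_integral_add(2)[OF int int] set_integral_mult_right)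
    qed
    show "AE \<omega> in Q. let \<mu> = (\<lambda>t. fst (\<omega> t)); h = (\<lambda>t. snd (\<omega> t)) in
       \<forall>t\<in>{0..T}.
         (\<forall>i. h t $ i = h 0 $ i
           + \<alpha> * (\<integral>s\<in>{0..t}. (1 / CARD('m) * (\<Sum>j\<in>UNIV. (Y j - h s $ j) *
               (\<integral>(c, w). \<sigma> (w \<bullet> X i) * \<sigma> (w \<bullet> X j) \<partial>\<mu> s))) \<partial>lborel)
           + \<alpha> * (\<integral>s\<in>{0..t}. (1 / CARD('m) * (\<Sum>j\<in>UNIV. (Y j - h s $ j) *
               (\<integral>(c, w). c\<^sup>2 * deriv \<sigma> (w \<bullet> X j) * deriv \<sigma> (w \<bullet> X i) * (X i \<bullet> X j) \<partial>\<mu> s))) \<partial>lborel)) \<and>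
         (\<forall>f :: 'd param \<Rightarrow> real. C2_b f \<longrightarrow> (\<integral>q. f q \<partial>\<mu> t) = (\<integral>q. f q \<partial>\<mu>\<^sub>0))"
      using range
    proof eventually_elim
      case (elim \<omega>)
      then obtain g where w: "\<omega> = limit_process g" by blast
      have at: "fst (\<omega> t) = \<mu>\<^sub>0" "snd (\<omega> t) = limit_h g t" if "t \<in> {0..T}" for t
        using that by (auto simp: w limit_path_def)
      have at0: "snd (\<omega> 0) = g" using at(2)[of 0] pos(2) by (simp add: relax_0)
      show ?case
        unfolding Let_def
      proof (intro ballI conjI allI impI)
        fix t i assume t: "t \<in> {0..T}"
        have in_T: "s \<in> {0..T}" if "s \<in> {0..t}" for s using t that by auto
        have "(\<integral>s\<in>{0..t}. (1 / CARD('m) * (\<Sum>j\<in>UNIV. (Y j - snd (\<omega> s) $ j) *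
               (\<integral>(c, w). \<sigma> (w \<bullet> X i) * \<sigma> (w \<bullet> X j) \<partial>fst (\<omega> s)))) \<partial>lborel) =
          (\<integral>s\<in>{0..t}. (1 / CARD('m) * (\<Sum>j\<in>UNIV. (Y j - limit_h g s $ j) * A1 i j)) \<partial>lborel)"
          by (rule set_lebesgue_integral_cong) (simp_all add: at[OF in_T] A1_def)
        moreover have "(\<integral>s\<in>{0..t}. (1 / CARD('m) * (\<Sum>j\<in>UNIV. (Y j - snd (\<omega> s) $ j) *
               (\<integral>(c, w). c\<^sup>2 * deriv \<sigma> (w \<bullet> X j) * deriv \<sigma> (w \<bullet> X i) * (X i \<bullet> X j) \<partial>fst (\<omega> s)))) \<partial>lborel) =
          (\<integral>s\<in>{0..t}. (1 / CARD('m) * (\<Sum>j\<in>UNIV. (Y j - limit_h g s $ j) * A2 i j)) \<partial>lborel)"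
          by (rule set_lebesgue_integral_cong) (simp_all add: at[OF in_T] A2_def)
        ultimately show "snd (\<omega> t) $ i = snd (\<omega> 0) $ i
           + \<alpha> * (\<integral>s\<in>{0..t}. (1 / CARD('m) * (\<Sum>j\<in>UNIV. (Y j - snd (\<omega> s) $ j) *
               (\<integral>(c, w). \<sigma> (w \<bullet> X i) * \<sigma> (w \<bullet> X j) \<partial>fst (\<omega> s)))) \<partial>lborel)
           + \<alpha> * (\<integral>s\<in>{0..t}. (1 / CARD('m) * (\<Sum>j\<in>UNIV. (Y j - snd (\<omega> s) $ j) *
               (\<integral>(c, w). c\<^sup>2 * deriv \<sigma> (w \<bullet> X j) * deriv \<sigma> (w \<bullet> X i) * (X i \<bullet> X j) \<partial>fst (\<omega> s)))) \<partial>lborel)"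
          unfolding at0 at(2)[OF t] using ode[of t g i] t by simp
      next
        fix t and f :: "'d param \<Rightarrow> real" assume "t \<in> {0..T}"
        then show "(\<integral>q. f q \<partial>fst (\<omega> t)) = (\<integral>q. f q \<partial>\<mu>\<^sub>0)" by (simp add: at)
      qed
    qed
  qed
qed

end
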